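(* Let $K,L\subsetneqq S^2$ be closed convex sets with interior points. Then the following statements are equivalent. (1) There exists some $\varepsilon>0$ such that for all orientation preserving congruences $\varphi,\psi:S^2\to S^2$ for which $\mathrm{int}\,((\varphi K)\cap(\psi L))\neq\emptyset$ and $\mathrm{diam}\,((\varphi K)\cap(\psi L))\le\varepsilon$, the set $(\varphi K)\cap(\psi L)$ has some non-trivial symmetry. (2) There exists some $\varepsilon>0$ such that for all orientation preserving congruences $\varphi,\psi:S^2\to S^2$ for which $\mathrm{int}\,((\varphi K)\cap(\psi L))\neq\emptyset$ and $\mathrm{diam}\,((\varphi K)\cap(\psi L))\le\varepsilon$, the set $(\varphi K)\cap(\psi L)$ has an axis of symmetry. (3) $K$ and $L$ are two circles, of radii at most $\pi/2$. In particular, if the symmetries in (1) are central symmetries (i.e. (1) holds with "has some non-trivial symmetry" replaced by "is centrally symmetric"), then $K$ and $L$ are two congruent circles of radius at most $\pi/2$.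
   Context: $S^2$ is the unit sphere with its intrinsic metric; $\mathrm{diam}$ denotes diameter. A closed set $K\subset S^2$ with non-empty interior is convex if for any two non-antipodal points of $K$ the shorter great circle arc connecting them lies in $K$. A congruence is an isometry of $S^2$ onto itself. A non-trivial symmetry of a set is a congruence (possibly orientation reversing), different from the identity, mapping the set onto itself. An axis of symmetry of a set is a great circle such that the reflection of $S^2$ in it maps the set onto itself. A set is centrally symmetric if it is invariant under the rotation by angle $\pi$ about some point of $S^2$. When $K$ or $L$ is said to be a circle, the closed disc (closed metric ball, spherical cap) is meant. *)

theory Defs
  imports "HOL-Analysis.Analysis"
begin

abbreviation S2 :: "(real ^ 3) set" where
  "S2 \<equiv> sphere 0 1"

text \<open>The intrinsic (angular) metric of the sphere. All notions below are meant for points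
  and subsets of \<open>S2\<close> only; a map of \<open>S2\<close> is represented by a function on the ambient space
  whose values outside \<open>S2\<close> are irrelevant.\<close>

definition sdist :: "real ^ 3 \<Rightarrow> real ^ 3 \<Rightarrow> real" where
  "sdist x y = arccos (x \<bullet> y)"

definition sdiam :: "(real ^ 3) set \<Rightarrow> real" where
  "sdiam A = (if A = {} then 0 else SUP (x, y) \<in> A \<times> A. sdist x y)"

abbreviation sint :: "(real ^ 3) set \<Rightarrow> (real ^ 3) set" where
  "sint A \<equiv> (top_of_set S2) interior_of A"

text \<open>For non-antipodal \<open>x\<close>, \<open>y\<close> on the sphere the chord misses the centre, and its radial
  projection \<open>z \<mapsto> z / |z|\<close> is the shorter great circle arc.\<close>

definition short_arc :: "real ^ 3 \<Rightarrow> real ^ 3 \<Rightarrow> (real ^ 3) set" where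
  "short_arc x y = sgn ` closed_segment x y"

text \<open>Closedness and non-emptiness of the interior are not included here.\<close>

definition sconvex :: "(real ^ 3) set \<Rightarrow> bool" where
  "sconvex K \<longleftrightarrow> (\<forall>x\<in>K. \<forall>y\<in>K. y \<noteq> - x \<longrightarrow> short_arc x y \<subseteq> K)"

definition congruence :: "(real ^ 3 \<Rightarrow> real ^ 3) \<Rightarrow> bool" where
  "congruence f \<longleftrightarrow> f ` S2 = S2 \<and> (\<forall>x\<in>S2. \<forall>y\<in>S2. sdist (f x) (f y) = sdist x y)"

text \<open>Every congruence is the restriction of a unique orthogonal map of the ambient space; it
  preserves orientation iff that map has determinant 1.\<close>

definition orientation_preserving :: "(real ^ 3 \<Rightarrow> real ^ 3) \<Rightarrow> bool" where
  "orientation_preserving f \<longleftrightarrow> (\<exists>Q :: real ^ 3 ^ 3. rotation_matrix Q \<and> (\<forall>x\<in>S2. f x = Q *v x))"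

definition has_nontrivial_symmetry :: "(real ^ 3) set \<Rightarrow> bool" where
  "has_nontrivial_symmetry A \<longleftrightarrow> (\<exists>f. congruence f \<and> (\<exists>x\<in>S2. f x \<noteq> x) \<and> f ` A = A)"

definition great_circle :: "real ^ 3 \<Rightarrow> (real ^ 3) set" where
  "great_circle u = {x \<in> S2. u \<bullet> x = 0}"

text \<open>Reflection of the sphere in the great circle with poles \<open>u\<close>, \<open>- u\<close> (for a unit vector \<open>u\<close>).\<close>

definition great_circle_reflection :: "real ^ 3 \<Rightarrow> real ^ 3 \<Rightarrow> real ^ 3" where
  "great_circle_reflection u x = x - (2 * (u \<bullet> x)) *\<^sub>R u"

definition axis_of_symmetry :: "(real ^ 3) set \<Rightarrow> (real ^ 3) set \<Rightarrow> bool" where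
  "axis_of_symmetry C A \<longleftrightarrow>
     (\<exists>u\<in>S2. C = great_circle u \<and> great_circle_reflection u ` A = A)"

text \<open>Rotation about \<open>p \<in> S2\<close> by the angle \<open>t\<close> (Rodrigues' formula).\<close>

definition rotation_about :: "real ^ 3 \<Rightarrow> real \<Rightarrow> real ^ 3 \<Rightarrow> real ^ 3" where
  "rotation_about p t x =
     cos t *\<^sub>R x + sin t *\<^sub>R cross3 p x + ((1 - cos t) * (p \<bullet> x)) *\<^sub>R p"

definition centrally_symmetric :: "(real ^ 3) set \<Rightarrow> bool" where
  "centrally_symmetric A \<longleftrightarrow> (\<exists>p\<in>S2. rotation_about p pi ` A = A)"

definition sdisc :: "real ^ 3 \<Rightarrow> real \<Rightarrow> (real ^ 3) set" where
  "sdisc c r = {x \<in> S2. sdist c x \<le> r}"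

definition circle_radius_le_half_pi :: "(real ^ 3) set \<Rightarrow> bool" where
  "circle_radius_le_half_pi K \<longleftrightarrow> (\<exists>c\<in>S2. \<exists>r. 0 < r \<and> r \<le> pi / 2 \<and> K = sdisc c r)"

definition congruent_sets :: "(real ^ 3) set \<Rightarrow> (real ^ 3) set \<Rightarrow> bool" where
  "congruent_sets A B \<longleftrightarrow> (\<exists>f. congruence f \<and> f ` A = B)"

end

theory Submission
  imports Defs
begin

text \<open>Replace \<open>K\<close> and \<open>L\<close> by the convex cones they span; points of their boundaries then carry normal
  cones, and a symmetry of an intersection permutes the extreme rays of these.

  If \<open>K\<close> had a corner, cutting it off by an almost straight piece of the boundary of \<open>L\<close> in a generic
  direction would give arbitrarily small nearly triangular intersections without symmetry. So \<open>K\<close> and \<open>L\<close> are smooth.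

  Gluing caps of \<open>K\<close> and \<open>L\<close> along short chords of equal length gives small intersections with exactly two corners,
  so a symmetry must preserve the pair of corners. Comparing the angles between chord and boundary, either every chord
  of that length in both bodies makes equal angles at its two ends, or all of them make the same pair of
  distinct angles. In the second case moving a chord around the boundary would multiply lengths
  by a factor different from one, which is impossible on a closed curve. So all short chords make equal angles, i.e.
  the difference of the unit normals at \<open>p\<close> and \<open>q\<close> is parallel to \<open>p - q\<close>. Since three points of a sphere are not
  collinear, the unit normal is an affine function \<open>k *\<^sub>R y + a\<close> of the boundary point \<open>y\<close>; being orthogonal
  to \<open>y\<close> it confines the boundary to the plane \<open>a \<bullet> y = - k\<close>.\<close>

section \<open>Convex cones and their normal cones\<close>

text \<open>Passing to cones makes congruences linear: they become orthogonal maps, which act on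
  polars and normal cones, and separation of convex sets applies. It also puts hemispheres and
  lunes, whose cones contain lines, on the same footing as the rest. The obstacle is regularity: no
  curvature of the boundary is available, since a convex boundary without corners has only a
  continuous normal. So all estimates are first order, made uniform by compactness, and chords are
  kept at a fixed small length instead of shrinking to a point. A lens with two corners admits only
  three nontrivial symmetries, two reflections and a half turn, and each is read off from four inner
  products such as \<open>unormal C p \<bullet> q\<close>. The gluing rotation has to preserve
  orientation, so it reverses the chord. The claim on central symmetry needs its own argument, since
  any two discs meet in a set with an axis; there the arc of the smaller circle on the boundary of
  the intersection is followed under the half turn.\<close>

definition cbody :: "'a::euclidean_space set \<Rightarrow> bool" where
  "cbody C \<longleftrightarrow> convex C \<and> closed C \<and> (\<forall>x\<in>C. \<forall>r\<ge>0. r *\<^sub>R x \<in> C) \<and> interior C \<noteq> {} \<and> C \<noteq> UNIV"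

definition polar :: "'a::euclidean_space set \<Rightarrow> 'a set" where
  "polar C = {u. \<forall>y\<in>C. u \<bullet> y \<le> 0}"

text \<open>For \<open>x\<close> in \<open>C\<close> this is the normal cone of \<open>C\<close> at
  \<open>x\<close>: a cone is supported only by hyperplanes through its apex, so the polar cut down
  to the complement of \<open>x\<close> is enough.\<close>

definition normals :: "'a::euclidean_space set \<Rightarrow> 'a \<Rightarrow> 'a set" where
  "normals C x = {u \<in> polar C. u \<bullet> x = 0}"

definition bd :: "'a::euclidean_space set \<Rightarrow> 'a set" where
  "bd C = frontier C \<inter> sphere 0 1"

lemma cbodyD:
  assumes "cbody C"
  shows "convex C" "closed C" "\<And>x r. x \<in> C \<Longrightarrow> 0 \<le> r \<Longrightarrow> r *\<^sub>R x \<in> C" "interior C \<noteq> {}" "C \<noteq> UNIV"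
  using assms by (auto simp: cbody_def)

lemma cbody_zero: "cbody C \<Longrightarrow> 0 \<in> C"
  using cbodyD(3)[of C _ 0] cbodyD(4)[of C] interior_subset by fastforce

lemma cbody_add:
  assumes "cbody C" "x \<in> C" "y \<in> C"
  shows "x + y \<in> C"
proof -
  have "(1/2) *\<^sub>R x + (1/2) *\<^sub>R y \<in> C"
    using cbodyD(1)[OF assms(1)] assms(2,3) by (auto intro: convexD)
  then have "2 *\<^sub>R ((1/2) *\<^sub>R x + (1/2) *\<^sub>R y) \<in> C"
    using cbodyD(3)[OF assms(1), of _ 2] by simp
  then show ?thesis by (simp add: scaleR_add_right)
qed

lemma polarD: "u \<in> polar C \<Longrightarrow> y \<in> C \<Longrightarrow> u \<bullet> y \<le> 0"
  by (simp add: polar_def)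

lemma polar_scale: "u \<in> polar C \<Longrightarrow> 0 \<le> r \<Longrightarrow> r *\<^sub>R u \<in> polar C"
  by (simp add: polar_def mult_nonneg_nonpos)

lemma polar_add: "u \<in> polar C \<Longrightarrow> v \<in> polar C \<Longrightarrow> u + v \<in> polar C"
  by (simp add: polar_def inner_add_left) (meson add_nonpos_nonpos)

text \<open>Moving \<open>c\<close> slightly along \<open>w\<close> stays in \<open>C\<close> and
  adds a positive amount to the inner product, which must still be at most 0.\<close>

lemma polar_interior_neg:
  assumes "w \<in> polar C" "w \<noteq> 0" "c \<in> interior C"
  shows "w \<bullet> c < 0"
proof -
  obtain r where r: "r > 0" "ball c r \<subseteq> C"
    using assms(3) by (meson interior_subset open_contains_ball open_interior subset_trans)
  have "c + (r / 2 / norm w) *\<^sub>R w \<in> ball c r"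
    using r assms(2) by (simp add: dist_norm)
  then have "w \<bullet> (c + (r / 2 / norm w) *\<^sub>R w) \<le> 0"
    using r assms(1) by (auto simp: polar_def)
  moreover have "(r / 2 / norm w) * (w \<bullet> w) > 0"
    using r assms(2) by simp
  ultimately show ?thesis
    by (simp add: inner_add_right)
qed

lemma interior_cone_scale:
  assumes "cbody C" "x \<in> interior C" "r > 0"
  shows "r *\<^sub>R x \<in> interior C"
proof -
  have "(\<lambda>x. r *\<^sub>R x) ` interior C \<subseteq> C"
    using cbodyD(3)[OF assms(1)] interior_subset assms(3) by fastforce
  moreover have "open ((\<lambda>x. r *\<^sub>R x) ` interior C)"
    using assms(3) by (intro open_scaling) auto
  ultimately show ?thesis
    using assms(2) interior_maximal by blast
qed

text \<open>Separation gives \<open>a \<bullet> x \<le> b\<close> on \<open>C\<close>. As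
  \<open>C\<close> contains 0, the bound \<open>b\<close> is nonnegative; as \<open>C\<close>
  contains all positive multiples of its points, the functional is in fact at most 0 on
  \<open>C\<close>.\<close>

lemma polar_support:
  assumes "cbody C" "z \<notin> interior C"
  obtains w where "norm w = 1" "w \<in> polar C" "w \<bullet> z \<ge> 0"
proof -
  have "\<exists>a b. a \<noteq> 0 \<and> (\<forall>x\<in>interior C. inner a x \<le> b) \<and> (\<forall>x\<in>{z}. inner a x \<ge> b)"
    using assms cbodyD(1,4)[OF assms(1)]
    by (intro separating_hyperplane_sets) auto
  then obtain a b where ab: "a \<noteq> 0" "\<And>x. x \<in> interior C \<Longrightarrow> a \<bullet> x \<le> b" "b \<le> a \<bullet> z"
    by auto
  have cl: "C = closure (interior C)"
    using cbodyD[OF assms(1)] convex_closure_interior[of C] by simp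
  have le: "a \<bullet> x \<le> b" if "x \<in> C" for x
  proof -
    have "closure (interior C) \<subseteq> {x. a \<bullet> x \<le> b}"
      using ab(2) by (intro closure_minimal) (auto simp: closed_halfspace_le)
    with cl that show ?thesis by auto
  qed
  have "0 \<le> b"
    using le[OF cbody_zero[OF assms(1)]] by simp
  have neg: "a \<bullet> x \<le> 0" if "x \<in> C" for x
  proof (rule ccontr)
    assume "\<not> a \<bullet> x \<le> 0"
    then have pos: "a \<bullet> x > 0" by simp
    \<comment> \<open>The multiple of \<open>x\<close> at which the functional takes the value
      \<open>b + 1\<close>.\<close>
    then have "((b + 1) / (a \<bullet> x)) *\<^sub>R x \<in> C"
      using cbodyD(3)[OF assms(1) that] \<open>0 \<le> b\<close> by simp
    from le[OF this] pos show False by simp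
  qed
  show ?thesis
  proof
    show "norm (sgn a) = 1" using ab(1) by (simp add: norm_sgn)
    show "sgn a \<in> polar C"
      using neg by (auto simp: polar_def sgn_div_norm mult_nonneg_nonpos)
    show "sgn a \<bullet> z \<ge> 0"
      using ab(3) \<open>0 \<le> b\<close> by (simp add: sgn_div_norm)
  qed
qed

text \<open>Strict version for points outside \<open>C\<close>: the same scaling argument, applied
  to a hyperplane that misses the closed set \<open>C\<close>.\<close>

lemma polar_separate:
  assumes "cbody C" "z \<notin> C"
  obtains w where "norm w = 1" "w \<in> polar C" "w \<bullet> z > 0"
proof -
  obtain a b where ab: "a \<bullet> z < b" "\<And>x. x \<in> C \<Longrightarrow> a \<bullet> x > b"
    using separating_hyperplane_closed_point[OF cbodyD(1,2)[OF assms(1)] assms(2)] by blast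
  have b0: "b < 0"
    using ab(2)[OF cbody_zero[OF assms(1)]] by simp
  have pos: "a \<bullet> x \<ge> 0" if "x \<in> C" for x
  proof (rule ccontr)
    assume "\<not> a \<bullet> x \<ge> 0"
    then have neg: "a \<bullet> x < 0" by simp
    then have "(b / (a \<bullet> x)) *\<^sub>R x \<in> C"
      using cbodyD(3)[OF assms(1) that] b0 by (simp add: divide_nonpos_neg)
    from ab(2)[OF this] neg show False by simp
  qed
  have "a \<noteq> 0" using ab b0 by auto
  show ?thesis
  proof
    show "norm (sgn (-a)) = 1" using \<open>a \<noteq> 0\<close> by (simp add: norm_sgn)
    show "sgn (-a) \<in> polar C"
      using pos by (auto simp: polar_def sgn_div_norm)
    show "sgn (-a) \<bullet> z > 0"
      using ab(1) b0 \<open>a \<noteq> 0\<close> by (simp add: sgn_div_norm mult_pos_neg)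
  qed
qed

text \<open>At an interior apex every nonzero polar vector would have to be negative on 0.\<close>

lemma zero_frontier: "cbody C \<Longrightarrow> 0 \<in> frontier C"
proof -
  assume C: "cbody C"
  have "0 \<notin> interior C"
  proof
    assume "0 \<in> interior C"
    obtain z where "z \<notin> C" using cbodyD(5)[OF C] by auto
    obtain w where "norm w = 1" "w \<in> polar C" by (rule polar_separate[OF C \<open>z \<notin> C\<close>])
    then have "w \<bullet> 0 < 0" using polar_interior_neg[of w C 0] \<open>0 \<in> interior C\<close> by fastforce
    then show False by simp
  qed
  then show ?thesis
    using cbody_zero[OF C] cbodyD(2)[OF C] by (simp add: frontier_def)
qed

lemma normals_iff: "u \<in> normals C x \<longleftrightarrow> u \<in> polar C \<and> u \<bullet> x = 0"
  by (simp add: normals_def)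

lemma normals_scale: "u \<in> normals C x \<Longrightarrow> 0 \<le> r \<Longrightarrow> r *\<^sub>R u \<in> normals C x"
  by (simp add: normals_iff polar_scale)

lemma normals_add: "u \<in> normals C x \<Longrightarrow> v \<in> normals C x \<Longrightarrow> u + v \<in> normals C x"
  by (simp add: normals_iff polar_add inner_add_left)

lemma bd_mem: "cbody C \<Longrightarrow> x \<in> bd C \<Longrightarrow> x \<in> C" 
  using cbodyD(2) frontier_subset_closed by (auto simp: bd_def)

lemma bd_norm: "x \<in> bd C \<Longrightarrow> norm x = 1"
  by (simp add: bd_def)

lemma bd_normal:
  assumes "cbody C" "x \<in> bd C"
  obtains u where "norm u = 1" "u \<in> normals C x"
proof -
  have "x \<notin> interior C" "x \<in> C"
    using assms bd_mem by (auto simp: bd_def frontier_def)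
  obtain w where "norm w = 1" "w \<in> polar C" "w \<bullet> x \<ge> 0" by (rule polar_support[OF assms(1) \<open>x \<notin> interior C\<close>])
  then show ?thesis using that polarD[of w C x] \<open>x \<in> C\<close> by (force simp: normals_iff)
qed

lemma normal_imp_bd:
  assumes "cbody C" "x \<in> C" "norm x = 1" "u \<in> normals C x" "u \<noteq> 0"
  shows "x \<in> bd C"
  using assms polar_interior_neg[of u C x] closure_subset[of C]
  by (auto simp: bd_def frontier_def normals_iff)

lemma compact_bd: "compact (bd C)"
  unfolding bd_def by (simp add: closed_Int_compact)

lemma polar_tendsto:
  assumes "\<And>n. w n \<in> polar C" "w \<longlonglongrightarrow> l"
  shows "l \<in> polar C"
proof -
  have "l \<bullet> y \<le> 0" if "y \<in> C" for y
  proof (rule LIMSEQ_le_const2)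
    show "(\<lambda>n. w n \<bullet> y) \<longlonglongrightarrow> l \<bullet> y" using assms(2) by (intro tendsto_intros)
    show "\<exists>N. \<forall>n\<ge>N. w n \<bullet> y \<le> 0" using assms(1) that by (auto simp: polar_def)
  qed
  then show ?thesis by (simp add: polar_def)
qed

text \<open>The graph of the normal cone map is closed; limits of normals at moving points rely on
  this.\<close>

lemma normals_tendsto:
  assumes "\<And>n. w n \<in> normals C (x n)" "w \<longlonglongrightarrow> l" "x \<longlonglongrightarrow> z"
  shows "l \<in> normals C z"
proof -
  have "l \<in> polar C" using assms(1) by (intro polar_tendsto[OF _ assms(2)]) (simp add: normals_iff)
  moreover have "(\<lambda>n. w n \<bullet> x n) \<longlonglongrightarrow> l \<bullet> z" using assms(2,3) by (intro tendsto_intros)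
  then have "l \<bullet> z = 0" using assms(1) by (simp add: normals_iff LIMSEQ_const_iff)
  ultimately show ?thesis by (simp add: normals_iff)
qed

lemma unit_subseq:
  fixes w :: "nat \<Rightarrow> 'a::euclidean_space"
  assumes "\<And>n. norm (w n) = 1"
  obtains l r where "norm l = 1" "strict_mono (r :: nat \<Rightarrow> nat)" "(w \<circ> r) \<longlonglongrightarrow> l"
proof -
  have "\<forall>n. w n \<in> sphere 0 1" using assms by simp
  then obtain l r where "l \<in> sphere 0 (1::real)" "strict_mono r" "(w \<circ> r) \<longlonglongrightarrow> l"
    using compact_sphere[of "0::'a" 1] unfolding compact_eq_seq_compact_metric seq_compact_def by meson
  then show ?thesis using that by auto
qed

text \<open>The uniform version in \<open>x\<close> and \<open>d\<close> is what makes chords of a fixed small length available everywhere.\<close>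

lemma inward_seq:
  assumes C: "cbody C" and x: "x \<in> C" and xs: "xs \<longlonglongrightarrow> x" and ds: "ds \<longlonglongrightarrow> d" 
    and xsC: "\<And>n. xs n \<in> C" and s: "\<And>n. 0 < s n" and slim: "s \<longlonglongrightarrow> 0"
    and nd: "\<And>w. w \<in> normals C x \<Longrightarrow> w \<noteq> 0 \<Longrightarrow> w \<bullet> d < 0"
  shows "\<exists>n. xs n + s n *\<^sub>R ds n \<in> interior C"
proof (rule ccontr)
  \<comment> \<open>If every point of the sequence misses the interior, supporting vectors
    \<open>w n\<close> at these points have a limit, which is then a normal at \<open>x\<close>
    contradicting \<open>nd\<close>.\<close>
  assume "\<not> ?thesis"
  then have "\<exists>w. norm w = 1 \<and> w \<in> polar C \<and> w \<bullet> (xs n + s n *\<^sub>R ds n) \<ge> 0" for n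
    using polar_support[OF C] by metis
  then obtain w where w: "\<And>n. norm (w n) = 1" "\<And>n. w n \<in> polar C" "\<And>n. w n \<bullet> (xs n + s n *\<^sub>R ds n) \<ge> 0"
    by metis
  obtain l r where l: "norm l = 1" "strict_mono r" "(w \<circ> r) \<longlonglongrightarrow> l"
    by (rule unit_subseq[OF w(1)])
  have xr: "(xs \<circ> r) \<longlonglongrightarrow> x" and dr: "(ds \<circ> r) \<longlonglongrightarrow> d" and sr: "(s \<circ> r) \<longlonglongrightarrow> 0"
    using LIMSEQ_subseq_LIMSEQ[OF xs l(2)] LIMSEQ_subseq_LIMSEQ[OF ds l(2)] LIMSEQ_subseq_LIMSEQ[OF slim l(2)] by blast+
  have lp: "l \<in> polar C"
    using w(2) by (intro polar_tendsto[OF _ l(3)]) auto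
  have "(\<lambda>n. (w \<circ> r) n \<bullet> ((xs \<circ> r) n + (s \<circ> r) n *\<^sub>R (ds \<circ> r) n)) \<longlonglongrightarrow> l \<bullet> (x + 0 *\<^sub>R d)"
    by (intro tendsto_intros l(3) xr dr sr)
  then have "0 \<le> l \<bullet> (x + 0 *\<^sub>R d)"
    by (rule LIMSEQ_le_const) (use w(3) in auto)
  then have "l \<bullet> x = 0" using polarD[OF lp x] by simp
  then have "l \<in> normals C x" using lp by (simp add: normals_iff)
  then have "l \<bullet> d < 0" using nd l(1) by force
  \<comment> \<open>Since \<open>w n\<close> is nonpositive on \<open>xs n\<close>, the nonnegative
    value comes from the increment; dividing by \<open>s n\<close> keeps the information in the
    limit.\<close>
  have "0 \<le> w n \<bullet> ds n" for n
  proof -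
    have "w n \<bullet> xs n \<le> 0" using polarD[OF w(2) xsC] .
    then have "0 \<le> s n * (w n \<bullet> ds n)" using w(3)[of n] by (simp add: inner_add_right)
    then show ?thesis using s[of n] by (simp add: zero_le_mult_iff)
  qed
  moreover have "(\<lambda>n. (w \<circ> r) n \<bullet> (ds \<circ> r) n) \<longlonglongrightarrow> l \<bullet> d"
    by (intro tendsto_intros l(3) dr)
  ultimately have "0 \<le> l \<bullet> d"
    by (intro LIMSEQ_le_const[where X="\<lambda>n. (w \<circ> r) n \<bullet> (ds \<circ> r) n"]) auto
  with \<open>l \<bullet> d < 0\<close> show False by simp
qed

lemma inward_interior:
  assumes C: "cbody C" and x: "x \<in> C"
    and nd: "\<And>w. w \<in> normals C x \<Longrightarrow> w \<noteq> 0 \<Longrightarrow> w \<bullet> d < 0"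
  shows "\<exists>s0>0. \<forall>s. 0 < s \<and> s \<le> s0 \<longrightarrow> x + s *\<^sub>R d \<in> interior C"
proof (rule ccontr)
  assume "\<not> ?thesis"
  then have "\<exists>s. 0 < s \<and> s \<le> 1 / Suc n \<and> x + s *\<^sub>R d \<notin> interior C" for n
    by (smt (verit) of_nat_0_less_iff zero_less_Suc zero_less_divide_1_iff)
  then obtain s where s: "\<And>n. 0 < s n" "\<And>n. s n \<le> 1 / Suc n" "\<And>n. x + s n *\<^sub>R d \<notin> interior C"
    by metis
  have "s \<longlonglongrightarrow> 0"
  proof (rule tendsto_sandwich[OF _ _ tendsto_const])
    show "\<forall>\<^sub>F n in sequentially. 0 \<le> s n" using s(1) by (simp add: less_imp_le)
    show "\<forall>\<^sub>F n in sequentially. s n \<le> 1 / Suc n" using s(2) by simp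
    show "(\<lambda>n. 1 / real (Suc n)) \<longlonglongrightarrow> 0" by (rule LIMSEQ_Suc[OF lim_1_over_n])
  qed
  then show False
    using inward_seq[OF C x tendsto_const[of x] tendsto_const[of d] _ s(1) _ nd] x s(3) by auto
qed

section \<open>Normals of intersections and their images under orthogonal maps\<close>

text \<open>The polar of an intersection is the sum of the polars. Separating the origin from
  \<open>Q\<close> in the product with the real line yields a pair \<open>(z, m)\<close>; a common
  interior point rules out \<open>m = 0\<close>, and division by \<open>m\<close> gives the
  splitting.\<close>

lemma polar_Int:
  fixes C D :: "'a::euclidean_space set"
  assumes C: "cbody C" and D: "cbody D" and I: "interior C \<inter> interior D \<noteq> {}"
    and u: "u \<in> polar (C \<inter> D)"
  obtains v w where "v \<in> polar C" "w \<in> polar D" "u = v + w"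
proof -
  \<comment> \<open>A point of \<open>Q\<close> with first component 0 comes from
    \<open>a = b\<close> in \<open>C \<inter> D\<close>, where \<open>u \<bullet> a\<close> is at
    most 0; hence \<open>(0, 0)\<close> is not in \<open>Q\<close>.\<close>
  define Q where "Q = {(a - b, r) | a b r. a \<in> C \<and> b \<in> D \<and> r < u \<bullet> a}"
  have "convex Q"
  proof (rule convexI)
    fix p q :: "'a \<times> real" and s t :: real
    assume pq: "p \<in> Q" "q \<in> Q" and st: "0 \<le> s" "0 \<le> t" "s + t = 1"
    obtain a b r a' b' r' where 1: "p = (a - b, r)" "a \<in> C" "b \<in> D" "r < u \<bullet> a"
      and 2: "q = (a' - b', r')" "a' \<in> C" "b' \<in> D" "r' < u \<bullet> a'"
      using pq unfolding Q_def by blast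
    have "s *\<^sub>R p + t *\<^sub>R q = ((s *\<^sub>R a + t *\<^sub>R a') - (s *\<^sub>R b + t *\<^sub>R b'), s * r + t * r')"
      by (simp add: 1(1) 2(1) algebra_simps)
    moreover have "s *\<^sub>R a + t *\<^sub>R a' \<in> C" "s *\<^sub>R b + t *\<^sub>R b' \<in> D"
      using 1 2 st cbodyD(1)[OF C] cbodyD(1)[OF D] by (auto intro: convexD)
    moreover have "s * r + t * r' < u \<bullet> (s *\<^sub>R a + t *\<^sub>R a')"
    proof (cases "s = 0")
      case True then show ?thesis using st 2 by simp
    next
      case False
      then have "s * r < s * (u \<bullet> a)" using 1 st by simp
      moreover have "t * r' \<le> t * (u \<bullet> a')" using 2 st by (simp add: mult_left_mono)
      ultimately show ?thesis by (simp add: inner_add_right)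
    qed
    ultimately show "s *\<^sub>R p + t *\<^sub>R q \<in> Q"
      unfolding Q_def by blast
  qed
  moreover have "(0, 0) \<notin> Q"
  proof
    assume "(0, 0) \<in> Q"
    then obtain a b where "a \<in> C" "b \<in> D" "0 = a - b" "0 < u \<bullet> a" unfolding Q_def by auto
    then have "a \<in> C \<inter> D" by simp
    then show False using polarD[OF u] \<open>0 < u \<bullet> a\<close> by fastforce
  qed
  moreover have "Q \<noteq> {}"
  proof -
    have "(0 - 0, -1) \<in> Q" unfolding Q_def using cbody_zero[OF C] cbody_zero[OF D] by force
    then show ?thesis by blast
  qed
  ultimately have "\<exists>a b. a \<noteq> 0 \<and> (\<forall>x\<in>Q. inner a x \<le> b) \<and> (\<forall>x\<in>{(0,0)}. inner a x \<ge> b)"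
    by (intro separating_hyperplane_sets) auto
  then obtain z m where zm: "(z, m) \<noteq> 0" and le: "\<And>x. x \<in> Q \<Longrightarrow> (z, m) \<bullet> x \<le> 0"
    by (force simp: inner_prod_def)
  have ab: "z \<bullet> (a - b) + m * r \<le> 0" if "a \<in> C" "b \<in> D" "r < u \<bullet> a" for a b r
    using le[of "(a - b, r)"] that unfolding Q_def by (force simp: inner_prod_def)
  have "m \<ge> 0"
    using ab[of 0 0 "-1"] cbody_zero[OF C] cbody_zero[OF D] by simp
  \<comment> \<open>The strict inequality \<open>r < u \<bullet> a\<close> in \<open>Q\<close> is
    removed by letting \<open>r\<close> rise; the gap \<open>e / (m + 1)\<close> costs less than
    \<open>e\<close> after multiplication by \<open>m\<close>.\<close>
  have lim: "z \<bullet> (a - b) + m * (u \<bullet> a) \<le> 0" if "a \<in> C" "b \<in> D" for a b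
  proof (rule ccontr)
    define e where "e = z \<bullet> (a - b) + m * (u \<bullet> a)"
    assume "\<not> ?thesis" then have e: "e > 0" by (simp add: e_def)
    then have "m * (e / (m + 1)) < e" using \<open>m \<ge> 0\<close> by (simp add: field_simps)
    moreover have "z \<bullet> (a - b) + m * (u \<bullet> a - e / (m + 1)) \<le> 0"
      using that e \<open>m \<ge> 0\<close> by (intro ab) auto
    ultimately show False unfolding e_def by (simp add: algebra_simps)
  qed
  have zD: "- z \<in> polar D"
    using lim[OF cbody_zero[OF C]] by (auto simp: polar_def)
  have zC: "z + m *\<^sub>R u \<in> polar C"
    using lim[OF _ cbody_zero[OF D]] by (auto simp: polar_def inner_add_left)
  show ?thesis
  proof (cases "m = 0")
    \<comment> \<open>With \<open>m = 0\<close> the vectors \<open>z\<close> and \<open>- z\<close>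
      would be polar to \<open>C\<close> and to \<open>D\<close>, and both negative on a common
      interior point.\<close>
    case True
    then have "z \<noteq> 0" "z \<in> polar C" using zm zC by (auto simp: zero_prod_def)
    obtain c where "c \<in> interior C" "c \<in> interior D" using I by blast
    have "z \<bullet> c < 0" using \<open>z \<noteq> 0\<close> \<open>z \<in> polar C\<close> \<open>c \<in> interior C\<close> by (intro polar_interior_neg)
    moreover have "(- z) \<bullet> c < 0" using \<open>z \<noteq> 0\<close> zD \<open>c \<in> interior D\<close> by (intro polar_interior_neg) auto
    ultimately show ?thesis by simp
  next
    case False
    then have "m > 0" using \<open>m \<ge> 0\<close> by simp
    show ?thesis
    proof
      show "(1/m) *\<^sub>R (z + m *\<^sub>R u) \<in> polar C" "(1/m) *\<^sub>R (- z) \<in> polar D"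
        using \<open>m > 0\<close> by (intro polar_scale zC zD, simp)+
      show "u = (1/m) *\<^sub>R (z + m *\<^sub>R u) + (1/m) *\<^sub>R (- z)"
        using \<open>m > 0\<close> by (simp add: algebra_simps)
    qed
  qed
qed

text \<open>Both summands are nonpositive at \<open>x\<close> and add up to 0 there, so each
  vanishes.\<close>

lemma normals_Int:
  assumes "cbody C" "cbody D" "interior C \<inter> interior D \<noteq> {}" "x \<in> C" "x \<in> D"
    and "u \<in> normals (C \<inter> D) x"
  obtains v w where "v \<in> normals C x" "w \<in> normals D x" "u = v + w"
proof -
  obtain v w where vw: "v \<in> polar C" "w \<in> polar D" "u = v + w"
    by (rule polar_Int[OF assms(1-3)]) (use assms(6) in \<open>auto simp: normals_iff\<close>)
  have "v \<bullet> x \<le> 0" "w \<bullet> x \<le> 0" "v \<bullet> x + w \<bullet> x = 0"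
    using vw assms(4-6) by (auto simp: polarD normals_iff inner_add_left)
  then show ?thesis using vw by (intro that[of v w]) (auto simp: normals_iff)
qed

lemma normals_Int_mono1: "normals C x \<subseteq> normals (C \<inter> D) x"
  by (auto simp: normals_def polar_def)

lemma normals_Int_mono2: "normals D x \<subseteq> normals (C \<inter> D) x"
  by (auto simp: normals_def polar_def)

text \<open>At an interior point of \<open>D\<close> the only normal of \<open>D\<close> is
  0.\<close>

lemma normals_Int_interior:
  assumes "cbody C" "cbody D" "interior C \<inter> interior D \<noteq> {}" "x \<in> C" "x \<in> interior D"
  shows "normals (C \<inter> D) x = normals C x"
proof
  show "normals (C \<inter> D) x \<subseteq> normals C x"
  proof
    fix u assume u: "u \<in> normals (C \<inter> D) x"
    have "x \<in> D" using assms(5) interior_subset by blast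
    obtain v w where vw: "v \<in> normals C x" "w \<in> normals D x" "u = v + w"
      by (rule normals_Int[OF assms(1-4) \<open>x \<in> D\<close> u])
    then have "w = 0" using polar_interior_neg[OF _ _ assms(5), of w] by (force simp: normals_iff)
    with vw show "u \<in> normals C x" by simp
  qed
qed (rule normals_Int_mono1)

lemma orth_inner: "orthogonal_transformation f \<Longrightarrow> f x \<bullet> f y = x \<bullet> y"
  by (simp add: orthogonal_transformation_def)

lemma polar_image:
  assumes "orthogonal_transformation f"
  shows "f u \<in> polar (f ` C) \<longleftrightarrow> u \<in> polar C"
  using assms by (auto simp: polar_def orth_inner)

lemma normals_image:
  assumes "orthogonal_transformation f"
  shows "f u \<in> normals (f ` C) (f x) \<longleftrightarrow> u \<in> normals C x"
  using assms by (simp add: normals_iff polar_image orth_inner)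

lemma orth_interior_image:
  fixes f :: "'a::euclidean_space \<Rightarrow> 'a"
  assumes "orthogonal_transformation f"
  shows "interior (f ` C) = f ` interior C"
  using assms by (intro interior_injective_linear_image)
    (auto simp: orthogonal_transformation_linear orthogonal_transformation_inj)

lemma cbody_image:
  fixes f :: "'a::euclidean_space \<Rightarrow> 'a"
  assumes C: "cbody C" and f: "orthogonal_transformation f"
  shows "cbody (f ` C)"
proof -
  have lin: "linear f" and inj: "inj f" and surj: "surj f"
    using f by (auto simp: orthogonal_transformation_linear orthogonal_transformation_inj orthogonal_transformation_surj)
  have "f ` C \<noteq> UNIV"
    using cbodyD(5)[OF C] inj surj by (metis inj_image_eq_iff)
  moreover have "interior (f ` C) \<noteq> {}"
    using cbodyD(4)[OF C] by (simp add: orth_interior_image[OF f])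
  moreover have "\<forall>x\<in>f ` C. \<forall>r\<ge>0. r *\<^sub>R x \<in> f ` C"
    using cbodyD(3)[OF C] by (auto simp: linear_scale[OF lin, symmetric])
  ultimately show ?thesis
    using C lin inj by (auto simp: cbody_def convex_linear_image closed_injective_linear_image)
qed

lemma orth_norm: "orthogonal_transformation f \<Longrightarrow> norm (f x) = norm x"
  by (simp add: orthogonal_transformation)

lemma bd_image:
  fixes f :: "'a::euclidean_space \<Rightarrow> 'a"
  assumes C: "cbody C" and f: "orthogonal_transformation f"
  shows "f x \<in> bd (f ` C) \<longleftrightarrow> x \<in> bd C"
proof -
  have "closed (f ` C)" using cbodyD(2)[OF cbody_image[OF assms]] .
  then show ?thesis
    using cbodyD(2)[OF C] f
    by (auto simp: bd_def frontier_def orth_interior_image orth_norm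
        inj_image_mem_iff[OF orthogonal_transformation_inj])
qed

text \<open>Symmetries of an intersection map extreme rays of normal cones to extreme rays, and an extreme
  ray of a sum of two cones lies in one of the summands.\<close>

lemma extreme_normal_transfer:
  fixes f :: "'a::euclidean_space \<Rightarrow> 'a"
  assumes C: "cbody C" and E: "cbody E" and I: "interior C \<inter> interior E \<noteq> {}"
    and f: "orthogonal_transformation f" and fM: "f ` (C \<inter> E) = C \<inter> E"
    and x: "x \<in> C \<inter> E" and u: "u \<in> normals (C \<inter> E) x" "u \<noteq> 0"
    and cone: "\<And>w. w \<in> normals (C \<inter> E) x \<Longrightarrow> \<exists>a b. 0 \<le> a \<and> 0 \<le> b \<and> w = a *\<^sub>R u + b *\<^sub>R v"
    and pos: "u \<bullet> c < 0" and v: "v \<bullet> c < 0" and ind: "\<And>r. v \<noteq> r *\<^sub>R u"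
  shows "f u \<in> normals C (f x) \<or> f u \<in> normals E (f x)"
proof -
  have lin: "linear f" using f by (rule orthogonal_transformation_linear)
  have "f x \<in> C \<inter> E" using x fM by blast
  have "f u \<in> normals (C \<inter> E) (f x)" using normals_image[OF f, of u "C \<inter> E" x] u fM by simp
  then obtain w1 w2 where w: "w1 \<in> normals C (f x)" "w2 \<in> normals E (f x)" "f u = w1 + w2"
    using normals_Int[OF C E I] \<open>f x \<in> C \<inter> E\<close> by blast
  \<comment> \<open>The summands of \<open>f u\<close> are pulled back to normals at
    \<open>x\<close>, where they are nonnegative combinations of \<open>u\<close> and
    \<open>v\<close> with sum \<open>u\<close>.\<close>
  obtain z1 z2 where z: "w1 = f z1" "w2 = f z2"
    using orthogonal_transformation_surj[OF f] by (meson surjD)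
  have "f z1 \<in> normals (f ` (C \<inter> E)) (f x)" "f z2 \<in> normals (f ` (C \<inter> E)) (f x)"
    using w z normals_Int_mono1[of C "f x" E] normals_Int_mono2[of E "f x" C] fM by auto
  then have zn: "z1 \<in> normals (C \<inter> E) x" "z2 \<in> normals (C \<inter> E) x"
    using normals_image[OF f] by auto
  obtain a1 b1 a2 b2 where ab: "0 \<le> a1" "0 \<le> b1" "z1 = a1 *\<^sub>R u + b1 *\<^sub>R v"
      "0 \<le> a2" "0 \<le> b2" "z2 = a2 *\<^sub>R u + b2 *\<^sub>R v"
    using cone[OF zn(1)] cone[OF zn(2)] by blast
  have "f u = f (z1 + z2)" using w z by (simp add: linear_add[OF lin])
  then have uz: "u = z1 + z2" using orthogonal_transformation_inj[OF f] by (simp add: inj_eq)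
  have e: "(1 - a1 - a2) *\<^sub>R u = (b1 + b2) *\<^sub>R v"
    using uz ab by (simp add: algebra_simps)
  \<comment> \<open>Since \<open>v\<close> is no multiple of \<open>u\<close>, both coefficients of
    \<open>v\<close> vanish, so one summand is a positive multiple of \<open>u\<close>; its image is
    the same multiple of \<open>f u\<close>.\<close>
  have "b1 + b2 = 0"
  proof (rule ccontr)
    assume b: "b1 + b2 \<noteq> 0"
    have "v = (1 / (b1 + b2)) *\<^sub>R ((b1 + b2) *\<^sub>R v)" using b by simp
    also have "\<dots> = ((1 - a1 - a2) / (b1 + b2)) *\<^sub>R u" by (simp flip: e)
    finally show False using ind by blast
  qed
  then have b0: "b1 = 0" "b2 = 0" using ab by auto
  then have "(1 - a1 - a2) *\<^sub>R u = 0" using e by simp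
  then have "a1 + a2 = 1" using u(2) by simp
  then consider "a1 > 0" | "a2 > 0" using ab by linarith
  then show ?thesis
  proof cases
    case 1
    have "f u = (1/a1) *\<^sub>R w1" using z ab b0 1 by (simp add: linear_scale[OF lin])
    then show ?thesis using normals_scale[OF w(1), of "1/a1"] 1 by simp
  next
    case 2
    have "f u = (1/a2) *\<^sub>R w2" using z ab b0 2 by (simp add: linear_scale[OF lin])
    then show ?thesis using normals_scale[OF w(2), of "1/a2"] 2 by simp
  qed
qed

section \<open>Frames and rotations\<close>

lemma cross3_bilinear:
  fixes a b c :: "real^3"
  shows "cross3 (a + b) c = cross3 a c + cross3 b c" "cross3 a (b + c) = cross3 a b + cross3 a c"
    "cross3 (a - b) c = cross3 a c - cross3 b c" "cross3 a (b - c) = cross3 a b - cross3 a c"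
    "cross3 (r *\<^sub>R a) b = r *\<^sub>R cross3 a b" "cross3 a (r *\<^sub>R b) = r *\<^sub>R cross3 a b"
  by (simp_all add: cross_add_left cross_add_right cross_mult_left cross_mult_right
      Cross3.left_diff_distrib Cross3.right_diff_distrib)

text \<open>The vectors \<open>u\<close> and \<open>v\<close> span the plane orthogonal to
  \<open>x\<close>, so together with \<open>x\<close> they span the space; Lagrange's identity
  replaces a dimension count.\<close>

lemma perp_three_zero:
  fixes u v x e :: "real^3"
  assumes "u \<bullet> x = 0" "v \<bullet> x = 0" "x \<noteq> 0" "cross3 u v \<noteq> 0" "e \<bullet> u = 0" "e \<bullet> v = 0" "e \<bullet> x = 0"
  shows "e = 0"
proof -
  let ?c = "cross3 u v"
  have "cross3 x ?c = 0" using assms(1,2) by (simp add: Lagrange inner_commute)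
  then have "(e \<bullet> ?c) *\<^sub>R x - (e \<bullet> x) *\<^sub>R ?c = 0" using Lagrange[of e x ?c] by simp
  then have "e \<bullet> ?c = 0" using assms(3,7) by simp
  moreover have "cross3 e ?c = 0" using assms(5,6) by (simp add: Lagrange)
  ultimately show ?thesis using norm_and_cross_eq_0[of e ?c] assms(4) by auto
qed

text \<open>The vectors orthogonal to both \<open>x\<close> and \<open>y\<close> form a line; the
  factor comes from expanding the double cross product with \<open>cross3 x y\<close>.\<close>

lemma parallel_cross3:
  fixes v x y :: "real^3"
  assumes "cross3 x y \<noteq> 0" "v \<bullet> x = 0" "v \<bullet> y = 0"
  shows "\<exists>k. v = k *\<^sub>R cross3 x y"
proof -
  let ?n = "cross3 x y"
  have "cross3 ?n (cross3 v ?n) = (?n \<bullet> ?n) *\<^sub>R v - (?n \<bullet> v) *\<^sub>R ?n" by (rule Lagrange)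
  moreover have "cross3 v ?n = 0" using assms by (simp add: Lagrange)
  ultimately have e: "(?n \<bullet> ?n) *\<^sub>R v = (?n \<bullet> v) *\<^sub>R ?n" by simp
  have "v = (1 / (?n \<bullet> ?n)) *\<^sub>R ((?n \<bullet> ?n) *\<^sub>R v)" using assms(1) by simp
  also have "\<dots> = ((?n \<bullet> v) / (?n \<bullet> ?n)) *\<^sub>R ?n" unfolding e by simp
  finally show ?thesis by blast
qed

text \<open>A vanishing cross product is equality in the Cauchy-Schwarz inequality, which for unit
  vectors means equal or opposite.\<close>

lemma unit_cross_nonzero:
  fixes u v :: "real^3"
  assumes "norm u = 1" "norm v = 1" "u \<noteq> v" "u \<noteq> - v"
  shows "cross3 u v \<noteq> 0"
proof
  assume "cross3 u v = 0"
  then have "(u \<bullet> v)\<^sup>2 = 1" using norm_cross[of u v] assms by simp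
  then consider "u \<bullet> v = 1" | "u \<bullet> v = -1" by (auto simp: power2_eq_1_iff)
  then show False
  proof cases
    case 1
    then have "(u - v) \<bullet> (u - v) = 0" using assms(1,2) by (simp add: inner_diff inner_commute norm_eq_1)
    then show ?thesis using assms(3) by simp
  next
    case 2
    then have "(u + v) \<bullet> (u + v) = 0" using assms(1,2) by (simp add: inner_add inner_commute norm_eq_1)
    then show ?thesis using assms(4) by (simp add: eq_neg_iff_add_eq_0)
  qed
qed

lemma cross_indep:
  fixes u v :: "real^3"
  assumes "cross3 u v \<noteq> 0" "a *\<^sub>R u + b *\<^sub>R v = a' *\<^sub>R u + b' *\<^sub>R v"
  shows "a = a'" "b = b'"
proof -
  have e: "(a - a') *\<^sub>R u + (b - b') *\<^sub>R v = 0" using assms(2) by (simp add: algebra_simps)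
  have "cross3 ((a - a') *\<^sub>R u + (b - b') *\<^sub>R v) v = (a - a') *\<^sub>R cross3 u v"
    by (simp add: cross3_bilinear)
  then show "a = a'" using e assms(1) by simp
  have "cross3 u ((a - a') *\<^sub>R u + (b - b') *\<^sub>R v) = (b - b') *\<^sub>R cross3 u v"
    by (simp add: cross3_bilinear)
  then show "b = b'" using e assms(1) by simp
qed

lemma cross_orthonormal:
  fixes a b :: "real^3"
  assumes "norm a = 1" "norm b = 1" "a \<bullet> b = 0"
  shows "norm (cross3 a b) = 1" "cross3 b (cross3 a b) = a" "cross3 (cross3 a b) a = b"
    "cross3 (cross3 a b) b = - a" "cross3 a (cross3 a b) = - b"
proof -
  have "(norm (cross3 a b))\<^sup>2 = 1" using norm_cross[of a b] assms by simp
  then show "norm (cross3 a b) = 1" by (simp add: power2_eq_1_iff) (metis norm_ge_zero not_one_le_zero neg_0_le_iff_le)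
  show b: "cross3 b (cross3 a b) = a" and a: "cross3 a (cross3 a b) = - b"
    using assms by (simp_all add: Lagrange inner_commute norm_eq_1)
  show "cross3 (cross3 a b) b = - a" using b cross_skew[of "cross3 a b" b] by simp
  show "cross3 (cross3 a b) a = b" using a cross_skew[of "cross3 a b" a] by simp
qed

lemma orthonormal_expand:
  fixes a b :: "real^3"
  assumes "norm a = 1" "norm b = 1" "a \<bullet> b = 0"
  shows "z = (z \<bullet> a) *\<^sub>R a + (z \<bullet> b) *\<^sub>R b + (z \<bullet> cross3 a b) *\<^sub>R cross3 a b"
proof -
  let ?c = "cross3 a b"
  let ?e = "z - ((z \<bullet> a) *\<^sub>R a + (z \<bullet> b) *\<^sub>R b + (z \<bullet> ?c) *\<^sub>R ?c)"
  have d: "a \<bullet> a = 1" "b \<bullet> b = 1" "?c \<bullet> ?c = 1" "a \<bullet> ?c = 0" "b \<bullet> ?c = 0" "?c \<bullet> a = 0" "?c \<bullet> b = 0" "b \<bullet> a = 0"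
    using assms cross_orthonormal(1)[OF assms] by (simp_all add: norm_eq_1 dot_cross_self inner_commute)
  have "?e = 0"
    by (rule perp_three_zero[of a ?c b])
       (use assms d cross_orthonormal[OF assms] in \<open>auto simp: inner_diff_left inner_add_left\<close>)
  then show ?thesis by simp
qed

lemma orthonormal_inner:
  fixes a b :: "real^3"
  assumes "norm a = 1" "norm b = 1" "a \<bullet> b = 0"
  shows "x \<bullet> y = (x \<bullet> a) * (y \<bullet> a) + (x \<bullet> b) * (y \<bullet> b) + (x \<bullet> cross3 a b) * (y \<bullet> cross3 a b)"
proof -
  have "x \<bullet> y = ((x \<bullet> a) *\<^sub>R a + (x \<bullet> b) *\<^sub>R b + (x \<bullet> cross3 a b) *\<^sub>R cross3 a b) \<bullet> y"
    using orthonormal_expand[OF assms, of x] by simp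
  then show ?thesis by (simp add: inner_add_left inner_commute[of y])
qed

lemma orthogonal_unit_exists:
  fixes c :: "real^3"
  obtains e where "norm e = 1" "c \<bullet> e = 0"
proof -
  obtain y :: "real^3" where y: "y \<noteq> 0" "orthogonal c y" using orthogonal_to_vector_exists[of c] by auto
  then show ?thesis using that[of "sgn y"] by (auto simp: norm_sgn orthogonal_def sgn_div_norm)
qed

text \<open>Orientation is encoded by compatibility with the cross product, since that is what
  frames give directly; \<open>rot_orientation_preserving\<close> turns it into determinant
  1.\<close>

definition rot :: "(real^3 \<Rightarrow> real^3) \<Rightarrow> bool" where
  "rot g \<longleftrightarrow> orthogonal_transformation g \<and> (\<forall>x y. cross3 (g x) (g y) = g (cross3 x y))"

text \<open>The third vector of each right-handed frame is a cross product, so only two images are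
  prescribed.\<close>

definition frame_map :: "real^3 \<Rightarrow> real^3 \<Rightarrow> real^3 \<Rightarrow> real^3 \<Rightarrow> real^3 \<Rightarrow> real^3" where
  "frame_map a b a' b' z = (z \<bullet> a) *\<^sub>R a' + (z \<bullet> b) *\<^sub>R b' + (z \<bullet> cross3 a b) *\<^sub>R cross3 a' b'"

lemma frame_map:
  assumes "norm a = 1" "norm b = 1" "a \<bullet> b = 0" "norm a' = 1" "norm b' = 1" "a' \<bullet> b' = 0"
  shows "rot (frame_map a b a' b')" "frame_map a b a' b' a = a'" "frame_map a b a' b' b = b'"
proof -
  let ?g = "frame_map a b a' b'" and ?c = "cross3 a b" and ?c' = "cross3 a' b'"
  have d: "a \<bullet> a = 1" "b \<bullet> b = 1" "?c \<bullet> ?c = 1" "a \<bullet> ?c = 0" "b \<bullet> ?c = 0" "?c \<bullet> a = 0" "?c \<bullet> b = 0" "b \<bullet> a = 0"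
    using assms cross_orthonormal(1)[OF assms(1-3)] by (simp_all add: norm_eq_1 dot_cross_self inner_commute)
  have d': "a' \<bullet> a' = 1" "b' \<bullet> b' = 1" "?c' \<bullet> ?c' = 1" "a' \<bullet> ?c' = 0" "b' \<bullet> ?c' = 0" "?c' \<bullet> a' = 0" "?c' \<bullet> b' = 0" "b' \<bullet> a' = 0"
    using assms cross_orthonormal(1)[OF assms(4-6)] by (simp_all add: norm_eq_1 dot_cross_self inner_commute)
  show "?g a = a'" "?g b = b'" using assms d by (simp_all add: frame_map_def)
  have lin: "linear ?g"
    by (rule linearI) (simp_all add: frame_map_def inner_add_left algebra_simps)
  have "?g x \<bullet> ?g y = x \<bullet> y" for x y
    unfolding orthonormal_inner[OF assms(1-3), of x y] 
    by (simp add: frame_map_def inner_add_left inner_add_right d' assms(6))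
  with lin have orth: "orthogonal_transformation ?g" by (simp add: orthogonal_transformation_def)
  \<comment> \<open>The cross product has the same coordinate formula in every right-handed
    orthonormal frame, so a map between two such frames commutes with it.\<close>
  have cr: "cross3 (x1 *\<^sub>R p + x2 *\<^sub>R q + x3 *\<^sub>R cross3 p q) (y1 *\<^sub>R p + y2 *\<^sub>R q + y3 *\<^sub>R cross3 p q)
      = (x2 * y3 - x3 * y2) *\<^sub>R p + (x3 * y1 - x1 * y3) *\<^sub>R q + (x1 * y2 - x2 * y1) *\<^sub>R cross3 p q"
    if "norm p = 1" "norm q = 1" "p \<bullet> q = 0" for p q x1 x2 x3 y1 y2 y3
    using cross_skew[of q p] by (simp add: cross3_bilinear cross_orthonormal[OF that] algebra_simps)
  have "cross3 (?g x) (?g y) = ?g (cross3 x y)" for x y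
  proof -
    define x1 x2 x3 y1 y2 y3 where xy: "x1 = x \<bullet> a" "x2 = x \<bullet> b" "x3 = x \<bullet> ?c" "y1 = y \<bullet> a" "y2 = y \<bullet> b" "y3 = y \<bullet> ?c"
    have "cross3 x y = cross3 (x1 *\<^sub>R a + x2 *\<^sub>R b + x3 *\<^sub>R ?c) (y1 *\<^sub>R a + y2 *\<^sub>R b + y3 *\<^sub>R ?c)"
      using orthonormal_expand[OF assms(1-3), of x] orthonormal_expand[OF assms(1-3), of y] by (simp add: xy)
    also have "\<dots> = (x2 * y3 - x3 * y2) *\<^sub>R a + (x3 * y1 - x1 * y3) *\<^sub>R b + (x1 * y2 - x2 * y1) *\<^sub>R ?c"
      by (rule cr[OF assms(1-3)])
    finally have "?g (cross3 x y) = (x2 * y3 - x3 * y2) *\<^sub>R a' + (x3 * y1 - x1 * y3) *\<^sub>R b' + (x1 * y2 - x2 * y1) *\<^sub>R ?c'"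
      by (simp add: frame_map_def inner_add_left d assms(3))
    moreover have "?g x = x1 *\<^sub>R a' + x2 *\<^sub>R b' + x3 *\<^sub>R ?c'" "?g y = y1 *\<^sub>R a' + y2 *\<^sub>R b' + y3 *\<^sub>R ?c'"
      by (simp_all add: frame_map_def xy)
    ultimately show ?thesis by (simp add: cr[OF assms(4-6)])
  qed
  with orth show "rot ?g" by (simp add: rot_def)
qed

lemma rot_orth: "rot g \<Longrightarrow> orthogonal_transformation g"
  by (simp add: rot_def)

lemma rot_inv:
  assumes "rot g"
  shows "rot (inv g)"
proof -
  have b: "bij g" using assms by (simp add: rot_def orthogonal_transformation_bij)
  have "cross3 (inv g x) (inv g y) = inv g (cross3 x y)" for x y
  proof -
    have "g (cross3 (inv g x) (inv g y)) = cross3 x y"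
      using assms surj_f_inv_f[OF bij_is_surj[OF b]] by (simp add: rot_def flip: assms[unfolded rot_def, THEN conjunct2, rule_format])
    then have "inv g (g (cross3 (inv g x) (inv g y))) = inv g (cross3 x y)" by simp
    then show ?thesis by (simp add: inv_f_f[OF bij_is_inj[OF b]])
  qed
  then show ?thesis using assms by (simp add: rot_def orthogonal_transformation_inv)
qed

text \<open>Diameters are measured by chords here, and one of the two congruences is normalised to the identity.\<close>

definition small_sym :: "real \<Rightarrow> (real^3) set \<Rightarrow> (real^3) set \<Rightarrow> bool" where
  "small_sym \<epsilon> C D \<longleftrightarrow> (\<forall>g. rot g \<longrightarrow> interior (C \<inter> g ` D) \<noteq> {} \<longrightarrow>
     (\<forall>x\<in>C \<inter> g ` D \<inter> sphere 0 1. \<forall>y\<in>C \<inter> g ` D \<inter> sphere 0 1. dist x y \<le> \<epsilon>) \<longrightarrow>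
     (\<exists>f. orthogonal_transformation f \<and> f \<noteq> id \<and> f ` (C \<inter> g ` D) = C \<inter> g ` D))"

text \<open>The inverse rotation carries one intersection to the other, so symmetries are
  transported by conjugation and chord distances do not change.\<close>

lemma small_sym_commute:
  assumes "small_sym \<epsilon> C D"
  shows "small_sym \<epsilon> D C"
  unfolding small_sym_def
proof (intro allI impI)
  fix g
  assume g: "rot g" and ne: "interior (D \<inter> g ` C) \<noteq> {}"
    and sm: "\<forall>x\<in>D \<inter> g ` C \<inter> sphere 0 1. \<forall>y\<in>D \<inter> g ` C \<inter> sphere 0 1. dist x y \<le> \<epsilon>"
  let ?h = "inv g"
  have b: "bij g" and o: "orthogonal_transformation g" using g by (auto simp: rot_def orthogonal_transformation_bij)
  have oh: "orthogonal_transformation ?h" using o by (rule orthogonal_transformation_inv)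
  have hg: "?h (g x) = x" "g (?h x) = x" for x using b by (auto simp: bij_is_inj bij_is_surj surj_f_inv_f)
  have M: "C \<inter> ?h ` D = ?h ` (D \<inter> g ` C)" by (force simp: hg image_iff)
  have M': "D \<inter> g ` C = g ` (C \<inter> ?h ` D)" unfolding M by (force simp: hg image_iff)
  have ne': "interior (C \<inter> ?h ` D) \<noteq> {}" using ne by (simp add: M orth_interior_image[OF oh])
  have sm': "\<forall>x\<in>C \<inter> ?h ` D \<inter> sphere 0 1. \<forall>y\<in>C \<inter> ?h ` D \<inter> sphere 0 1. dist x y \<le> \<epsilon>"
  proof (intro ballI)
    fix x y assume "x \<in> C \<inter> ?h ` D \<inter> sphere 0 1" "y \<in> C \<inter> ?h ` D \<inter> sphere 0 1"
    then have "g x \<in> D \<inter> g ` C \<inter> sphere 0 1" "g y \<in> D \<inter> g ` C \<inter> sphere 0 1"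
      unfolding M' using o by (auto simp: orth_norm)
    then have "dist (g x) (g y) \<le> \<epsilon>" using sm by blast
    moreover have "dist (g x) (g y) = dist x y" 
      using o by (simp add: orthogonal_transformation_isometry)
    ultimately show "dist x y \<le> \<epsilon>" by simp
  qed
  obtain f where f: "orthogonal_transformation f" "f \<noteq> id" "f ` (C \<inter> ?h ` D) = C \<inter> ?h ` D"
    using assms[unfolded small_sym_def, THEN spec, THEN mp, OF rot_inv[OF g], THEN mp, OF ne', THEN mp, OF sm'] by auto
  have "orthogonal_transformation (g \<circ> f \<circ> ?h)"
    using o oh f(1) by (simp add: orthogonal_transformation_compose)
  moreover have "g \<circ> f \<circ> ?h \<noteq> id"
  proof
    assume e: "g \<circ> f \<circ> ?h = id"
    have "f x = x" for x
      using fun_cong[OF e, of "g x"] by (simp add: hg) (metis hg(1))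
    then show False using f(2) by (simp add: fun_eq_iff)
  qed
  moreover have "(g \<circ> f \<circ> ?h) ` (D \<inter> g ` C) = D \<inter> g ` C"
  proof -
    have "?h ` (D \<inter> g ` C) = C \<inter> ?h ` D" using M by simp
    then have "(g \<circ> f \<circ> ?h) ` (D \<inter> g ` C) = g ` (C \<inter> ?h ` D)" using f(3) by (metis image_comp)
    then show ?thesis using M' by simp
  qed
  ultimately show "\<exists>f. orthogonal_transformation f \<and> f \<noteq> id \<and> f ` (D \<inter> g ` C) = D \<inter> g ` C" by blast
qed

section \<open>Smooth points and corners\<close>

definition smooth :: "'a::euclidean_space set \<Rightarrow> bool" where
  "smooth C \<longleftrightarrow> (\<forall>x\<in>bd C. \<forall>u\<in>normals C x. \<forall>v\<in>normals C x. norm u = 1 \<longrightarrow> norm v = 1 \<longrightarrow> u = v)"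

text \<open>The sphere is connected and meets both \<open>C\<close> and its complement, hence the
  frontier.\<close>

lemma bd_nonempty:
  fixes C :: "(real^3) set"
  assumes C: "cbody C"
  shows "bd C \<noteq> {}"
proof -
  obtain c where c: "c \<in> interior C" using cbodyD(4)[OF C] by blast
  have "c \<noteq> 0" using c zero_frontier[OF C] by (auto simp: frontier_def)
  have "c \<in> C" using c interior_subset by blast
  obtain z where z: "z \<notin> C" using cbodyD(5)[OF C] by auto
  have "z \<noteq> 0" using z cbody_zero[OF C] by auto
  have 1: "sgn c \<in> C" using cbodyD(3)[OF C \<open>c \<in> C\<close>, of "inverse (norm c)"] by (simp add: sgn_div_norm divide_inverse)
  have 2: "sgn z \<notin> C"
  proof
    assume "sgn z \<in> C"
    from cbodyD(3)[OF C this, of "norm z"] show False using z \<open>z \<noteq> 0\<close> by (simp add: sgn_div_norm)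
  qed
  have "connected (sphere (0::real^3) 1)" by (simp add: connected_sphere)
  moreover have "sgn c \<in> sphere 0 1 \<inter> C" "sgn z \<in> sphere 0 1 - C"
    using 1 2 \<open>c \<noteq> 0\<close> \<open>z \<noteq> 0\<close> by (auto simp: norm_sgn)
  ultimately have "sphere 0 1 \<inter> frontier C \<noteq> {}"
    by (intro connected_Int_frontier) blast+
  then show ?thesis by (auto simp: bd_def)
qed

text \<open>The frontier point nearest to an interior point is touched by an inscribed ball, and the
  ball leaves only one unit normal there. The centre is pushed far along a frontier ray so that the
  apex is not the nearest point.\<close>

lemma smooth_point_exists:
  fixes D :: "(real^3) set"
  assumes D: "cbody D"
  obtains y u where "y \<in> bd D" "u \<in> normals D y" "norm u = 1" "\<And>w. w \<in> normals D y \<Longrightarrow> norm w = 1 \<Longrightarrow> w = u"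
proof -
  obtain c where c: "c \<in> interior D" using cbodyD(4)[OF D] by blast
  obtain b where b: "b \<in> bd D" using bd_nonempty[OF D] by blast
  have "norm b = 1" using b by (rule bd_norm)
  \<comment> \<open>With this \<open>K\<close> the point \<open>c + K *\<^sub>R b\<close> has norm
    at least \<open>norm c + 1\<close>, while its distance to the frontier point
    \<open>K *\<^sub>R b\<close> is \<open>norm c\<close>; so 0 is not nearest.\<close>
  define K where "K = 2 * norm c + 1"
  have bf: "r *\<^sub>R b \<in> frontier D" if "r > 0" for r
  proof -
    have "r *\<^sub>R b \<in> D" using cbodyD(3)[OF D bd_mem[OF D b]] that by simp
    moreover have "r *\<^sub>R b \<notin> interior D"
    proof
      assume "r *\<^sub>R b \<in> interior D"
      then have "(1/r) *\<^sub>R (r *\<^sub>R b) \<in> interior D" by (rule interior_cone_scale[OF D]) (use that in simp)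
      then show False using b that by (simp add: bd_def frontier_def)
    qed
    ultimately show ?thesis using cbodyD(2)[OF D] by (simp add: frontier_def)
  qed
  define p where "p = c + K *\<^sub>R b"
  have "K > 0" by (simp add: K_def add_nonneg_pos)
  have "closed (frontier D)" "frontier D \<noteq> {}" using b by (auto simp: bd_def)
  then obtain y where y: "y \<in> frontier D" "\<And>z. z \<in> frontier D \<Longrightarrow> dist p y \<le> dist p z"
    using distance_attains_inf[of "frontier D" p] by blast
  have "dist p y \<le> norm c"
    using y(2)[OF bf[OF \<open>K > 0\<close>]] by (simp add: p_def dist_norm)
  moreover have "norm p > norm c"
  proof -
    have "norm (K *\<^sub>R b) \<le> norm p + norm c" unfolding p_def by (metis add_diff_cancel_left' norm_triangle_ineq4)
    then show ?thesis using \<open>norm b = 1\<close> \<open>K > 0\<close> by (simp add: K_def)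
  qed
  ultimately have "y \<noteq> 0" by auto
  have pI: "p \<in> interior D"
  proof -
    have "(\<lambda>x. K *\<^sub>R b + x) ` interior D \<subseteq> D"
    proof
      fix z assume "z \<in> (\<lambda>x. K *\<^sub>R b + x) ` interior D"
      then obtain x where x: "x \<in> interior D" "z = K *\<^sub>R b + x" by blast
      moreover have "K *\<^sub>R b \<in> D" using cbodyD(3)[OF D bd_mem[OF D b]] \<open>K > 0\<close> by simp
      ultimately show "z \<in> D" using cbody_add[OF D] interior_subset by blast
    qed
    then have "(\<lambda>x. K *\<^sub>R b + x) ` interior D \<subseteq> interior D" by (intro interior_maximal open_translation) auto
    then show ?thesis using c unfolding p_def by (metis add.commute image_subset_iff)
  qed
  define R where "R = dist p y"
  have "R > 0" using pI y(1) by (auto simp: R_def frontier_def)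
  have ball: "ball p R \<subseteq> D"
  proof (rule ccontr)
    assume "\<not> ball p R \<subseteq> D"
    then have "ball p R - D \<noteq> {}" by auto
    moreover have "ball p R \<inter> D \<noteq> {}" using pI interior_subset \<open>R > 0\<close> by force
    ultimately have "ball p R \<inter> frontier D \<noteq> {}" by (intro connected_Int_frontier) auto
    then show False using y(2) by (force simp: R_def)
  qed
  then have cball: "cball p R \<subseteq> D"
    using closure_minimal[OF ball cbodyD(2)[OF D]] \<open>R > 0\<close> by simp
  define u where "u = (1/R) *\<^sub>R (y - p)"
  have nu: "norm u = 1" using \<open>R > 0\<close> by (simp add: u_def R_def dist_norm norm_minus_commute)
  \<comment> \<open>The extreme point of the inscribed ball in direction \<open>w\<close> lies in
    \<open>D\<close>, which forces \<open>w \<bullet> u \<ge> 1\<close>, equality in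
    Cauchy-Schwarz.\<close>
  have key: "w = u" if w: "w \<in> normals D y" "norm w = 1" for w
  proof -
    have "p + R *\<^sub>R w \<in> D" using cball w(2) \<open>R > 0\<close> by (auto simp: dist_norm)
    then have "w \<bullet> (p + R *\<^sub>R w) \<le> 0" using w(1) by (auto simp: normals_iff polarD)
    then have "w \<bullet> p \<le> - R" using w(2) by (simp add: inner_add_right norm_eq_1)
    then have "w \<bullet> (y - p) \<ge> R" using w(1) by (simp add: normals_iff inner_diff_right)
    then have "w \<bullet> u \<ge> 1" using \<open>R > 0\<close> by (simp only: u_def inner_scaleR_right) (simp add: field_simps)
    then have "(w - u) \<bullet> (w - u) \<le> 0" using w(2) nu by (simp add: inner_diff inner_commute norm_eq_1)
    then have "(w - u) \<bullet> (w - u) = 0" using inner_ge_zero[of "w - u"] by linarith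
    then show ?thesis by simp
  qed
  have eqn: "normals D (sgn y) = normals D y"
    using \<open>y \<noteq> 0\<close> by (auto simp: normals_iff sgn_div_norm)
  have "sgn y \<in> bd D"
  proof -
    have "y = norm y *\<^sub>R sgn y" by (simp add: sgn_div_norm \<open>y \<noteq> 0\<close>)
    have "y \<in> D" using y(1) cbodyD(2)[OF D] frontier_subset_closed by blast
    then have "sgn y \<in> D" using cbodyD(3)[OF D, of y "inverse (norm y)"] by (simp add: sgn_div_norm divide_inverse)
    moreover have "sgn y \<notin> interior D"
    proof
      assume "sgn y \<in> interior D"
      then have "norm y *\<^sub>R sgn y \<in> interior D" using \<open>y \<noteq> 0\<close> by (intro interior_cone_scale[OF D]) auto
      then show False using y(1) \<open>y = norm y *\<^sub>R sgn y\<close> by (simp add: frontier_def)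
    qed
    ultimately show ?thesis using cbodyD(2)[OF D] \<open>y \<noteq> 0\<close> by (simp add: bd_def frontier_def norm_sgn)
  qed
  moreover obtain w where "norm w = 1" "w \<in> normals D (sgn y)" by (rule bd_normal[OF D \<open>sgn y \<in> bd D\<close>])
  ultimately show ?thesis using key nu eqn by (intro that[of "sgn y" u]) auto
qed

text \<open>Normalising by an interior point \<open>c\<close> cuts the normal cone down to a compact
  convex set on a line, since its elements agree on \<open>x\<close> and on \<open>c\<close>. That
  set is a segment, and its ends span the two extreme rays.\<close>

lemma corner_cone:
  fixes C :: "(real^3) set"
  assumes C: "cbody C" and x: "x \<in> bd C" and n: "n1 \<in> normals C x" "n2 \<in> normals C x" "norm n1 = 1" "norm n2 = 1" "n1 \<noteq> n2"
  obtains u v where "norm u = 1" "norm v = 1" "cross3 u v \<noteq> 0" "u \<in> normals C x" "v \<in> normals C x"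
    "\<And>w. w \<in> normals C x \<Longrightarrow> \<exists>a b. 0 \<le> a \<and> 0 \<le> b \<and> w = a *\<^sub>R u + b *\<^sub>R v"
proof -
  obtain c where c: "c \<in> interior C" using cbodyD(4)[OF C] by blast
  have neg: "w \<bullet> c < 0" if "w \<in> normals C x" "w \<noteq> 0" for w
    using that polar_interior_neg[OF _ _ c] by (simp add: normals_iff)
  define S where "S = {w \<in> normals C x. w \<bullet> c = -1}"
  \<comment> \<open>If \<open>c\<close> were a multiple of \<open>x\<close>, a nonzero normal at
    \<open>x\<close> would vanish on \<open>c\<close>.\<close>
  have xc: "cross3 x c \<noteq> 0"
  proof
    assume "cross3 x c = 0"
    then have "cross3 n1 (cross3 x c) = 0" by simp
    then have "(n1 \<bullet> c) *\<^sub>R x = 0" using n(1) by (simp add: Lagrange normals_iff)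
    moreover have "n1 \<noteq> 0" "x \<noteq> 0" using n(3) bd_norm[OF x] by auto
    ultimately show False using neg[OF n(1)] by auto
  qed
  obtain r where r: "r > 0" "ball c r \<subseteq> C" using c by (meson interior_subset open_contains_ball open_interior subset_trans)
  have "norm w \<le> 2 / r" if "w \<in> S" for w
  proof (cases "w = 0")
    case False
    have "c + (r / 2 / norm w) *\<^sub>R w \<in> ball c r" using r False by (simp add: dist_norm)
    then have "w \<bullet> (c + (r / 2 / norm w) *\<^sub>R w) \<le> 0" using r that by (auto simp: S_def normals_iff polarD)
    then have "r / 2 * norm w \<le> 1" using that False
      by (simp add: S_def inner_add_right power2_norm_eq_inner[symmetric] power2_eq_square)
    then show ?thesis using r by (simp add: field_simps)
  qed (use r in simp)
  then have "bounded S" by (meson boundedI)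
  moreover have "closed S"
  proof -
    have "S = (\<Inter>y\<in>C. {w. y \<bullet> w \<le> 0}) \<inter> {w. x \<bullet> w = 0} \<inter> {w. c \<bullet> w = -1}"
      by (auto simp: S_def normals_iff polar_def inner_commute)
    then show ?thesis by (auto intro!: closed_Int closed_INT closed_halfspace_le closed_hyperplane)
  qed
  ultimately have cS: "compact S" by (simp add: compact_eq_bounded_closed)
  have sS: "(1 / - (w \<bullet> c)) *\<^sub>R w \<in> S" if "w \<in> normals C x" "w \<noteq> 0" for w
  proof -
    have "(1 / - (w \<bullet> c)) *\<^sub>R w \<in> normals C x" using that neg[OF that] by (intro normals_scale) auto
    then show ?thesis using neg[OF that] by (simp add: S_def)
  qed
  have "convex S"
    unfolding S_def by (rule convexI) (auto simp: normals_scale normals_add inner_add_left)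
  moreover have "collinear S"
    unfolding collinear_def
  proof (rule exI[of _ "cross3 x c"], intro ballI)
    fix w w' assume "w \<in> S" "w' \<in> S"
    then have d: "(w - w') \<bullet> x = 0" "(w - w') \<bullet> c = 0" by (auto simp: S_def normals_iff inner_diff_left)
    show "\<exists>k. w - w' = k *\<^sub>R cross3 x c" using parallel_cross3[OF xc d] .
  qed
  moreover have "n1 \<noteq> 0" "n2 \<noteq> 0" using n by auto
  ultimately obtain a b where ab: "S = closed_segment a b"
    using compact_convex_collinear_segment[OF _ cS] sS[OF n(1)] by blast
  have "a \<in> S" "b \<in> S" using ab by auto
  then have a0: "a \<noteq> 0" "b \<noteq> 0" "a \<in> normals C x" "b \<in> normals C x" by (auto simp: S_def)
  \<comment> \<open>Equal ends would leave the cone a single ray, against two distinct unit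
    normals.\<close>
  have "a \<noteq> b"
  proof
    assume "a = b"
    then have "S = {a}" using ab by simp
    then have e: "(1 / - (n1 \<bullet> c)) *\<^sub>R n1 = a" "(1 / - (n2 \<bullet> c)) *\<^sub>R n2 = a"
      using sS[OF n(1) \<open>n1 \<noteq> 0\<close>] sS[OF n(2) \<open>n2 \<noteq> 0\<close>] by simp_all
    have "sgn a = sgn n1" "sgn a = sgn n2"
      using neg[OF n(1) \<open>n1 \<noteq> 0\<close>] neg[OF n(2) \<open>n2 \<noteq> 0\<close>]
      by (subst e(1)[symmetric] e(2)[symmetric], simp add: sgn_scaleR sgn_minus del: scaleR_minus_left)+
    then show False using n(3-5) by (simp add: sgn_div_norm)
  qed
  have un: "norm (sgn a) = 1" "norm (sgn b) = 1" using a0 by (auto simp: norm_sgn)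
  have nn: "sgn a \<in> normals C x" "sgn b \<in> normals C x" using a0 by (auto simp: sgn_div_norm intro!: normals_scale)
  have ne1: "sgn a \<noteq> sgn b"
  proof
    assume e: "sgn a = sgn b"
    have "a = norm a *\<^sub>R sgn a" "b = norm b *\<^sub>R sgn b" using a0 by (simp_all add: sgn_div_norm)
    then have "a = norm a *\<^sub>R sgn a" "b = norm b *\<^sub>R sgn a" by (simp_all only: e)
    then have "a \<bullet> c = norm a * (sgn a \<bullet> c)" "b \<bullet> c = norm b * (sgn a \<bullet> c)" by (metis inner_scaleR_left)+
    then have m: "norm a * (sgn a \<bullet> c) = -1" "norm b * (sgn a \<bullet> c) = -1" using \<open>a \<in> S\<close> \<open>b \<in> S\<close> by (auto simp: S_def)
    then have "sgn a \<bullet> c \<noteq> 0" by auto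
    then have "norm a = norm b" using m by (metis mult_right_cancel)
    then show False using \<open>a = norm a *\<^sub>R sgn a\<close> \<open>b = norm b *\<^sub>R sgn a\<close> \<open>a \<noteq> b\<close> by metis
  qed
  have ne2: "sgn a \<noteq> - sgn b"
    using neg[OF nn(1)] neg[OF nn(2)] un by fastforce
  show ?thesis
  proof
    show "cross3 (sgn a) (sgn b) \<noteq> 0" using unit_cross_nonzero[OF un ne1 ne2] .
    fix w assume w: "w \<in> normals C x"
    show "\<exists>p q. 0 \<le> p \<and> 0 \<le> q \<and> w = p *\<^sub>R sgn a + q *\<^sub>R sgn b"
    proof (cases "w = 0")
      case True then show ?thesis by (intro exI[of _ 0]) simp
    next
      case False
      let ?m = "- (w \<bullet> c)"
      have m: "?m > 0" using neg[OF w False] by simp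
      have "(1 / ?m) *\<^sub>R w \<in> closed_segment a b" using sS[OF w False] ab by simp
      then obtain t where t: "0 \<le> t" "t \<le> 1" "(1 / ?m) *\<^sub>R w = (1 - t) *\<^sub>R a + t *\<^sub>R b"
        unfolding closed_segment_def by blast
      have "w = ?m *\<^sub>R ((1 / ?m) *\<^sub>R w)" using m by simp
      also have "\<dots> = ?m *\<^sub>R ((1 - t) *\<^sub>R a + t *\<^sub>R b)" by (simp only: t(3))
      also have "\<dots> = (?m * (1 - t) * norm a) *\<^sub>R sgn a + (?m * t * norm b) *\<^sub>R sgn b"
      proof -
        have "(k * norm a) *\<^sub>R sgn a = k *\<^sub>R a" "(k * norm b) *\<^sub>R sgn b = k *\<^sub>R b" for k
          using a0 by (simp_all add: sgn_div_norm)
        then show ?thesis by (simp only: scaleR_add_right scaleR_scaleR)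
      qed
      finally have "w = (?m * (1 - t) * norm a) *\<^sub>R sgn a + (?m * t * norm b) *\<^sub>R sgn b" .
      moreover have "0 \<le> ?m * (1 - t) * norm a" "0 \<le> ?m * t * norm b"
        by (rule mult_nonneg_nonneg[OF mult_nonneg_nonneg[OF less_imp_le[OF m]] norm_ge_zero], use t in linarith)+
      ultimately show ?thesis by blast
    qed
  qed (use un nn in auto)
qed

lemma inner_unit_close:
  assumes "norm a = 1" "norm b' = 1"
  shows "\<bar>a \<bullet> b - a' \<bullet> b'\<bar> \<le> norm (a - a') + norm (b - b')"
proof -
  have "a \<bullet> b - a' \<bullet> b' = a \<bullet> (b - b') + (a - a') \<bullet> b'" by (simp add: inner_diff)
  also have "\<bar>\<dots>\<bar> \<le> norm a * norm (b - b') + norm (a - a') * norm b'"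
    by (meson Cauchy_Schwarz_ineq2 abs_triangle_ineq add_mono order_trans)
  finally show ?thesis using assms by simp
qed

section \<open>Normals at points near a smooth point or a corner\<close>

text \<open>Supplies the sequences of counterexamples for compactness arguments by
  contradiction.\<close>

lemma null_seq_choice:
  fixes P :: "real \<Rightarrow> 'a \<Rightarrow> bool"
  assumes "\<And>r. r > 0 \<Longrightarrow> \<exists>z. P r z"
  shows "\<exists>z. \<forall>n. P (1 / Suc n) (z n)"
proof -
  have "\<forall>n. \<exists>z. P (1 / Suc n) z" using assms by simp
  then show ?thesis by (rule choice)
qed

lemma inverse_Suc_tendsto: "(\<lambda>n. 1 / real (Suc n)) \<longlonglongrightarrow> 0"
  by (rule LIMSEQ_Suc[OF lim_1_over_n])

lemma tendsto_of_norm_less: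
  fixes z :: "nat \<Rightarrow> 'a::real_normed_vector"
  assumes "\<And>n. norm (z n - x) < 1 / Suc n"
  shows "z \<longlonglongrightarrow> x"
proof -
  have "(\<lambda>n. z n - x) \<longlonglongrightarrow> 0"
    by (rule Lim_null_comparison[OF _ inverse_Suc_tendsto]) (use less_imp_le[OF assms] in auto)
  then show ?thesis by (simp add: LIM_zero_iff)
qed

text \<open>Otherwise unit normals at points converging to \<open>y\<close> would stay away from
  \<open>u\<close> and yet have a limit, which is a unit normal at \<open>y\<close>.\<close>

lemma normals_near_smooth_point:
  fixes D :: "'a::euclidean_space set"
  assumes u: "\<And>w. w \<in> normals D y \<Longrightarrow> norm w = 1 \<Longrightarrow> w = u" and e: "\<eta> > 0"
  shows "\<exists>r>0. \<forall>z w. norm (z - y) < r \<longrightarrow> w \<in> normals D z \<longrightarrow> norm w = 1 \<longrightarrow> norm (w - u) < \<eta>"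
proof (rule ccontr)
  assume "\<not> ?thesis"
  then have "\<exists>p. norm (fst p - y) < r \<and> snd p \<in> normals D (fst p) \<and> norm (snd p) = 1 \<and> \<not> norm (snd p - u) < \<eta>" if "r > 0" for r
    using that by force
  then have "\<exists>p. \<forall>n. norm (fst (p n) - y) < 1 / Suc n \<and> snd (p n) \<in> normals D (fst (p n)) \<and> norm (snd (p n)) = 1 \<and> \<not> norm (snd (p n) - u) < \<eta>"
    by (rule null_seq_choice)
  then obtain p where p: "\<And>n. norm (fst (p n) - y) < 1 / Suc n \<and> snd (p n) \<in> normals D (fst (p n)) \<and> norm (snd (p n)) = 1 \<and> \<not> norm (snd (p n) - u) < \<eta>"
    by blast
  obtain l r where l: "norm l = 1" "strict_mono r" "((\<lambda>n. snd (p n)) \<circ> r) \<longlonglongrightarrow> l"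
    by (rule unit_subseq[of "\<lambda>n. snd (p n)"]) (use p in auto)
  have "(\<lambda>n. fst (p n)) \<longlonglongrightarrow> y" using p by (intro tendsto_of_norm_less) auto
  then have z: "((\<lambda>n. fst (p n)) \<circ> r) \<longlonglongrightarrow> y" using l(2) by (rule LIMSEQ_subseq_LIMSEQ)
  have "l \<in> normals D y"
    by (rule normals_tendsto[OF _ l(3) z]) (use p in auto)
  then have "l = u" using u l by blast
  then have "(\<lambda>n. norm (((\<lambda>n. snd (p n)) \<circ> r) n - u)) \<longlonglongrightarrow> norm (u - u)" using l(3) by (intro tendsto_intros) (simp add: o_def)
  moreover have "\<exists>N. \<forall>n\<ge>N. \<eta> \<le> norm (((\<lambda>n. snd (p n)) \<circ> r) n - u)" using p by (auto simp: not_less)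
  ultimately have "\<eta> \<le> norm (u - u)" by (rule LIMSEQ_le_const)
  then show False using e by simp
qed

lemma unit_subseq3:
  fixes a b c :: "nat \<Rightarrow> 'a::euclidean_space"
  assumes "\<And>n. norm (a n) = 1" "\<And>n. norm (b n) = 1" "\<And>n. norm (c n) = 1"
  obtains a' b' c' r where "norm a' = 1" "norm b' = 1" "norm c' = 1" "strict_mono (r :: nat \<Rightarrow> nat)"
    "(a \<circ> r) \<longlonglongrightarrow> a'" "(b \<circ> r) \<longlonglongrightarrow> b'" "(c \<circ> r) \<longlonglongrightarrow> c'"
proof -
  obtain a' r1 where 1: "norm a' = 1" "strict_mono (r1 :: nat \<Rightarrow> nat)" "(a \<circ> r1) \<longlonglongrightarrow> a'" using assms(1) by (rule unit_subseq)
  obtain b' r2 where 2: "norm b' = 1" "strict_mono (r2 :: nat \<Rightarrow> nat)" "((b \<circ> r1) \<circ> r2) \<longlonglongrightarrow> b'" 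
    by (rule unit_subseq[of "b \<circ> r1"]) (use assms(2) in auto)
  obtain c' r3 where 3: "norm c' = 1" "strict_mono (r3 :: nat \<Rightarrow> nat)" "((c \<circ> (r1 \<circ> r2)) \<circ> r3) \<longlonglongrightarrow> c'"
    by (rule unit_subseq[of "c \<circ> (r1 \<circ> r2)"]) (use assms(3) in auto)
  have "strict_mono (r1 \<circ> r2 \<circ> r3)" using 1 2 3 by (simp add: strict_mono_o)
  moreover have "(a \<circ> (r1 \<circ> r2 \<circ> r3)) \<longlonglongrightarrow> a'"
    using LIMSEQ_subseq_LIMSEQ[OF 1(3) strict_mono_o[OF 2(2) 3(2)]] by (simp add: o_assoc)
  moreover have "(b \<circ> (r1 \<circ> r2 \<circ> r3)) \<longlonglongrightarrow> b'"
    using LIMSEQ_subseq_LIMSEQ[OF 2(3) 3(2)] by (simp add: o_assoc)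
  moreover have "(c \<circ> (r1 \<circ> r2 \<circ> r3)) \<longlonglongrightarrow> c'"
    using 3(3) by (simp add: o_assoc)
  ultimately show ?thesis using that 1 2 3 by blast
qed

text \<open>If \<open>z\<close> tends to the corner from direction \<open>e\<close>, limits of
  normals at \<open>z\<close> are orthogonal to \<open>e\<close>. A tangent direction is orthogonal
  to at most one of \<open>u\<close> and \<open>v\<close>, so all these limits are that one extreme
  normal. Hence near a corner the only boundary point with widely differing normals is the corner
  itself.\<close>

lemma normals_near_corner:
  fixes C :: "(real^3) set"
  assumes x: "x \<in> C" "norm x = 1"
    and u: "norm u = 1" "norm v = 1" "cross3 u v \<noteq> 0" "u \<in> normals C x" "v \<in> normals C x"
    and cone: "\<And>w. w \<in> normals C x \<Longrightarrow> \<exists>a b. 0 \<le> a \<and> 0 \<le> b \<and> w = a *\<^sub>R u + b *\<^sub>R v"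
    and e: "\<eta> > 0"
  shows "\<exists>r>0. \<forall>z w w'. z \<in> C \<longrightarrow> norm z = 1 \<longrightarrow> z \<noteq> x \<longrightarrow> norm (z - x) < r \<longrightarrow>
    w \<in> normals C z \<longrightarrow> norm w = 1 \<longrightarrow> w' \<in> normals C z \<longrightarrow> norm w' = 1 \<longrightarrow>
    norm (w - w') < \<eta> \<and> (norm (w - u) < \<eta> \<or> norm (w - v) < \<eta>)"
    (is "\<exists>r>0. ?Q r")
proof (rule ccontr)
  assume neg: "\<not> ?thesis"
  have "\<exists>p::(real^3)\<times>(real^3)\<times>(real^3). case p of (z,w,w') \<Rightarrow> z \<in> C \<and> norm z = 1 \<and> z \<noteq> x \<and> norm (z - x) < r \<and>
    w \<in> normals C z \<and> norm w = 1 \<and> w' \<in> normals C z \<and> norm w' = 1 \<and>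
    \<not> (norm (w - w') < \<eta> \<and> (norm (w - u) < \<eta> \<or> norm (w - v) < \<eta>))" if "r > 0" for r
  proof -
    have "\<not> ?Q r" using neg that by blast
    then show ?thesis unfolding split_paired_Ex by auto
  qed
  then have "\<exists>p. \<forall>n. case p n of (z,w,w') \<Rightarrow> z \<in> C \<and> norm z = 1 \<and> z \<noteq> x \<and> norm (z - x) < 1 / Suc n \<and>
    w \<in> normals C z \<and> norm w = 1 \<and> w' \<in> normals C z \<and> norm w' = 1 \<and>
    \<not> (norm (w - w') < \<eta> \<and> (norm (w - u) < \<eta> \<or> norm (w - v) < \<eta>))"
    by (rule null_seq_choice)
  then obtain p :: "nat \<Rightarrow> (real^3)\<times>(real^3)\<times>(real^3)" where p: "\<And>n. case p n of (z,w,w') \<Rightarrow> z \<in> C \<and> norm z = 1 \<and> z \<noteq> x \<and> norm (z - x) < 1 / Suc n \<and>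
    w \<in> normals C z \<and> norm w = 1 \<and> w' \<in> normals C z \<and> norm w' = 1 \<and>
    \<not> (norm (w - w') < \<eta> \<and> (norm (w - u) < \<eta> \<or> norm (w - v) < \<eta>))"
    by blast
  define z where "z = (\<lambda>n. fst (p n))"
  define w where "w = (\<lambda>n. fst (snd (p n)))"
  define w' where "w' = (\<lambda>n. snd (snd (p n)))"
  define d where "d = (\<lambda>n. sgn (z n - x))"
  have zw: "z n \<in> C" "norm (z n) = 1" "z n \<noteq> x" "norm (z n - x) < 1 / Suc n" "w n \<in> normals C (z n)" "norm (w n) = 1"
      "w' n \<in> normals C (z n)" "norm (w' n) = 1"
      "\<not> (norm (w n - w' n) < \<eta> \<and> (norm (w n - u) < \<eta> \<or> norm (w n - v) < \<eta>))" for n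
    using p[of n] by (auto simp: z_def w_def w'_def split: prod.splits)
  have nd: "norm (d n) = 1" for n using zw(3) by (simp add: d_def norm_sgn)
  obtain l l' e r where lim: "norm l = 1" "norm l' = 1" "norm e = 1" "strict_mono (r :: nat \<Rightarrow> nat)"
    "(w \<circ> r) \<longlonglongrightarrow> l" "(w' \<circ> r) \<longlonglongrightarrow> l'" "(d \<circ> r) \<longlonglongrightarrow> e"
    using zw(6,8) nd by (rule unit_subseq3)
  have zl: "z \<longlonglongrightarrow> x" by (rule tendsto_of_norm_less) (rule zw(4))
  have zr: "(z \<circ> r) \<longlonglongrightarrow> x" using zl lim(4) by (rule LIMSEQ_subseq_LIMSEQ)
  have ln: "l \<in> normals C x" "l' \<in> normals C x"
    by (rule normals_tendsto[OF _ lim(5) zr], use zw in simp, rule normals_tendsto[OF _ lim(6) zr], use zw in simp)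
  \<comment> \<open>Normals at \<open>x\<close> are tested on the points \<open>z n\<close>, and
    normals at \<open>z n\<close> on \<open>x\<close>; the two signs together make limit normals
    vanish on \<open>e\<close>.\<close>
  have dC: "m \<bullet> e \<le> 0" if "m \<in> normals C x" for m
  proof (rule LIMSEQ_le_const2)
    show "(\<lambda>n. m \<bullet> (d \<circ> r) n) \<longlonglongrightarrow> m \<bullet> e" by (intro tendsto_intros lim)
    have "m \<bullet> z n \<le> 0" "m \<bullet> x = 0" for n using that zw(1) by (auto simp: normals_iff polarD)
    then have "m \<bullet> d n \<le> 0" for n by (simp add: d_def sgn_div_norm inner_diff_right mult_nonneg_nonpos)
    then show "\<exists>N. \<forall>n\<ge>N. m \<bullet> (d \<circ> r) n \<le> 0" by simp
  qed
  have dpos: "q \<bullet> e \<ge> 0" if "\<And>n. m n \<in> normals C (z n)" "(m \<circ> r) \<longlonglongrightarrow> q" for q m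
  proof (rule LIMSEQ_le_const)
    show "(\<lambda>n. (m \<circ> r) n \<bullet> (d \<circ> r) n) \<longlonglongrightarrow> q \<bullet> e" by (intro tendsto_intros lim that)
    have "m n \<bullet> x \<le> 0" "m n \<bullet> z n = 0" for n using that(1)[of n] polarD[of "m n" C x] x(1) by (auto simp: normals_iff)
    then have "m n \<bullet> d n \<ge> 0" for n by (simp add: d_def sgn_div_norm inner_diff_right mult_nonneg_nonpos)
    then show "\<exists>N. \<forall>n\<ge>N. 0 \<le> (m \<circ> r) n \<bullet> (d \<circ> r) n" by simp
  qed
  have le: "l \<bullet> e = 0" "l' \<bullet> e = 0"
    using dC[OF ln(1)] dC[OF ln(2)] dpos[OF zw(5) lim(5)] dpos[OF zw(7) lim(6)] by auto
  \<comment> \<open>Secants of the sphere become tangent in the limit: the radial part of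
    \<open>d n\<close> is minus half the distance.\<close>
  have ex: "e \<bullet> x = 0"
  proof -
    have "d n \<bullet> x = - norm (z n - x) / 2" for n
    proof -
      have "(z n - x) \<bullet> x = - (norm (z n - x))\<^sup>2 / 2"
        using zw(2)[of n] x(2) by (simp add: power2_norm_eq_inner inner_diff inner_commute norm_eq_1)
      moreover have "norm (z n - x) \<noteq> 0" using zw(3) by simp
      ultimately show ?thesis unfolding d_def sgn_div_norm inner_scaleR_left by (simp add: power2_eq_square field_simps)
    qed
    then have "(\<lambda>n. (d \<circ> r) n \<bullet> x) = (\<lambda>n. - norm ((z \<circ> r) n - x) / 2)" by auto
    moreover have "(\<lambda>n. - norm ((z \<circ> r) n - x) / 2) \<longlonglongrightarrow> - norm (x - x) / 2" by (intro tendsto_intros zr) auto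
    moreover have "(\<lambda>n. (d \<circ> r) n \<bullet> x) \<longlonglongrightarrow> e \<bullet> x" by (intro tendsto_intros lim)
    ultimately show ?thesis using LIMSEQ_unique by force
  qed
  have ux: "u \<bullet> x = 0" "v \<bullet> x = 0" using u by (auto simp: normals_iff)
  have nz: "x \<noteq> 0" using x by auto
  have not_both: "\<not> (u \<bullet> e = 0 \<and> v \<bullet> e = 0)"
  proof
    assume "u \<bullet> e = 0 \<and> v \<bullet> e = 0"
    then have "e = 0" using perp_three_zero[OF ux nz u(3), of e] ex by (simp add: inner_commute)
    then show False using lim(3) by simp
  qed
  \<comment> \<open>Both \<open>u\<close> and \<open>v\<close> are nonpositive on \<open>e\<close>,
    so a normal vanishing on \<open>e\<close> is carried by the extreme ray that vanishes
    there.\<close>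
  have ext: "(q = u \<and> u \<bullet> e = 0) \<or> (q = v \<and> v \<bullet> e = 0)" if q: "q \<in> normals C x" "norm q = 1" "q \<bullet> e = 0" for q
  proof -
    obtain a b where ab: "0 \<le> a" "0 \<le> b" "q = a *\<^sub>R u + b *\<^sub>R v" using cone[OF q(1)] by blast
    have "a * (u \<bullet> e) + b * (v \<bullet> e) = 0" using q(3) ab by (simp add: inner_add_left)
    moreover have "a * (u \<bullet> e) \<le> 0" "b * (v \<bullet> e) \<le> 0" using dC u ab by (auto simp: mult_nonneg_nonpos)
    ultimately have z: "a * (u \<bullet> e) = 0" "b * (v \<bullet> e) = 0" by linarith+
    then consider "b = 0" "a \<noteq> 0" "u \<bullet> e = 0" | "a = 0" "b \<noteq> 0" "v \<bullet> e = 0" using not_both q(2) ab(3) by (cases "a = 0"; cases "b = 0") auto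
    then show ?thesis
    proof cases
      case 1 then show ?thesis using ab q(2) u(1) by auto
    next
      case 2 then show ?thesis using ab q(2) u(2) by auto
    qed
  qed
  have l1: "l = u \<or> l = v" and l2: "l = l'"
    using ext[OF ln(1) lim(1) le(1)] ext[OF ln(2) lim(2) le(2)] not_both by auto
  have "(\<lambda>n. norm ((w \<circ> r) n - (w' \<circ> r) n)) \<longlonglongrightarrow> norm (l - l')" by (intro tendsto_intros lim)
  then have E1: "\<forall>\<^sub>F n in sequentially. norm ((w \<circ> r) n - (w' \<circ> r) n) < \<eta>" using l2 e by (auto elim: order_tendstoD)
  have "(\<lambda>n. norm ((w \<circ> r) n - l)) \<longlonglongrightarrow> norm (l - l)" by (intro tendsto_intros lim)
  then have E2: "\<forall>\<^sub>F n in sequentially. norm ((w \<circ> r) n - l) < \<eta>" using e by (auto elim: order_tendstoD)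
  obtain n where "norm ((w \<circ> r) n - (w' \<circ> r) n) < \<eta>" "norm ((w \<circ> r) n - l) < \<eta>"
    using eventually_happens'[OF _ eventually_conj[OF E1 E2]] by auto
  then show False using zw(9)[of "r n"] l1 by auto
qed

text \<open>A limit of counterexamples is annihilated by \<open>u\<close> and \<open>v\<close>,
  hence a nonnegative multiple of \<open>x\<close>, hence \<open>x\<close>. This confines the
  triangle cut off at a corner.\<close>

lemma near_vertex:
  fixes u v x :: "real^3"
  assumes "u \<bullet> x = 0" "v \<bullet> x = 0" "norm x = 1" "cross3 u v \<noteq> 0" "\<rho> > 0"
  shows "\<exists>\<tau>>0. \<forall>z. norm z = 1 \<longrightarrow> z \<bullet> x \<ge> 0 \<longrightarrow> \<bar>u \<bullet> z\<bar> \<le> \<tau> \<longrightarrow> \<bar>v \<bullet> z\<bar> \<le> \<tau> \<longrightarrow> norm (z - x) < \<rho>"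
proof (rule ccontr)
  assume "\<not> ?thesis"
  then have "\<exists>z. norm z = 1 \<and> z \<bullet> x \<ge> 0 \<and> \<bar>u \<bullet> z\<bar> \<le> r \<and> \<bar>v \<bullet> z\<bar> \<le> r \<and> \<not> norm (z - x) < \<rho>" if "r > 0" for r
    using that by blast
  then have "\<exists>z. \<forall>n. norm (z n) = 1 \<and> z n \<bullet> x \<ge> 0 \<and> \<bar>u \<bullet> z n\<bar> \<le> 1 / Suc n \<and> \<bar>v \<bullet> z n\<bar> \<le> 1 / Suc n \<and> \<not> norm (z n - x) < \<rho>"
    by (rule null_seq_choice)
  then obtain z where z: "\<And>n. norm (z n) = 1 \<and> z n \<bullet> x \<ge> 0 \<and> \<bar>u \<bullet> z n\<bar> \<le> 1 / Suc n \<and> \<bar>v \<bullet> z n\<bar> \<le> 1 / Suc n \<and> \<not> norm (z n - x) < \<rho>"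
    by blast
  obtain l r where l: "norm l = 1" "strict_mono r" "(z \<circ> r) \<longlonglongrightarrow> l"
    by (rule unit_subseq[of z]) (use z in auto)
  have nl: "(\<lambda>n. q \<bullet> z n) \<longlonglongrightarrow> 0" if "\<And>n. \<bar>q \<bullet> z n\<bar> \<le> 1 / Suc n" for q
    by (rule Lim_null_comparison[OF _ inverse_Suc_tendsto]) (use that in auto)
  have "(\<lambda>n. u \<bullet> (z \<circ> r) n) \<longlonglongrightarrow> u \<bullet> l" "(\<lambda>n. v \<bullet> (z \<circ> r) n) \<longlonglongrightarrow> v \<bullet> l" by (intro tendsto_intros l)+
  moreover have "(\<lambda>n. u \<bullet> (z \<circ> r) n) \<longlonglongrightarrow> 0" "(\<lambda>n. v \<bullet> (z \<circ> r) n) \<longlonglongrightarrow> 0"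
    using LIMSEQ_subseq_LIMSEQ[OF nl l(2), of u] LIMSEQ_subseq_LIMSEQ[OF nl l(2), of v] z by (auto simp: o_def)
  ultimately have ul: "u \<bullet> l = 0" "v \<bullet> l = 0" using LIMSEQ_unique by blast+
  have "(\<lambda>n. (z \<circ> r) n \<bullet> x) \<longlonglongrightarrow> l \<bullet> x" by (intro tendsto_intros l)
  then have lx: "l \<bullet> x \<ge> 0" by (rule LIMSEQ_le_const) (use z in auto)
  have "x \<noteq> 0" using assms(3) by auto
  have "l - (l \<bullet> x) *\<^sub>R x = 0"
    using assms(1-3) ul by (intro perp_three_zero[OF assms(1,2) \<open>x \<noteq> 0\<close> assms(4)])
      (auto simp: inner_diff_left inner_diff_right inner_commute norm_eq_1)
  then have le: "l = (l \<bullet> x) *\<^sub>R x" by simp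
  then have "norm l = \<bar>l \<bullet> x\<bar>" using assms(3) by (metis mult.right_neutral norm_scaleR)
  then have "l \<bullet> x = 1" using lx l(1) by simp
  then have "l = x" using le by simp
  have "(\<lambda>n. norm ((z \<circ> r) n - x)) \<longlonglongrightarrow> norm (l - x)" by (intro tendsto_intros l)
  then have "\<rho> \<le> norm (l - x)" by (rule LIMSEQ_le_const) (use z in \<open>auto simp: not_less\<close>)
  then show False using \<open>l = x\<close> assms(5) by simp
qed

lemma interior_Int_nonempty:
  fixes C :: "'a::euclidean_space set"
  assumes "cbody C" "x \<in> C" "x \<in> interior E"
  shows "interior C \<inter> interior E \<noteq> {}"
proof -
  have "C = closure (interior C)" using cbodyD[OF assms(1)] convex_closure_interior[of C] by simp
  then show ?thesis
    using assms open_Int_closure_eq_empty[of "interior E" "interior C"] by (auto simp: Int_commute)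
qed

text \<open>The inverse \<open>h\<close> also has nonnegative coefficients, and a nonnegative matrix
  with nonnegative inverse permutes the rays; preservation of norms removes the scaling.\<close>

lemma extreme_permuted:
  fixes f :: "real^3 \<Rightarrow> real^3"
  assumes f: "linear f" "inj f" and fu: "f u \<in> N" and hu: "h u \<in> N" "f (h u) = u" and hv: "h v \<in> N" "f (h v) = v"
    and fn: "\<And>x. norm (f x) = norm x"
    and n: "norm u = 1" "norm v = 1" "cross3 u v \<noteq> 0"
    and cone: "\<And>w. w \<in> N \<Longrightarrow> \<exists>a b. 0 \<le> a \<and> 0 \<le> b \<and> w = a *\<^sub>R u + b *\<^sub>R v"
  shows "f u = u \<or> f u = v"
proof -
  obtain a b where ab: "0 \<le> a" "0 \<le> b" "f u = a *\<^sub>R u + b *\<^sub>R v" using cone[OF fu] by blast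
  obtain p q where pq: "0 \<le> p" "0 \<le> q" "h u = p *\<^sub>R u + q *\<^sub>R v" using cone[OF hu(1)] by blast
  obtain p' q' where pq': "0 \<le> p'" "0 \<le> q'" "h v = p' *\<^sub>R u + q' *\<^sub>R v" using cone[OF hv(1)] by blast
  have "f u = f (a *\<^sub>R h u + b *\<^sub>R h v)" using ab hu hv by (simp add: linear_add[OF f(1)] linear_scale[OF f(1)])
  then have "u = a *\<^sub>R h u + b *\<^sub>R h v" using f(2) by (simp add: inj_eq)
  then have "1 *\<^sub>R u + 0 *\<^sub>R v = (a * p + b * p') *\<^sub>R u + (a * q + b * q') *\<^sub>R v"
    using pq pq' by (simp add: algebra_simps)
  then have "0 = a * q + b * q'" by (rule cross_indep(2)[OF n(3)])
  moreover have "a * q \<ge> 0" "b * q' \<ge> 0" using ab pq pq' by auto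
  ultimately have z: "a * q = 0" "b * q' = 0" by linarith+
  have nh: "norm (h u) = 1" "norm (h v) = 1" using fn[of "h u"] fn[of "h v"] hu hv n by auto
  have "a \<noteq> 0 \<or> b \<noteq> 0" using ab fn[of u] n by auto
  then show ?thesis
  proof
    assume "a \<noteq> 0"
    then have "q = 0" using z by simp
    then have "h u = p *\<^sub>R u" using pq by simp
    then have "p = 1" using nh(1) n(1) pq(1) by simp
    then show ?thesis using \<open>h u = p *\<^sub>R u\<close> hu by simp
  next
    assume "b \<noteq> 0"
    then have "q' = 0" using z by simp
    then have "h v = p' *\<^sub>R u" using pq' by simp
    then have "p' = 1" using nh(2) n(1) pq'(1) by simp
    then show ?thesis using \<open>h v = p' *\<^sub>R u\<close> hv by simp
  qed
qed

lemma orth_fix_three: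
  fixes f :: "real^3 \<Rightarrow> real^3"
  assumes f: "orthogonal_transformation f" and "f x = x" "f u = u" "f v = v"
    and "u \<bullet> x = 0" "v \<bullet> x = 0" "x \<noteq> 0" "cross3 u v \<noteq> 0"
  shows "f = id"
proof
  fix z
  have "f z \<bullet> q = z \<bullet> q" if "f q = q" for q using orth_inner[OF f, of z q] that by simp
  then have "f z - z = 0"
    using assms by (intro perp_three_zero[of u x v]) (auto simp: inner_diff_left)
  then show "f z = id z" by simp
qed

text \<open>Excludes the two values at which the cut in \<open>corner_direction\<close> could make
  an angle at another corner equal to the angle at \<open>x\<close>.\<close>

lemma generic_direction:
  fixes c :: real
  assumes "\<bar>c\<bar> < 1"
  obtains l where "\<bar>c\<bar> < l" "l < 1" "1 + 2 * l * c \<noteq> 0" "l + 2 * c \<noteq> 0"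
proof -
  have "infinite ({\<bar>c\<bar><..<1} - {- 1 / (2 * c), - 2 * c})" using assms by (intro Diff_infinite_finite) auto
  then obtain l where l: "l \<in> {\<bar>c\<bar><..<1} - {- 1 / (2 * c), - 2 * c}" by (metis finite.emptyI ex_in_conv)
  have "1 + 2 * l * c \<noteq> 0"
  proof
    assume "1 + 2 * l * c = 0"
    then have "c \<noteq> 0" "l * (2 * c) = - 1" by (auto simp: algebra_simps)
    then have "l = - 1 / (2 * c)" using nonzero_eq_divide_eq[of "2 * c" l "-1"] by simp
    then show False using l by simp
  qed
  then show ?thesis using l by (intro that[of l]) auto
qed

section \<open>Corners\<close>

text \<open>Here \<open>k\<close> is the outer normal of the cut, and it also points into the body:
  \<open>l > \<bar>u \<bullet> v\<bar>\<close> makes it negative on both normals. As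
  \<open>l < 1\<close>, the cut is asymmetric, so swapping \<open>u\<close> and \<open>v\<close>
  moves \<open>k\<close> to another vector \<open>k'\<close>; the generic choice of \<open>l\<close>
  keeps the angles at the other two corners different from the one at \<open>x\<close>.\<close>

lemma corner_direction:
  fixes u v x :: "real^3"
  assumes "norm u = 1" "norm v = 1" "cross3 u v \<noteq> 0" "u \<bullet> x = 0" "v \<bullet> x = 0"
  obtains k k' l N where "norm k = 1" "norm k' = 1" "k \<bullet> x = 0" "k' \<bullet> x = 0" "k \<noteq> k'" "N > 0" "l > 0"
    "N *\<^sub>R k = - (u + l *\<^sub>R v)" "N *\<^sub>R k' = - (v + l *\<^sub>R u)"
    "k \<bullet> u < 0" "k \<bullet> v < 0" "k' \<bullet> u < 0" "k' \<bullet> v < 0" "k \<bullet> u \<noteq> u \<bullet> v" "k \<bullet> v \<noteq> u \<bullet> v"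
proof -
  define c where "c = u \<bullet> v"
  have "(norm (cross3 u v))\<^sup>2 = 1 - c\<^sup>2" using norm_cross[of u v] assms by (simp add: c_def)
  moreover have "(norm (cross3 u v))\<^sup>2 > 0" using assms(3) by simp
  ultimately have c2: "c\<^sup>2 < 1" by simp
  then have c1: "\<bar>c\<bar> < 1" by (simp add: abs_square_less_1)
  then obtain l where l: "\<bar>c\<bar> < l" "l < 1" "1 + 2 * l * c \<noteq> 0" "l + 2 * c \<noteq> 0" by (rule generic_direction)
  have "l > 0" using l(1) by linarith
  have uu: "u \<bullet> u = 1" "v \<bullet> v = 1" "v \<bullet> u = c" "u \<bullet> v = c" using assms by (auto simp: norm_eq_1 c_def inner_commute)
  define N where "N = norm (u + l *\<^sub>R v)"
  have N2: "N\<^sup>2 = 1 + l\<^sup>2 + 2 * l * c"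
    unfolding N_def power2_norm_eq_inner power2_eq_square[of l]
    by (simp add: inner_add_left inner_add_right uu algebra_simps)
  have N2': "(norm (v + l *\<^sub>R u))\<^sup>2 = N\<^sup>2"
    unfolding N2 power2_norm_eq_inner power2_eq_square[of l]
    by (simp add: inner_add_left inner_add_right uu algebra_simps)
  then have N': "norm (v + l *\<^sub>R u) = N" by (simp add: N_def)
  have lc: "1 + l * c > 0" "c + l > 0"
  proof -
    have "l * \<bar>c\<bar> < 1 * 1" by (rule mult_strict_mono') (use l c1 \<open>l > 0\<close> in auto)
    then have "\<bar>l * c\<bar> < 1" using \<open>l > 0\<close> by (simp add: abs_mult)
    then show "1 + l * c > 0" by linarith
    show "c + l > 0" using l(1) by linarith
  qed
  have "N \<noteq> 0"
  proof
    assume "N = 0"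
    then have "u + l *\<^sub>R v = 0" by (simp add: N_def)
    then have "1 *\<^sub>R u + l *\<^sub>R v = 0 *\<^sub>R u + 0 *\<^sub>R v" by simp
    from cross_indep(1)[OF assms(3) this] show False by simp
  qed
  then have "N > 0" by (simp add: N_def)
  define k where "k = - (1 / N) *\<^sub>R (u + l *\<^sub>R v)"
  define k' where "k' = - (1 / N) *\<^sub>R (v + l *\<^sub>R u)"
  have ku: "k \<bullet> u = - (1 + l * c) / N" "k \<bullet> v = - (c + l) / N" "k' \<bullet> u = - (c + l) / N" "k' \<bullet> v = - (1 + l * c) / N"
    by (simp_all only: k_def k'_def inner_scaleR_left inner_add_left uu) (simp_all add: algebra_simps add_divide_distrib diff_divide_distrib)
  show ?thesis
  proof
    show "norm k = 1" "norm k' = 1" using \<open>N > 0\<close> by (simp_all add: k_def k'_def N' flip: N_def)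
    show "k \<bullet> x = 0" "k' \<bullet> x = 0" using assms by (simp_all add: k_def k'_def inner_add_left)
    show "N > 0" "l > 0" by fact+
    show "N *\<^sub>R k = - (u + l *\<^sub>R v)" "N *\<^sub>R k' = - (v + l *\<^sub>R u)" using \<open>N > 0\<close> by (simp_all add: k_def k'_def)
    show "k \<bullet> u < 0" "k \<bullet> v < 0" "k' \<bullet> u < 0" "k' \<bullet> v < 0"
      unfolding ku using lc \<open>N > 0\<close> by (simp_all add: divide_neg_pos)
    show "k \<noteq> k'"
    proof
      assume "k = k'"
      then have "- (1 + l * c) / N = - (c + l) / N" using ku by metis
      then have "(1 - l) * (1 - c) = 0" using \<open>N > 0\<close> by (simp add: field_simps)
      then show False using l c1 by auto
    qed
    show "k \<bullet> u \<noteq> u \<bullet> v"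
    proof
      assume "k \<bullet> u = u \<bullet> v"
      then have "1 + l * c = - c * N" using ku uu \<open>N > 0\<close> by (simp add: field_simps)
      \<comment> \<open>Squaring leaves, besides \<open>1 - c\<^sup>2\<close>, the factor
        \<open>1 + 2 * l * c\<close>, which the choice of \<open>l\<close> keeps nonzero.\<close>
      then have "(1 + l * c)\<^sup>2 = c\<^sup>2 * N\<^sup>2" by (simp add: power_mult_distrib)
      moreover have "(1 - c\<^sup>2) * (1 + 2 * l * c) = (1 + l * c)\<^sup>2 - c\<^sup>2 * N\<^sup>2" unfolding N2 by (simp add: power2_eq_square algebra_simps)
      ultimately have "(1 - c\<^sup>2) * (1 + 2 * l * c) = 0" by simp
      then show False using c2 l by auto
    qed
    show "k \<bullet> v \<noteq> u \<bullet> v"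
    proof
      assume "k \<bullet> v = u \<bullet> v"
      then have "- (c + l) / N = c" by (simp only: ku uu)
      then have "- (c + l) = c * N" using \<open>N > 0\<close> by (simp only: nonzero_divide_eq_eq)
      then have "c + l = - c * N" by simp
      then have "(c + l)\<^sup>2 = c\<^sup>2 * N\<^sup>2" by (simp add: power_mult_distrib)
      moreover have "(1 - c\<^sup>2) * (l * (l + 2 * c)) = (c + l)\<^sup>2 - c\<^sup>2 * N\<^sup>2" unfolding N2 by (simp add: power2_eq_square algebra_simps)
      ultimately have "(1 - c\<^sup>2) * (l * (l + 2 * c)) = 0" by simp
      then show False using c2 l \<open>l > 0\<close> by auto
    qed
  qed
qed

text \<open>At a corner of \<open>C\<close> the body \<open>D\<close> is placed with a smooth
  boundary point a little inside, so that the intersection is almost a triangle with normals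
  \<open>u\<close>, \<open>v\<close>, \<open>k\<close>. A symmetry cannot move the corner
  \<open>x\<close>, by comparing inner products of normals, and cannot fix it, by the asymmetry of
  the cut.\<close>

lemma smooth_of_small_sym:
  assumes C: "cbody C" and D: "cbody D" and sym: "small_sym \<epsilon> C D" and eps: "\<epsilon> > 0"
  shows "smooth C"
proof (rule ccontr)
  assume "\<not> smooth C"
  then obtain x n1 n2 where xb: "x \<in> bd C" and n: "n1 \<in> normals C x" "n2 \<in> normals C x" "norm n1 = 1" "norm n2 = 1" "n1 \<noteq> n2"
    unfolding smooth_def by blast
  have xC: "x \<in> C" and nx: "norm x = 1" using bd_mem[OF C xb] bd_norm[OF xb] by auto
  obtain u v where uv: "norm u = 1" "norm v = 1" "cross3 u v \<noteq> 0" "u \<in> normals C x" "v \<in> normals C x"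
    and cone: "\<And>w. w \<in> normals C x \<Longrightarrow> \<exists>a b. 0 \<le> a \<and> 0 \<le> b \<and> w = a *\<^sub>R u + b *\<^sub>R v"
    using corner_cone[OF C xb n] by blast
  have ux: "u \<bullet> x = 0" "v \<bullet> x = 0" using uv by (auto simp: normals_iff)
  obtain k k' l N where k: "norm k = 1" "norm k' = 1" "k \<bullet> x = 0" "k' \<bullet> x = 0" "k \<noteq> k'" and Nl: "N > 0" "l > 0"
    and Nk: "N *\<^sub>R k = - (u + l *\<^sub>R v)" "N *\<^sub>R k' = - (v + l *\<^sub>R u)"
    and kneg: "k \<bullet> u < 0" "k \<bullet> v < 0" "k' \<bullet> u < 0" "k' \<bullet> v < 0" and kgen: "k \<bullet> u \<noteq> u \<bullet> v" "k \<bullet> v \<noteq> u \<bullet> v"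
    using corner_direction[OF uv(1-3) ux] by metis
  obtain y uy where y: "y \<in> bd D" "uy \<in> normals D y" "norm uy = 1" and uyu: "\<And>w. w \<in> normals D y \<Longrightarrow> norm w = 1 \<Longrightarrow> w = uy"
    using smooth_point_exists[OF D] by metis
  have ny: "norm y = 1" and yD: "y \<in> D" and yuy: "y \<bullet> uy = 0" using y bd_norm bd_mem[OF D] by (auto simp: normals_iff inner_commute)
  have uv_ne: "u \<noteq> v" using uv(3) by auto
  \<comment> \<open>The margins: \<open>4 * \<eta>\<close> for two normals of \<open>E\<close> near
    \<open>k\<close>, \<open>3 * \<eta>\<close> for one normal from each body, and
    \<open>3 * \<eta>\<close> for the final comparison of \<open>k\<close> with
    \<open>k'\<close>.\<close>
  define \<eta> where "\<eta> = Min {norm (u - v) / 4, \<bar>u \<bullet> v - k \<bullet> u\<bar> / 3, \<bar>u \<bullet> v - k \<bullet> v\<bar> / 3, norm (k - k') / 3}"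
  have eta: "\<eta> > 0" using uv_ne kgen k(5) by (auto simp: \<eta>_def)
  have eta_le: "4 * \<eta> \<le> norm (u - v)" "3 * \<eta> \<le> \<bar>u \<bullet> v - k \<bullet> u\<bar>" "3 * \<eta> \<le> \<bar>u \<bullet> v - k \<bullet> v\<bar>" "3 * \<eta> \<le> norm (k - k')"
  proof -
    have "\<eta> \<le> norm (u - v) / 4" "\<eta> \<le> \<bar>u \<bullet> v - k \<bullet> u\<bar> / 3" "\<eta> \<le> \<bar>u \<bullet> v - k \<bullet> v\<bar> / 3" "\<eta> \<le> norm (k - k') / 3"
      unfolding \<eta>_def by (rule Min_le; simp)+
    then show "4 * \<eta> \<le> norm (u - v)" "3 * \<eta> \<le> \<bar>u \<bullet> v - k \<bullet> u\<bar>" "3 * \<eta> \<le> \<bar>u \<bullet> v - k \<bullet> v\<bar>" "3 * \<eta> \<le> norm (k - k')"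
      by (simp_all only: le_divide_eq_numeral1 mult.commute)
  qed
  obtain r1 where r1: "r1 > 0" and N1: "\<And>z w w'. z \<in> C \<Longrightarrow> norm z = 1 \<Longrightarrow> z \<noteq> x \<Longrightarrow> norm (z - x) < r1 \<Longrightarrow>
    w \<in> normals C z \<Longrightarrow> norm w = 1 \<Longrightarrow> w' \<in> normals C z \<Longrightarrow> norm w' = 1 \<Longrightarrow>
    norm (w - w') < \<eta> \<and> (norm (w - u) < \<eta> \<or> norm (w - v) < \<eta>)"
    using normals_near_corner[OF xC nx uv cone eta] by meson
  obtain r2 where r2: "r2 > 0" and N2: "\<And>z w. norm (z - y) < r2 \<Longrightarrow> w \<in> normals D z \<Longrightarrow> norm w = 1 \<Longrightarrow> norm (w - uy) < \<eta>"
    using normals_near_smooth_point[OF uyu eta] by meson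
  \<comment> \<open>\<open>\<epsilon> / 2\<close> bounds the diameter; \<open>r1\<close> and half of
    \<open>r2\<close> keep the intersection where normals are controlled.\<close>
  define \<rho> where "\<rho> = Min {\<epsilon> / 2, r1, r2 / 2}"
  have rho: "\<rho> > 0" using eps r1 r2 by (simp add: \<rho>_def)
  have rho_le: "\<rho> \<le> \<epsilon> / 2" "\<rho> \<le> r1" "\<rho> \<le> r2 / 2" by (simp_all add: \<rho>_def)
  obtain \<tau> where tau: "\<tau> > 0" and NV: "\<And>z. norm z = 1 \<Longrightarrow> z \<bullet> x \<ge> 0 \<Longrightarrow> \<bar>u \<bullet> z\<bar> \<le> \<tau> \<Longrightarrow> \<bar>v \<bullet> z\<bar> \<le> \<tau> \<Longrightarrow> norm (z - x) < \<rho>"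
    using near_vertex[OF ux nx uv(3) rho] by meson
  have kn: "w \<bullet> k < 0" "w \<bullet> k' < 0" if w: "w \<in> normals C x" "w \<noteq> 0" for w
  proof -
    obtain a b where ab: "0 \<le> a" "0 \<le> b" "w = a *\<^sub>R u + b *\<^sub>R v" using cone[OF w(1)] by blast
    have "a > 0 \<or> b > 0" using ab w(2) by auto
    then have "a * (u \<bullet> q) + b * (v \<bullet> q) < 0" if "q \<bullet> u < 0" "q \<bullet> v < 0" for q
      using ab that by (auto simp: inner_commute add_neg_nonpos add_nonpos_neg mult_pos_neg mult_nonneg_nonpos)
    then show "w \<bullet> k < 0" "w \<bullet> k' < 0" using kneg ab by (simp_all add: inner_add_left)
  qed
  obtain s1 where s1: "s1 > 0" "\<And>s. 0 < s \<Longrightarrow> s \<le> s1 \<Longrightarrow> x + s *\<^sub>R k \<in> interior C"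
    using inward_interior[OF C xC, of k] kn by blast
  obtain s2 where s2: "s2 > 0" "\<And>s. 0 < s \<Longrightarrow> s \<le> s2 \<Longrightarrow> x + s *\<^sub>R k' \<in> interior C"
    using inward_interior[OF C xC, of k'] kn by blast
  have "w \<bullet> (- uy) < 0" if "w \<in> normals D y" "w \<noteq> 0" for w
  proof -
    have "sgn w = uy" using that by (intro uyu) (auto simp: sgn_div_norm intro!: normals_scale)
    then have "w = norm w *\<^sub>R uy" using that by (auto simp: sgn_div_norm)
    then have "w \<bullet> uy = norm w * (uy \<bullet> uy)" by (metis inner_scaleR_left)
    then show ?thesis using that y(3) by (simp add: norm_eq_1)
  qed
  then obtain s3 where s3: "s3 > 0" "\<And>s. 0 < s \<Longrightarrow> s \<le> s3 \<Longrightarrow> y + s *\<^sub>R (- uy) \<in> interior D"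
    using inward_interior[OF D yD, of "- uy"] by blast
  \<comment> \<open>Tangent of the angle by which the smooth point is moved off \<open>x\<close>:
    \<open>s1\<close> and \<open>s2\<close> keep \<open>yt\<close> and \<open>yt'\<close> inside
    \<open>C\<close>, \<open>s3\<close> keeps \<open>x\<close> inside \<open>E\<close>, the two
    terms with \<open>\<tau>\<close> confine the triangle, and the rest bound the tilt of the
    frame.\<close>
  define T where "T = Min {s1, s2, s3, \<tau> / N, \<tau> * l / N, 1, \<eta> / 2, r2 / 8}"
  have T: "T > 0" unfolding T_def by (subst Min_gr_iff) (use s1 s2 s3 tau Nl eta r2 in auto)
  have T_le: "T \<le> s1" "T \<le> s2" "T \<le> s3" "T \<le> \<tau> / N" "T \<le> \<tau> * l / N" "T \<le> 1" "T \<le> \<eta> / 2" "T \<le> r2 / 8"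
    unfolding T_def by (rule Min_le; simp)+
  \<comment> \<open>\<open>cs\<close> and \<open>sn\<close> are cosine and sine of the angle with
    tangent \<open>T\<close>.\<close>
  define cs where "cs = 1 / sqrt (1 + T\<^sup>2)"
  define sn where "sn = T * cs"
  have T1: "1 + T\<^sup>2 > 0" by (simp add: add_pos_nonneg)
  have cs0: "cs > 0" using T1 by (simp add: cs_def)
  have sn0: "sn > 0" using cs0 T by (simp add: sn_def)
  have "cs\<^sup>2 = 1 / (1 + T\<^sup>2)" using T1 by (simp add: cs_def power_divide)
  then have "cs\<^sup>2 * (1 + T\<^sup>2) = 1" using T1 by simp
  then have one: "cs\<^sup>2 + sn\<^sup>2 = 1" by (simp add: sn_def power_mult_distrib algebra_simps)
  have cs1: "cs \<le> 1" using one sn0 cs0 by (smt (verit) power2_eq_square mult_left_le_imp_le zero_le_power2 mult_le_cancel_right1)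
  have snT: "sn \<le> T" using cs1 cs0 T by (simp add: sn_def mult_left_le)
  have csT: "1 - cs \<le> T"
  proof -
    have "1 - cs \<le> 1 - cs\<^sup>2" using cs0 cs1 by (simp add: power2_eq_square mult_left_le)
    also have "\<dots> = sn * sn" using one by (simp add: power2_eq_square)
    also have "\<dots> \<le> T * 1" using snT sn0 T_le(6) by (intro mult_mono) auto
    finally show ?thesis by simp
  qed
  have close: "norm (cs *\<^sub>R p + sn *\<^sub>R q - p) \<le> 2 * T" if "norm p = 1" "norm q = 1" for p q :: "real^3"
  proof -
    have "cs *\<^sub>R p + sn *\<^sub>R q - p = sn *\<^sub>R q - (1 - cs) *\<^sub>R p" by (simp add: algebra_simps)
    also have "norm \<dots> \<le> norm (sn *\<^sub>R q) + norm ((1 - cs) *\<^sub>R p)" by (rule norm_triangle_ineq4)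
    also have "\<dots> \<le> 2 * T" using that snT csT sn0 cs1 by simp
    finally show ?thesis .
  qed
  define yt where "yt = cs *\<^sub>R x + sn *\<^sub>R k"
  define yt' where "yt' = cs *\<^sub>R x + sn *\<^sub>R k'"
  define vt where "vt = cs *\<^sub>R k - sn *\<^sub>R x"
  have nn: "x \<bullet> x = 1" "k \<bullet> k = 1" "k' \<bullet> k' = 1" "x \<bullet> k = 0" "x \<bullet> k' = 0" using nx k by (auto simp: norm_eq_1 inner_commute)
  have nyt: "norm yt = 1" "norm yt' = 1" "norm vt = 1" "yt \<bullet> vt = 0"
    using one by (simp_all add: norm_eq_1 yt_def yt'_def vt_def inner_add_left inner_add_right inner_diff_left inner_diff_right nn k power2_eq_square)
  have ytI: "yt \<in> interior C" "yt' \<in> interior C"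
  proof -
    have "yt = cs *\<^sub>R (x + T *\<^sub>R k)" "yt' = cs *\<^sub>R (x + T *\<^sub>R k')" by (simp_all add: yt_def yt'_def sn_def scaleR_add_right mult.commute)
    then show "yt \<in> interior C" "yt' \<in> interior C"
      using interior_cone_scale[OF C s1(2)[OF T T_le(1)] cs0] interior_cone_scale[OF C s2(2)[OF T T_le(2)] cs0] by auto
  qed
  \<comment> \<open>The smooth point \<open>y\<close> goes to \<open>yt\<close> and its normal to
    \<open>vt\<close>, so that near \<open>x\<close> the body \<open>E\<close> is almost a
    half-space with outer normal \<open>k\<close>.\<close>
  define g where "g = frame_map y uy yt vt"
  have g: "rot g" "g y = yt" "g uy = vt"
    using frame_map[OF ny y(3) yuy nyt(1,3,4)] by (auto simp: g_def)
  have og: "orthogonal_transformation g" using g(1) by (rule rot_orth)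
  have lg: "linear g" using og by (rule orthogonal_transformation_linear)
  define E where "E = g ` D"
  have E: "cbody E" unfolding E_def by (rule cbody_image[OF D og])
  \<comment> \<open>The preimage of \<open>x\<close>, reached from \<open>y\<close> by going inwards
    along the normal.\<close>
  define xi where "xi = cs *\<^sub>R y - sn *\<^sub>R uy"
  have gxi: "g xi = x"
  proof -
    have "g xi = cs *\<^sub>R yt - sn *\<^sub>R vt" using g by (simp add: xi_def linear_diff[OF lg] linear_scale[OF lg])
    also have "\<dots> = (cs\<^sup>2 + sn\<^sup>2) *\<^sub>R x" by (simp add: yt_def vt_def algebra_simps power2_eq_square)
    finally show ?thesis using one by simp
  qed
  have xE: "x \<in> interior E"
  proof -
    have "xi = cs *\<^sub>R (y + T *\<^sub>R (- uy))" by (simp add: xi_def sn_def scaleR_diff_right mult.commute)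
    then have "xi \<in> interior D" using interior_cone_scale[OF D s3(2)[OF T T_le(3)] cs0] by simp
    then show ?thesis unfolding E_def orth_interior_image[OF og] using gxi by blast
  qed
  have xiy: "norm (xi - y) \<le> 2 * T" using close[of y "- uy"] ny y(3) by (simp add: xi_def)
  have vtk: "norm (vt - k) \<le> 2 * T" using close[of k "- x"] nx k by (simp add: vt_def)
  have normE: "norm (w - k) < 2 * \<eta>" if w: "norm (z - x) < \<rho>" "w \<in> normals E z" "norm w = 1" for z w
  proof -
    obtain z0 w0 where zw: "z = g z0" "w = g w0" using orthogonal_transformation_surj[OF og] by (meson surjD)
    have "w0 \<in> normals D z0" "norm w0 = 1" using w zw normals_image[OF og] orth_norm[OF og] by (auto simp: E_def)
    moreover have "norm (z0 - y) < r2"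
    proof -
      have "norm (z0 - xi) = norm (z - x)" using zw gxi by (metis linear_diff[OF lg] orth_norm[OF og])
      moreover have "norm (z0 - y) \<le> norm (z0 - xi) + norm (xi - y)" by (rule norm_diff_triangle_ineq[of z0 xi xi y, simplified]) 
      ultimately show ?thesis using w(1) rho_le(3) xiy T_le(8) r2 by linarith
    qed
    ultimately have "norm (w0 - uy) < \<eta>" by (intro N2)
    moreover have "norm (w - vt) = norm (w0 - uy)" using zw g by (metis linear_diff[OF lg] orth_norm[OF og])
    moreover have "norm (w - k) \<le> norm (w - vt) + norm (vt - k)" by (metis diff_add_cancel norm_triangle_ineq add_diff_eq)
    ultimately show ?thesis using vtk T_le(7) by linarith
  qed
  define M where "M = C \<inter> E"
  \<comment> \<open>On the intersection \<open>k \<bullet> z\<close> is at most \<open>T\<close>,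
    while \<open>N * (k \<bullet> z)\<close> splits into \<open>- (u \<bullet> z)\<close> and
    \<open>- l * (v \<bullet> z)\<close>, both nonnegative; so both are small and
    \<open>near_vertex\<close> applies.\<close>
  have small: "norm (z - x) < \<rho>" if z: "z \<in> M" "norm z = 1" for z
  proof -
    have zle: "u \<bullet> z \<le> 0" "v \<bullet> z \<le> 0" using z uv by (auto simp: M_def normals_iff polarD)
    have "vt \<in> normals E yt" using normals_image[OF og, of uy D y] y(2) g by (simp add: E_def)
    then have "vt \<bullet> z \<le> 0" using z by (auto simp: M_def normals_iff polarD)
    then have "cs * (k \<bullet> z) \<le> cs * (T * (x \<bullet> z))" by (simp add: vt_def inner_diff_left sn_def mult_ac)
    then have kz: "k \<bullet> z \<le> T * (x \<bullet> z)" using cs0 by simp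
    have "(N *\<^sub>R k) \<bullet> z = (- (u + l *\<^sub>R v)) \<bullet> z" by (simp only: Nk)
    then have e: "N * (k \<bullet> z) = - (u \<bullet> z) - l * (v \<bullet> z)" by (simp add: inner_add_left inner_diff_left)
    have lv: "l * (v \<bullet> z) \<le> 0" using zle Nl by (simp add: mult_nonneg_nonpos)
    then have "N * (k \<bullet> z) \<ge> 0" using e zle by linarith
    then have kz0: "k \<bullet> z \<ge> 0" using Nl by (simp add: zero_le_mult_iff)
    then have "T * (x \<bullet> z) \<ge> 0" using kz by linarith
    then have xz: "x \<bullet> z \<ge> 0" using T by (simp add: zero_le_mult_iff)
    have "x \<bullet> z \<le> 1" using norm_cauchy_schwarz[of x z] nx z by simp
    then have "k \<bullet> z \<le> T" using kz T by (smt (verit) mult_left_le)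
    then have NT: "N * (k \<bullet> z) \<le> N * T" using Nl by simp
    have 1: "N * T \<le> \<tau>" "N * T \<le> \<tau> * l" using T_le(4,5) Nl by (simp_all add: field_simps)
    have "\<bar>u \<bullet> z\<bar> \<le> \<tau>" using e NT 1 lv zle by linarith
    moreover have "l * \<bar>v \<bullet> z\<bar> \<le> l * \<tau>" using e NT 1 lv zle Nl by (simp add: abs_of_nonpos mult.commute)
    then have "\<bar>v \<bullet> z\<bar> \<le> \<tau>" using Nl by simp
    ultimately show ?thesis using NV[OF z(2)] xz by (simp add: inner_commute)
  qed
  have I: "interior C \<inter> interior E \<noteq> {}" using interior_Int_nonempty[OF C xC xE] .
  have xM: "x \<in> M" using xC xE interior_subset by (auto simp: M_def)
  have "\<exists>f. orthogonal_transformation f \<and> f \<noteq> id \<and> f ` (C \<inter> g ` D) = C \<inter> g ` D"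
  proof (rule sym[unfolded small_sym_def, THEN spec, THEN mp, OF g(1), THEN mp, THEN mp])
    show "interior (C \<inter> g ` D) \<noteq> {}" using I by (simp add: E_def)
    show "\<forall>p\<in>C \<inter> g ` D \<inter> sphere 0 1. \<forall>q\<in>C \<inter> g ` D \<inter> sphere 0 1. dist p q \<le> \<epsilon>"
    proof (intro ballI)
      fix p q assume "p \<in> C \<inter> g ` D \<inter> sphere 0 1" "q \<in> C \<inter> g ` D \<inter> sphere 0 1"
      then have "norm (p - x) < \<rho>" "norm (q - x) < \<rho>" by (auto intro!: small simp: M_def E_def)
      then have "dist p x < \<epsilon> / 2" "dist q x < \<epsilon> / 2" using rho_le(1) by (auto simp: dist_norm)
      then show "dist p q \<le> \<epsilon>" using dist_triangle2[of p q x] by linarith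
    qed
  qed
  then obtain f where f: "orthogonal_transformation f" "f \<noteq> id" "f ` M = M"
    unfolding M_def E_def by blast
  have lf: "linear f" and injf: "inj f" using f(1) by (auto simp: orthogonal_transformation_linear orthogonal_transformation_inj)
  \<comment> \<open>As \<open>x\<close> is interior to \<open>E\<close>, its normal cone in the
    intersection is spanned by \<open>u\<close> and \<open>v\<close>, so their images are normals of
    \<open>C\<close> or of \<open>E\<close> at \<open>f x\<close>.\<close>
  have nM: "normals M x = normals C x" unfolding M_def by (rule normals_Int_interior[OF C E I xC xE])
  obtain c where c: "c \<in> interior C" using cbodyD(4)[OF C] by blast
  have uvc: "u \<bullet> c < 0" "v \<bullet> c < 0" using uv c by (auto intro!: polar_interior_neg simp: normals_iff)
  have ind: "v \<noteq> r *\<^sub>R u" "u \<noteq> r *\<^sub>R v" for r using uv(3) by (auto simp: cross3_bilinear)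
  have fu: "f u \<in> normals C (f x) \<or> f u \<in> normals E (f x)"
    using f(3) xM uv(4) nM cone unfolding M_def
    by (intro extreme_normal_transfer[OF C E I f(1) _ _ _ _ _ uvc(1,2) ind(1)]) (use uv(1) in auto)
  have fv: "f v \<in> normals C (f x) \<or> f v \<in> normals E (f x)"
  proof (rule extreme_normal_transfer[OF C E I f(1) _ _ _ _ _ uvc(2,1) ind(2)])
    fix w assume "w \<in> normals (C \<inter> E) x"
    then have "w \<in> normals C x" using nM by (simp add: M_def)
    then obtain a b where "0 \<le> a" "0 \<le> b" "w = a *\<^sub>R u + b *\<^sub>R v" using cone by blast
    then have "w = b *\<^sub>R v + a *\<^sub>R u" by simp
    then show "\<exists>a b. 0 \<le> a \<and> 0 \<le> b \<and> w = a *\<^sub>R v + b *\<^sub>R u" using \<open>0 \<le> a\<close> \<open>0 \<le> b\<close> by blast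
  qed (use f(3) xM uv nM in \<open>auto simp: M_def\<close>)
  have fxM: "f x \<in> M" using f(3) xM by blast
  have nfx: "norm (f x) = 1" using orth_norm[OF f(1)] nx by simp
  have nfu: "norm (f u) = 1" "norm (f v) = 1" "f u \<bullet> f v = u \<bullet> v" "norm (f u - f v) = norm (u - v)"
    using uv orth_norm[OF f(1)] orth_inner[OF f(1)] by (auto simp flip: linear_diff[OF lf])
  show False
  proof (cases "f x = x")
    \<comment> \<open>Away from \<open>x\<close> the unit normals of one body at one point are
      nearly equal, so \<open>f u\<close> and \<open>f v\<close> cannot come from the same
      body.\<close>
    case False
    have nr: "norm (f x - x) < r1" "norm (f x - x) < \<rho>" using small[OF fxM nfx] rho_le by auto
    have fxC: "f x \<in> C" using fxM by (simp add: M_def)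
    \<comment> \<open>One normal from each body would have inner product close to
      \<open>k \<bullet> u\<close> or \<open>k \<bullet> v\<close>, which differ from
      \<open>u \<bullet> v\<close>.\<close>
    have mixed: False if a: "a \<in> normals C (f x)" "norm a = 1" and b: "b \<in> normals E (f x)" "norm b = 1" and ab: "a \<bullet> b = u \<bullet> v" for a b
    proof -
      have bk: "norm (b - k) < 2 * \<eta>" using normE[OF nr(2) b] .
      from N1[OF fxC nfx False nr(1) a a] consider "norm (a - u) < \<eta>" | "norm (a - v) < \<eta>" by blast
      then show False
      proof cases
        case 1
        have "\<bar>a \<bullet> b - u \<bullet> k\<bar> \<le> norm (a - u) + norm (b - k)" by (rule inner_unit_close) (use a k in auto)
        then show False using 1 bk ab eta_le(2) by (simp add: inner_commute[of u k])
      next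
        case 2
        have "\<bar>a \<bullet> b - v \<bullet> k\<bar> \<le> norm (a - v) + norm (b - k)" by (rule inner_unit_close) (use a k in auto)
        then show False using 2 bk ab eta_le(3) by (simp add: inner_commute[of v k])
      qed
    qed
    from fu fv consider (cc) "f u \<in> normals C (f x)" "f v \<in> normals C (f x)"
      | (ee) "f u \<in> normals E (f x)" "f v \<in> normals E (f x)"
      | (ce) "f u \<in> normals C (f x)" "f v \<in> normals E (f x)"
      | (ec) "f u \<in> normals E (f x)" "f v \<in> normals C (f x)" by blast
    then show False
    proof cases
      case cc
      then have "norm (f u - f v) < \<eta>" using N1[OF fxC nfx False nr(1) cc(1) nfu(1) cc(2) nfu(2)] by simp
      then show False using eta_le(1) nfu(4) eta by linarith
    next
      case ee
      have "norm (f u - k) < 2 * \<eta>" "norm (f v - k) < 2 * \<eta>" using normE[OF nr(2)] ee nfu by auto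
      then have "norm (f u - f v) < 4 * \<eta>" using norm_triangle_ineq4[of "f u - k" "f v - k"] by simp
      then show False using eta_le(1) nfu(4) by linarith
    next
      case ce
      then show False using mixed nfu by blast
    next
      case ec
      then show False using mixed[OF ec(2) nfu(2) ec(1) nfu(1)] nfu(3) by (simp add: inner_commute)
    qed
  next
    case True
    let ?h = "inv f"
    have fh: "f (?h z) = z" for z using surj_f_inv_f[OF orthogonal_transformation_surj[OF f(1)]] .
    have fN: "f w \<in> normals C x \<longleftrightarrow> w \<in> normals C x" for w
      using normals_image[OF f(1), of w M x] f(3) True nM by simp
    have hN: "?h w \<in> normals C x" if "w \<in> normals C x" for w using fN[of "?h w"] that fh by simp
    have p1: "f u = u \<or> f u = v"
      by (rule extreme_permuted[OF lf injf, where h="?h" and N="normals C x"]) (use fN hN fh uv orth_norm[OF f(1)] cone in auto)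
    have uv': "cross3 v u \<noteq> 0" using uv(3) cross_skew[of v u] by simp
    have cone': "\<exists>a b. 0 \<le> a \<and> 0 \<le> b \<and> w = a *\<^sub>R v + b *\<^sub>R u" if "w \<in> normals C x" for w
      using cone[OF that] by (metis add.commute)
    have p2: "f v = v \<or> f v = u"
      by (rule extreme_permuted[OF lf injf, where h="?h" and N="normals C x"]) (use fN hN fh uv uv' orth_norm[OF f(1)] cone' in auto)
    show False
    proof (cases "f u = u")
      case fuu: True
      then have "f v = v" using p2 uv_ne injf by (metis injD)
      moreover have "x \<noteq> 0" using nx by auto
      ultimately have "f = id" using orth_fix_three[OF f(1) True fuu _ ux _ uv(3)] by blast
      then show False using f(2) by simp
    next
      \<comment> \<open>The swap of \<open>u\<close> and \<open>v\<close> takes \<open>k\<close> to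
        \<open>k'\<close>, so the image of the cut normal at \<open>yt\<close> is near
        \<open>k'\<close>; but it is a normal of \<open>E\<close> at \<open>yt'\<close>, hence near
        \<open>k\<close>.\<close>
      case False
      then have sw: "f u = v" "f v = u" using p1 p2 uv_ne injf by (metis injD)+
      have "N *\<^sub>R f k = f (N *\<^sub>R k)" by (simp add: linear_scale[OF lf])
      also have "\<dots> = N *\<^sub>R k'" by (simp only: Nk) (simp add: linear_neg[OF lf] linear_add[OF lf] linear_scale[OF lf] linear_diff[OF lf] sw)
      finally have fk: "f k = k'" using Nl by simp
      have fyt: "f yt = yt'" by (simp add: yt_def yt'_def linear_add[OF lf] linear_scale[OF lf] True fk)
      have fvt: "f vt = cs *\<^sub>R k' - sn *\<^sub>R x" by (simp add: vt_def linear_diff[OF lf] linear_scale[OF lf] True fk)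
      have vtE: "vt \<in> normals E yt" using normals_image[OF og, of uy D y] y(2) g by (simp add: E_def)
      have "yt \<in> M" using ytI(1) interior_subset yD g by (auto simp: M_def E_def)
      then have yM: "yt' \<in> M" using f(3) fyt by blast
      have "f vt \<in> normals M (f yt)" using normals_image[OF f(1), of vt M yt] vtE normals_Int_mono2[of E yt C] f(3) by (auto simp: M_def)
      then have "f vt \<in> normals (E \<inter> C) yt'" by (simp add: fyt M_def Int_commute)
      moreover have "normals (E \<inter> C) yt' = normals E yt'"
        using I yM ytI(2) by (intro normals_Int_interior[OF E C]) (auto simp: M_def)
      ultimately have "f vt \<in> normals E yt'" by simp
      then have "norm (f vt - k) < 2 * \<eta>" using normE[OF small[OF yM nyt(2)]] orth_norm[OF f(1)] nyt by simp
      moreover have "norm (f vt - k') \<le> 2 * T" using close[of k' "- x"] nx k by (simp add: fvt)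
      moreover have "norm (k - k') \<le> norm (f vt - k') + norm (f vt - k)"
        using norm_triangle_ineq4[of "f vt - k'" "f vt - k"] by simp
      ultimately show False using T_le(7) eta_le(4) by linarith
    qed
  qed
qed

section \<open>Lenses glued along a common chord\<close>

text \<open>Some unit normal is chosen; \<open>smooth\<close> makes it the only one, see
  \<open>unormal_unique\<close>.\<close>

definition unormal :: "'a::euclidean_space set \<Rightarrow> 'a \<Rightarrow> 'a" where
  "unormal C x = (SOME u. u \<in> normals C x \<and> norm u = 1)"

lemma unormal:
  assumes "cbody C" "x \<in> bd C"
  shows "unormal C x \<in> normals C x" "norm (unormal C x) = 1" "unormal C x \<bullet> x = 0"
    "\<And>y. y \<in> C \<Longrightarrow> unormal C x \<bullet> y \<le> 0"
proof -
  have "\<exists>u. u \<in> normals C x \<and> norm u = 1" using bd_normal[OF assms] by metis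
  from someI_ex[OF this] show *: "unormal C x \<in> normals C x" "norm (unormal C x) = 1"
    by (simp_all add: unormal_def)
  then show "unormal C x \<bullet> x = 0" "\<And>y. y \<in> C \<Longrightarrow> unormal C x \<bullet> y \<le> 0"
    by (auto simp: normals_iff polarD)
qed

lemma unormal_unique:
  assumes "cbody C" "smooth C" "x \<in> bd C" "u \<in> normals C x" "norm u = 1"
  shows "u = unormal C x"
  using assms unormal[OF assms(1,3)] unfolding smooth_def by blast

lemma unormal_scale:
  assumes "cbody C" "smooth C" "x \<in> bd C" "u \<in> normals C x"
  shows "u = norm u *\<^sub>R unormal C x"
proof (cases "u = 0")
  case False
  have "sgn u = unormal C x"
    using assms False by (intro unormal_unique) (auto simp: sgn_div_norm intro!: normals_scale)
  then show ?thesis using False by (simp add: sgn_div_norm)  (metis False norm_eq_zero right_inverse scaleR_one scaleR_scaleR)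
qed simp

lemma smooth_image:
  fixes f :: "'a::euclidean_space \<Rightarrow> 'a"
  assumes C: "cbody C" and S: "smooth C" and f: "orthogonal_transformation f"
  shows "smooth (f ` C)" "x \<in> bd C \<Longrightarrow> unormal (f ` C) (f x) = f (unormal C x)"
proof -
  show sm: "smooth (f ` C)"
    unfolding smooth_def
  proof (intro ballI impI)
    fix z u v assume a: "z \<in> bd (f ` C)" "u \<in> normals (f ` C) z" "v \<in> normals (f ` C) z" "norm u = 1" "norm v = 1"
    obtain z' u' v' where e: "z = f z'" "u = f u'" "v = f v'"
      using orthogonal_transformation_surj[OF f] by (meson surjD)
    have "z' \<in> bd C" "u' \<in> normals C z'" "v' \<in> normals C z'" "norm u' = 1" "norm v' = 1"
      using a e bd_image[OF C f] normals_image[OF f] orth_norm[OF f] by auto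
    then show "u = v" using S e unfolding smooth_def by blast
  qed
  show "unormal (f ` C) (f x) = f (unormal C x)" if "x \<in> bd C"
    using that unormal[OF C that] bd_image[OF C f] normals_image[OF f] orth_norm[OF f]
    by (intro unormal_unique[symmetric] cbody_image[OF C f] sm) auto
qed

text \<open>A normal at \<open>p\<close> that vanishes at \<open>q\<close> is also a normal at
  \<open>q\<close>, so the two unit normals agree. A chord is thus flat at both ends or at
  neither.\<close>

lemma unormal_transfer_eq:
  assumes "cbody C" "smooth C" "p \<in> bd C" "q \<in> bd C" "unormal C p \<bullet> q = 0"
  shows "unormal C q \<bullet> p = 0"
proof -
  have "unormal C p \<in> normals C q" using unormal[OF assms(1,3)] assms(5) by (simp add: normals_iff)
  then have "unormal C p = unormal C q" using assms unormal by (intro unormal_unique) auto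
  then show ?thesis using unormal(3)[OF assms(1,3)] by simp
qed

lemma unormal_continuous:
  assumes C: "cbody C" and S: "smooth C"
  shows "continuous_on (bd C) (unormal C)"
  unfolding continuous_on_iff
proof (intro ballI allI impI)
  fix x and e :: real assume x: "x \<in> bd C" and e: "0 < e"
  obtain r where r: "r > 0" "\<And>z w. norm (z - x) < r \<Longrightarrow> w \<in> normals C z \<Longrightarrow> norm w = 1 \<Longrightarrow> norm (w - unormal C x) < e"
    using normals_near_smooth_point[of C x "unormal C x", OF unormal_unique[OF C S x] e] by blast
  show "\<exists>d>0. \<forall>x'\<in>bd C. dist x' x < d \<longrightarrow> dist (unormal C x') (unormal C x) < e"
    using r unormal[OF C] by (auto simp: dist_norm intro!: exI[of _ r])
qed

definition tang :: "(real^3) set \<Rightarrow> real^3 \<Rightarrow> real^3" where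
  "tang C x = cross3 x (unormal C x)"

lemma tang:
  assumes "cbody C" "x \<in> bd C"
  shows "norm (tang C x) = 1" "tang C x \<bullet> x = 0" "tang C x \<bullet> unormal C x = 0"
    "z \<bullet> z = (z \<bullet> x)\<^sup>2 + (z \<bullet> unormal C x)\<^sup>2 + (z \<bullet> tang C x)\<^sup>2"
proof -
  have o: "norm x = 1" "norm (unormal C x) = 1" "x \<bullet> unormal C x = 0"
    using unormal[OF assms] bd_norm[OF assms(2)] by (auto simp: inner_commute)
  show "norm (tang C x) = 1" using cross_orthonormal(1)[OF o] by (simp add: tang_def)
  show "tang C x \<bullet> x = 0" "tang C x \<bullet> unormal C x = 0" by (simp_all add: tang_def dot_cross_self)
  show "z \<bullet> z = (z \<bullet> x)\<^sup>2 + (z \<bullet> unormal C x)\<^sup>2 + (z \<bullet> tang C x)\<^sup>2"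
    using orthonormal_inner[OF o, of z z] by (simp add: tang_def power2_eq_square)
qed

lemma sphere_diff_inner:
  fixes x y :: "'a::real_inner"
  assumes "norm x = 1" "norm y = 1"
  shows "x \<bullet> (y - x) = - (norm (y - x))\<^sup>2 / 2"
  using assms by (simp add: power2_norm_eq_inner inner_diff inner_commute norm_eq_1)

text \<open>Each endpoint lies in the supporting half-space of the other, so the height of
  \<open>y\<close> over the tangent plane at \<open>x\<close> is at most the turning of the normal
  times the distance. The radial part is small as well, so the rest of the chord is
  tangential.\<close>

lemma flat_scale:
  fixes C :: "(real^3) set"
  assumes C: "cbody C" and S: "smooth C" and e: "0 < \<eta>" "\<eta> \<le> 1/2"
  obtains r where "0 < r" "r \<le> \<eta>"
    "\<And>x y. x \<in> bd C \<Longrightarrow> y \<in> bd C \<Longrightarrow> norm (y - x) < r \<Longrightarrow> norm (unormal C y - unormal C x) \<le> \<eta>"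
    "\<And>x y. x \<in> bd C \<Longrightarrow> y \<in> bd C \<Longrightarrow> norm (y - x) < r \<Longrightarrow> \<bar>unormal C x \<bullet> (y - x)\<bar> \<le> \<eta> * norm (y - x)"
    "\<And>x y. x \<in> bd C \<Longrightarrow> y \<in> bd C \<Longrightarrow> norm (y - x) < r \<Longrightarrow> (1 - 2 * \<eta>) * norm (y - x) \<le> \<bar>tang C x \<bullet> y\<bar>"
proof -
  have "uniformly_continuous_on (bd C) (unormal C)"
    using compact_uniformly_continuous[OF unormal_continuous[OF C S] compact_bd] .
  then obtain r0 where r0: "r0 > 0" "\<And>x y. x \<in> bd C \<Longrightarrow> y \<in> bd C \<Longrightarrow> norm (y - x) < r0 \<Longrightarrow> norm (unormal C y - unormal C x) < \<eta>"
    using e(1) unfolding uniformly_continuous_on_def dist_norm by metis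
  have 1: "\<bar>unormal C x \<bullet> (y - x)\<bar> \<le> \<eta> * norm (y - x)" if "x \<in> bd C" "y \<in> bd C" "norm (y - x) < r0" for x y
  proof -
    have "unormal C x \<bullet> (y - x) \<le> 0" "unormal C y \<bullet> (x - y) \<le> 0"
      using unormal[OF C that(1)] unormal[OF C that(2)] bd_mem[OF C that(1)] bd_mem[OF C that(2)] by (auto simp: inner_diff_right)
    then have "\<bar>unormal C x \<bullet> (y - x)\<bar> \<le> (unormal C y - unormal C x) \<bullet> (y - x)"
      by (simp add: inner_diff_left inner_diff_right)
    also have "\<dots> \<le> norm (unormal C y - unormal C x) * norm (y - x)" by (rule norm_cauchy_schwarz)
    also have "\<dots> \<le> \<eta> * norm (y - x)" using r0(2)[OF that] by (simp add: mult_right_mono)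
    finally show ?thesis .
  qed
  have 2: "(1 - 2 * \<eta>) * norm (y - x) \<le> \<bar>tang C x \<bullet> y\<bar>" if "x \<in> bd C" "y \<in> bd C" "norm (y - x) < min r0 \<eta>" for x y
  proof -
    define d where "d = norm (y - x)"
    have "d \<ge> 0" by (simp add: d_def)
    \<comment> \<open>The radial part is quadratic in \<open>d\<close>; a scale of at most \<eta>
      turns it into a linear bound with factor \<eta>.\<close>
    have a: "\<bar>x \<bullet> (y - x)\<bar> \<le> \<eta> * d"
    proof -
      have "x \<bullet> (y - x) = - (d * d / 2)"
        using sphere_diff_inner[OF bd_norm[OF that(1)] bd_norm[OF that(2)]] by (simp add: d_def power2_eq_square)
      then have "\<bar>x \<bullet> (y - x)\<bar> = d * d / 2" by simp
      also have "\<dots> \<le> d * d" using \<open>d \<ge> 0\<close> by simp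
      also have "\<dots> \<le> d * \<eta>" using that(3) \<open>d \<ge> 0\<close> by (intro mult_left_mono) (auto simp: d_def)
      finally show ?thesis by (simp add: mult.commute)
    qed
    have b: "\<bar>unormal C x \<bullet> (y - x)\<bar> \<le> \<eta> * d" using 1[OF that(1,2)] that(3) by (simp add: d_def)
    have s: "(x \<bullet> (y - x))\<^sup>2 \<le> (\<eta> * d)\<^sup>2" "(unormal C x \<bullet> (y - x))\<^sup>2 \<le> (\<eta> * d)\<^sup>2"
      using power_mono[OF a, of 2] power_mono[OF b, of 2] by auto
    have "tang C x \<bullet> y = (y - x) \<bullet> tang C x" using tang(2)[OF C that(1)] by (simp add: inner_diff_left inner_commute)
    then have "d\<^sup>2 = (x \<bullet> (y - x))\<^sup>2 + (unormal C x \<bullet> (y - x))\<^sup>2 + (tang C x \<bullet> y)\<^sup>2"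
      using tang(4)[OF C that(1), of "y - x"] by (simp add: d_def power2_norm_eq_inner inner_commute)
    then have t: "(tang C x \<bullet> y)\<^sup>2 \<ge> d\<^sup>2 - 2 * (\<eta> * d)\<^sup>2" using s by linarith
    \<comment> \<open>Needed for
      \<open>(1 - 2 * \<eta>)\<^sup>2 \<le> 1 - 2 * \<eta>\<^sup>2\<close>, where
      \<open>2 * \<eta>\<^sup>2\<close> accounts for the radial and the normal part.\<close>
    have "6 * (\<eta> * \<eta>) \<le> 4 * \<eta>" using e mult_left_mono[of \<eta> "1/2" \<eta>] by simp
    then have "(1 - 2 * \<eta>)\<^sup>2 \<le> 1 - 2 * \<eta>\<^sup>2" by (simp add: power2_eq_square algebra_simps)
    then have "(1 - 2 * \<eta>)\<^sup>2 * d\<^sup>2 \<le> (1 - 2 * \<eta>\<^sup>2) * d\<^sup>2" by (intro mult_right_mono) auto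
    also have "\<dots> = d\<^sup>2 - 2 * (\<eta> * d)\<^sup>2" by (simp add: power_mult_distrib algebra_simps)
    finally have "((1 - 2 * \<eta>) * d)\<^sup>2 \<le> (tang C x \<bullet> y)\<^sup>2" using t by (simp only: power_mult_distrib)
    then have "\<bar>(1 - 2 * \<eta>) * d\<bar> \<le> \<bar>tang C x \<bullet> y\<bar>" by (simp only: abs_le_square_iff)
    then show ?thesis by (simp add: d_def)
  qed
  show ?thesis
  proof
    show "0 < min r0 \<eta>" "min r0 \<eta> \<le> \<eta>" using r0 e by auto
  qed (use r0 1 2 in \<open>auto simp: less_imp_le\<close>)
qed

section \<open>The lens between two caps over a common chord\<close>

text \<open>\<open>p \<bullet> q \<ge> 0\<close> excludes antipodal ends, so \<open>p\<close>,
  \<open>q\<close>, \<open>n\<close> form a basis.\<close>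

lemma chord_coordinates:
  fixes p q n z :: "real^3"
  assumes "norm p = 1" "norm q = 1" "p \<noteq> q" "p \<bullet> q \<ge> 0" "norm n = 1" "n \<bullet> p = 0" "n \<bullet> q = 0"
  obtains a b where "z = a *\<^sub>R p + b *\<^sub>R q + (z \<bullet> n) *\<^sub>R n"
proof -
  have pn: "p \<bullet> n = 0" using assms by (simp add: inner_commute)
  let ?k = "cross3 p n"
  note ex = orthonormal_expand[OF assms(1,5) pn]
  have qe: "q = (q \<bullet> p) *\<^sub>R p + (q \<bullet> ?k) *\<^sub>R ?k" using ex[of q] assms(7) by (simp add: inner_commute)
  have qk: "q \<bullet> ?k \<noteq> 0"
  proof
    assume "q \<bullet> ?k = 0"
    then have 1: "q = (q \<bullet> p) *\<^sub>R p" using qe by simp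
    then have "norm q = \<bar>q \<bullet> p\<bar> * norm p" by (metis norm_scaleR)
    then have "q \<bullet> p = 1" using assms by (simp add: inner_commute)
    then show False using 1 assms(3) by simp
  qed
  define b where "b = (z \<bullet> ?k) / (q \<bullet> ?k)"
  have "(z \<bullet> ?k) *\<^sub>R ?k = b *\<^sub>R ((q \<bullet> ?k) *\<^sub>R ?k)" using qk by (simp add: b_def)
  also have "(q \<bullet> ?k) *\<^sub>R ?k = q - (q \<bullet> p) *\<^sub>R p" using qe by (metis add_diff_cancel_left')
  finally have "(z \<bullet> ?k) *\<^sub>R ?k = b *\<^sub>R q - (b * (q \<bullet> p)) *\<^sub>R p" by (simp add: scaleR_diff_right)
  then have "z = (z \<bullet> p) *\<^sub>R p + (z \<bullet> n) *\<^sub>R n + (b *\<^sub>R q - (b * (q \<bullet> p)) *\<^sub>R p)"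
    using ex[of z] by metis
  then have "z = (z \<bullet> p - b * (q \<bullet> p)) *\<^sub>R p + b *\<^sub>R q + (z \<bullet> n) *\<^sub>R n"
    by (simp add: algebra_simps)
  then show ?thesis by (rule that)
qed

text \<open>The normal \<open>n\<close> of the chord plane separates the two caps: outer normals of
  \<open>C\<close> lean towards \<open>n\<close>, those of \<open>E\<close> away from it. The radius
  \<open>5 * norm (q - p)\<close> is what \<open>lens_coordinates\<close> obtains for the lens, so
  the leaning is known at every common boundary point. \<open>nondeg\<close> keeps the lens from
  collapsing to the chord.\<close>

locale glued_caps =
  fixes C E :: "(real^3) set" and p q n :: "real^3"
  assumes C: "cbody C" "smooth C" and E: "cbody E" "smooth E"
    and pC: "p \<in> bd C" and qC: "q \<in> bd C" and pE: "p \<in> bd E" and qE: "q \<in> bd E" and pq: "p \<noteq> q" "p \<bullet> q \<ge> 0"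
    and n: "norm n = 1" "n \<bullet> p = 0" "n \<bullet> q = 0"
    and UC: "\<And>z. z \<in> bd C \<Longrightarrow> norm (z - p) \<le> 5 * norm (q - p) \<Longrightarrow> unormal C z \<bullet> n \<ge> 1/2"
    and UE: "\<And>z. z \<in> bd E \<Longrightarrow> norm (z - p) \<le> 5 * norm (q - p) \<Longrightarrow> unormal E z \<bullet> n \<le> - 1/2"
    and nondeg: "unormal C p \<bullet> q < 0 \<or> unormal E p \<bullet> q < 0"
begin

lemma norms: "norm p = 1" "norm q = 1"
  using pC qC by (auto simp: bd_norm)

lemma mem: "p \<in> C" "q \<in> C" "p \<in> E" "q \<in> E"
  using bd_mem C E pC qC pE qE by auto

lemma Un: "unormal C p \<bullet> n \<ge> 1/2" "unormal C q \<bullet> n \<ge> 1/2" "unormal E p \<bullet> n \<le> -1/2" "unormal E q \<bullet> n \<le> -1/2"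
  using UC[OF pC] UC[OF qC] UE[OF pE] UE[OF qE] by auto

text \<open>Tangent planes of both bodies at both ends bound the lens. Eliminating the height
  \<open>g\<close> between a bound from \<open>C\<close> and one from \<open>E\<close> gives
  nonnegative \<open>a\<close> and \<open>b\<close>; then \<open>\<bar>g\<bar>\<close> is at most
  twice the chord length and \<open>a + b\<close> is close to 1.\<close>

lemma lens_coordinates:
  assumes z: "z \<in> C" "z \<in> E" "norm z = 1"
  obtains a b where "z = a *\<^sub>R p + b *\<^sub>R q + (z \<bullet> n) *\<^sub>R n" "0 \<le> a" "0 \<le> b" "norm (z - p) \<le> 5 * norm (q - p)"
proof -
  obtain a b where zab: "z = a *\<^sub>R p + b *\<^sub>R q + (z \<bullet> n) *\<^sub>R n"
    using chord_coordinates[OF norms pq n] by blast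
  define g where "g = z \<bullet> n"
  define l where "l = norm (q - p)"
  note zab = zab[folded g_def]
  define A1 A2 B1 B2 where "A1 = - (unormal C p \<bullet> q)" and "A2 = - (unormal C q \<bullet> p)"
    and "B1 = - (unormal E p \<bullet> q)" and "B2 = - (unormal E q \<bullet> p)"
  note AB = A1_def A2_def B1_def B2_def
  define m1 m2 k1 k2 where "m1 = unormal C p \<bullet> n" and "m2 = unormal C q \<bullet> n"
    and "k1 = - (unormal E p \<bullet> n)" and "k2 = - (unormal E q \<bullet> n)"
  have mk: "m1 \<ge> 1/2" "m2 \<ge> 1/2" "k1 \<ge> 1/2" "k2 \<ge> 1/2" using Un by (simp_all add: m1_def m2_def k1_def k2_def)
  have nonneg: "A1 \<ge> 0" "A2 \<ge> 0" "B1 \<ge> 0" "B2 \<ge> 0"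
    using unormal(4)[OF C(1) pC mem(2)] unormal(4)[OF C(1) qC mem(1)] unormal(4)[OF E(1) pE mem(4)] unormal(4)[OF E(1) qE mem(3)]
    by (simp_all add: AB)
  have small: "A1 \<le> l" "A2 \<le> l" "B1 \<le> l" "B2 \<le> l"
  proof -
    have "- (u \<bullet> y) \<le> norm (y - x)" if "norm u = 1" "u \<bullet> x = 0" for u x y :: "real^3"
      using norm_cauchy_schwarz[of u "x - y"] that by (simp add: inner_diff_right norm_minus_commute)
    then show "A1 \<le> l" "A2 \<le> l" "B1 \<le> l" "B2 \<le> l"
      using unormal[OF C(1) pC] unormal[OF C(1) qC] unormal[OF E(1) pE] unormal[OF E(1) qE]
      unfolding AB l_def by (metis norm_minus_commute)+
  qed
  \<comment> \<open>A chord flat at one end is flat at the other, so strictness at \<open>p\<close>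
    passes to \<open>q\<close>.\<close>
  have nd: "A1 > 0 \<and> A2 > 0 \<or> B1 > 0 \<and> B2 > 0"
    using nondeg nonneg unormal_transfer_eq[OF C qC pC] unormal_transfer_eq[OF E qE pE] unfolding AB by fastforce
  have ineq: "g * m1 \<le> b * A1" "g * m2 \<le> a * A2" "- g * k1 \<le> b * B1" "- g * k2 \<le> a * B2"
  proof -
    have "unormal C p \<bullet> z \<le> 0" "unormal C q \<bullet> z \<le> 0" "unormal E p \<bullet> z \<le> 0" "unormal E q \<bullet> z \<le> 0"
      using unormal(4)[OF C(1) pC z(1)] unormal(4)[OF C(1) qC z(1)] unormal(4)[OF E(1) pE z(2)] unormal(4)[OF E(1) qE z(2)] by auto
    then show "g * m1 \<le> b * A1" "g * m2 \<le> a * A2" "- g * k1 \<le> b * B1" "- g * k2 \<le> a * B2"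
      unfolding m1_def m2_def k1_def k2_def AB
      by (subst (asm) (1 2 3 4) zab, simp add: inner_add_right unormal[OF C(1) pC] unormal[OF C(1) qC] unormal[OF E(1) pE] unormal[OF E(1) qE])+
  qed
  \<comment> \<open>The two bounds contain \<open>g\<close> with opposite signs; weighting them with
    \<open>k\<close> and \<open>m\<close> cancels it.\<close>
  have pos: "c \<ge> 0" if "g * m \<le> c * A" "- g * k \<le> c * B" "m \<ge> 1/2" "k \<ge> 1/2" "A \<ge> 0" "B \<ge> 0" "A > 0 \<or> B > 0" for c m A k B :: real
  proof -
    have "g * m * k \<le> c * A * k" "- g * k * m \<le> c * B * m"
      using mult_right_mono[OF that(1), of k] mult_right_mono[OF that(2), of m] that by auto
    then have "0 \<le> c * (A * k + B * m)" by (simp add: algebra_simps)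
    moreover have "A * k + B * m > 0" using that(7)
    proof
      assume "A > 0"
      then show ?thesis using that by (intro add_pos_nonneg mult_pos_pos mult_nonneg_nonneg) auto
    next
      assume "B > 0"
      then show ?thesis using that by (intro add_nonneg_pos mult_pos_pos mult_nonneg_nonneg) auto
    qed
    ultimately show ?thesis by (simp add: zero_le_mult_iff)
  qed
  have b0: "b \<ge> 0" using pos[OF ineq(1,3) mk(1,3) nonneg(1,3)] nd by blast
  have a0: "a \<ge> 0" using pos[OF ineq(2,4) mk(2,4) nonneg(2,4)] nd by blast
  have gb: "\<bar>g\<bar> \<le> 2 * (b * l)"
  proof (cases "g \<ge> 0")
    case True
    have "g * (1/2) \<le> g * m1" using True mk by (intro mult_left_mono) auto
    also have "\<dots> \<le> b * l" using ineq(1) small(1) b0 by (meson mult_left_mono order_trans)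
    finally show ?thesis using True by simp
  next
    case False
    have "- g * (1/2) \<le> - g * k1" using False mk by (intro mult_left_mono) auto
    also have "\<dots> \<le> b * l" using ineq(3) small(3) b0 by (meson mult_left_mono order_trans)
    finally show ?thesis using False by simp
  qed
  \<comment> \<open>Length of the component in the chord plane, squeezed between
    \<open>1 - \<bar>g\<bar>\<close> and 1.\<close>
  define s where "s = norm (a *\<^sub>R p + b *\<^sub>R q)"
  have s2: "s\<^sup>2 = 1 - g\<^sup>2"
  proof -
    have "1 = z \<bullet> z" using z(3) by (simp add: norm_eq_1)
    also have "\<dots> = (a *\<^sub>R p + b *\<^sub>R q) \<bullet> (a *\<^sub>R p + b *\<^sub>R q) + g * g"
      by (subst (1 2) zab) (use n in \<open>simp add: inner_add_left inner_add_right inner_commute norm_eq_1\<close>)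
    finally show ?thesis unfolding s_def power2_norm_eq_inner power2_eq_square[of g] by linarith
  qed
  have s2': "s\<^sup>2 = a\<^sup>2 + b\<^sup>2 + 2 * a * b * (p \<bullet> q)"
    unfolding s_def power2_norm_eq_inner using norms
    by (simp add: inner_add_left inner_add_right inner_commute norm_eq_1 power2_eq_square algebra_simps)
  have "b\<^sup>2 \<le> s\<^sup>2" using s2' a0 b0 pq(2) by simp
  also have "\<dots> \<le> 1" using s2 by simp
  finally have b1: "b \<le> 1" using b0 by (simp add: power_le_one_iff abs_square_le_1)
  have l0: "l \<ge> 0" by (simp add: l_def)
  have bl: "b * l \<le> l" using b0 b1 l0 by (simp add: mult_left_le_one_le)
  have s0: "s \<ge> 0" by (simp add: s_def)
  have g2: "g\<^sup>2 \<le> 1" using s2 by (smt (verit) zero_le_power2)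
  then have g1: "\<bar>g\<bar> \<le> 1" by (simp add: abs_square_le_1)
  have s1: "s \<le> 1" using s2 s0 by (smt (verit) zero_le_power2 power2_le_imp_le one_power2)
  have sg: "1 - \<bar>g\<bar> \<le> s"
  proof (rule power2_le_imp_le[OF _ s0])
    have "\<bar>g\<bar> * \<bar>g\<bar> \<le> \<bar>g\<bar>" by (rule mult_left_le[OF g1 abs_ge_zero])
    then show "(1 - \<bar>g\<bar>)\<^sup>2 \<le> s\<^sup>2" unfolding s2 by (simp add: power2_eq_square algebra_simps)
  qed
  have u1: "s \<le> a + b" using norm_triangle_ineq[of "a *\<^sub>R p" "b *\<^sub>R q"] a0 b0 norms by (simp add: s_def)
  have u2: "a + b \<le> s + b * l"
  proof -
    have "(a + b) *\<^sub>R p = (a *\<^sub>R p + b *\<^sub>R q) - b *\<^sub>R (q - p)" by (simp add: algebra_simps)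
    then have "norm ((a + b) *\<^sub>R p) \<le> s + norm (b *\<^sub>R (q - p))" unfolding s_def by (metis norm_triangle_ineq4)
    then show ?thesis using a0 b0 norms by (simp add: l_def)
  qed
  have ab1: "\<bar>a + b - 1\<bar> \<le> 2 * l" using u1 u2 s1 sg gb bl by linarith
  have "z - p = (a + b - 1) *\<^sub>R p + (b *\<^sub>R (q - p) + g *\<^sub>R n)" by (subst zab) (simp add: algebra_simps)
  then have "norm (z - p) \<le> norm ((a + b - 1) *\<^sub>R p) + (norm (b *\<^sub>R (q - p)) + norm (g *\<^sub>R n))"
    using norm_triangle_ineq[of "(a + b - 1) *\<^sub>R p" "b *\<^sub>R (q - p) + g *\<^sub>R n"]
      norm_triangle_ineq[of "b *\<^sub>R (q - p)" "g *\<^sub>R n"] by simp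
  also have "\<dots> = \<bar>a + b - 1\<bar> + (b * l + \<bar>g\<bar>)" using norms n b0 by (simp add: l_def)
  \<comment> \<open>\<open>2 * l\<close> for \<open>a + b - 1\<close>, \<open>l\<close> along the
    chord, \<open>2 * l\<close> for the height.\<close>
  also have "\<dots> \<le> 5 * l" using ab1 gb bl by linarith
  finally have "norm (z - p) \<le> 5 * norm (q - p)" by (simp only: l_def)
  with zab[unfolded g_def] a0 b0 show ?thesis by (rule that)
qed

lemma lens_small: "z \<in> C \<Longrightarrow> z \<in> E \<Longrightarrow> norm z = 1 \<Longrightarrow> norm (z - p) \<le> 5 * norm (q - p)"
  using lens_coordinates by metis

text \<open>At a common boundary point the normal of \<open>C\<close> forces height at least 0 and
  that of \<open>E\<close> at most 0, so \<open>z\<close> lies on the arc from \<open>p\<close> to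
  \<open>q\<close>. A point inside the arc would make both bodies flat along the chord.\<close>

lemma lens_corners:
  assumes z: "z \<in> bd C" "z \<in> bd E"
  shows "z = p \<or> z = q"
proof -
  have zm: "z \<in> C" "z \<in> E" "norm z = 1" using z C E bd_mem bd_norm by auto
  obtain a b where ab: "z = a *\<^sub>R p + b *\<^sub>R q + (z \<bullet> n) *\<^sub>R n" "0 \<le> a" "0 \<le> b" "norm (z - p) \<le> 5 * norm (q - p)"
    using lens_coordinates[OF zm] by blast
  define g where "g = z \<bullet> n"
  note ab = ab[folded g_def]
  have Uz: "unormal C z \<bullet> n > 0" "unormal E z \<bullet> n < 0" using UC[OF z(1) ab(4)] UE[OF z(2) ab(4)] by auto
  have e: "a * (u \<bullet> p) + b * (u \<bullet> q) + g * (u \<bullet> n) = 0" if "u \<bullet> z = 0" for u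
    using that by (subst (asm) ab(1)) (simp add: inner_add_right)
  have le: "unormal C z \<bullet> p \<le> 0" "unormal C z \<bullet> q \<le> 0" "unormal E z \<bullet> p \<le> 0" "unormal E z \<bullet> q \<le> 0"
    using unormal(4)[OF C(1) z(1)] unormal(4)[OF E(1) z(2)] mem by auto
  have le': "a * (unormal C z \<bullet> p) \<le> 0" "b * (unormal C z \<bullet> q) \<le> 0" "a * (unormal E z \<bullet> p) \<le> 0" "b * (unormal E z \<bullet> q) \<le> 0"
    using le ab by (auto simp: mult_nonneg_nonpos)
  note eC = e[OF unormal(3)[OF C(1) z(1)]] and eE = e[OF unormal(3)[OF E(1) z(2)]]
  have "g * (unormal C z \<bullet> n) \<ge> 0" "g * (unormal E z \<bullet> n) \<ge> 0" using eC eE le' by linarith+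
  then have g0: "g = 0" using Uz by (auto simp: zero_le_mult_iff)
  show ?thesis
  proof (cases "a = 0 \<or> b = 0")
    case True
    then show ?thesis
    proof
      assume "a = 0"
      then have "z = b *\<^sub>R q" using ab(1) g0 by simp
      moreover have "b = 1" using zm(3) norms ab(3) \<open>z = b *\<^sub>R q\<close> by simp
      ultimately show ?thesis by simp
    next
      assume "b = 0"
      then have "z = a *\<^sub>R p" using ab(1) g0 by simp
      moreover have "a = 1" using zm(3) norms ab(2) \<open>z = a *\<^sub>R p\<close> by simp
      ultimately show ?thesis by simp
    qed
  next
    case False
    have "a * (unormal C z \<bullet> p) = 0" "b * (unormal C z \<bullet> q) = 0" "a * (unormal E z \<bullet> p) = 0" "b * (unormal E z \<bullet> q) = 0"
      using eC eE le' unfolding g0 mult_zero_left add_0_right by linarith+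
    then have o: "unormal C z \<bullet> p = 0" "unormal C z \<bullet> q = 0" "unormal E z \<bullet> p = 0" "unormal E z \<bullet> q = 0" using False by auto
    have "unormal C z \<in> normals C p" "unormal E z \<in> normals E p"
      using o unormal(1)[OF C(1) z(1)] unormal(1)[OF E(1) z(2)] by (auto simp: normals_iff)
    then have "unormal C z = unormal C p" "unormal E z = unormal E p"
      using unormal_unique[OF C pC] unormal_unique[OF E pE] unormal(2)[OF C(1) z(1)] unormal(2)[OF E(1) z(2)] by auto
    then show ?thesis using nondeg o by auto
  qed
qed

text \<open>The point \<open>p + q\<close> is interior to a body that is not flat along the chord: a
  supporting normal there would vanish at both ends.\<close>

lemma lens_interior: "interior C \<inter> interior E \<noteq> {}"
proof -
  have mid: "p + q \<in> interior B" if B: "cbody B" "smooth B" "p \<in> bd B" "q \<in> bd B" "unormal B p \<bullet> q < 0" for B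
  proof (rule ccontr)
    assume "p + q \<notin> interior B"
    then obtain w where w: "norm w = 1" "w \<in> polar B" "w \<bullet> (p + q) \<ge> 0" by (rule polar_support[OF B(1)])
    have "w \<bullet> p \<le> 0" "w \<bullet> q \<le> 0" using w(2) bd_mem[OF B(1)] B(3,4) by (auto simp: polarD)
    then have "w \<bullet> p = 0" "w \<bullet> q = 0" using w(3) by (auto simp: inner_add_right)
    then have "w = unormal B p" using w by (intro unormal_unique B) (auto simp: normals_iff)
    then show False using B(5) \<open>w \<bullet> q = 0\<close> by simp
  qed
  have "p + q \<in> C" "p + q \<in> E" using cbody_add[OF C(1) mem(1,2)] cbody_add[OF E(1) mem(3,4)] by auto
  from nondeg show ?thesis
  proof
    assume "unormal C p \<bullet> q < 0"
    then have "p + q \<in> interior C" using mid C pC qC by blast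
    then show ?thesis using interior_Int_nonempty[OF E(1) \<open>p + q \<in> E\<close>] by (auto simp: Int_commute)
  next
    assume "unormal E p \<bullet> q < 0"
    then have "p + q \<in> interior E" using mid E pE qE by blast
    then show ?thesis using interior_Int_nonempty[OF C(1) \<open>p + q \<in> C\<close>] by auto
  qed
qed

text \<open>A corner carries two distinct unit normals, which a point on the boundary of only one
  smooth body cannot; hence corners go to corners and their normals to normals of one of the
  bodies.\<close>

lemma corner_image:
  assumes f: "orthogonal_transformation f" "f ` (C \<inter> E) = C \<inter> E" and x: "x = p \<or> x = q"
  shows "f x = p \<or> f x = q"
    "f (unormal C x) = unormal C (f x) \<or> f (unormal C x) = unormal E (f x)"
    "f (unormal E x) = unormal C (f x) \<or> f (unormal E x) = unormal E (f x)"
    "f (unormal C x) \<noteq> f (unormal E x)"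
proof -
  have xb: "x \<in> bd C" "x \<in> bd E" "x \<in> C" "x \<in> E" using x pC qC pE qE mem by auto
  have ox: "unormal C x \<bullet> n > 0" "unormal E x \<bullet> n < 0" using x Un by auto
  then have "unormal C x \<noteq> unormal E x" by auto
  then show ne: "f (unormal C x) \<noteq> f (unormal E x)" using orthogonal_transformation_inj[OF f(1)] by (simp add: inj_eq)
  have fxM: "f x \<in> C \<inter> E" using f(2) xb by blast
  have nfx: "norm (f x) = 1" using orth_norm[OF f(1)] bd_norm[OF xb(1)] by simp
  have nU: "norm (f (unormal C x)) = 1" "norm (f (unormal E x)) = 1" using orth_norm[OF f(1)] unormal C E xb by auto
  have nM: "unormal C x \<in> normals (C \<inter> E) x" "unormal E x \<in> normals (C \<inter> E) x"
    using normals_Int_mono1[of C x E] normals_Int_mono2[of E x C] unormal[OF C(1) xb(1)] unormal[OF E(1) xb(2)] by auto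
  then have fM: "f (unormal C x) \<in> normals (C \<inter> E) (f x)" "f (unormal E x) \<in> normals (C \<inter> E) (f x)"
    using normals_image[OF f(1), of _ "C \<inter> E" x] f(2) by auto
  have int: "f x \<in> interior B" if "cbody B" "f x \<in> B" "f x \<notin> bd B" for B
    using that nfx cbodyD(2)[OF that(1)] by (auto simp: bd_def frontier_def)
  have "f x \<in> bd C"
  proof (rule ccontr)
    assume "f x \<notin> bd C"
    then have "f x \<in> interior C" using int C fxM by blast
    then have "normals (C \<inter> E) (f x) = normals E (f x)"
      using normals_Int_interior[OF E(1) C(1), of "f x"] lens_interior fxM by (simp add: Int_commute)
    then have fE: "f (unormal C x) \<in> normals E (f x)" "f (unormal E x) \<in> normals E (f x)" using fM by auto
    then have "f x \<in> bd E" using fxM nfx nU by (intro normal_imp_bd[OF E(1) _ _ fE(1)]) auto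
    then show False using E(2) fE nU ne unfolding smooth_def by blast
  qed
  moreover have "f x \<in> bd E"
  proof (rule ccontr)
    assume "f x \<notin> bd E"
    then have "f x \<in> interior E" using int E fxM by blast
    then have "normals (C \<inter> E) (f x) = normals C (f x)"
      using normals_Int_interior[OF C(1) E(1), of "f x"] lens_interior fxM by simp
    then have fE: "f (unormal C x) \<in> normals C (f x)" "f (unormal E x) \<in> normals C (f x)" using fM by auto
    then show False using C(2) fE nU ne \<open>f x \<in> bd C\<close> unfolding smooth_def by blast
  qed
  ultimately have fb: "f x \<in> bd C" "f x \<in> bd E" by auto
  then show "f x = p \<or> f x = q" by (rule lens_corners)
  obtain c where c: "c \<in> interior C" "c \<in> interior E" using lens_interior by blast
  have cneg: "unormal C x \<bullet> c < 0" "unormal E x \<bullet> c < 0"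
    using unormal[OF C(1) xb(1)] unormal[OF E(1) xb(2)] by (auto intro!: polar_interior_neg c simp: normals_iff)
  have cone: "\<exists>a b. 0 \<le> a \<and> 0 \<le> b \<and> w = a *\<^sub>R unormal C x + b *\<^sub>R unormal E x" if w: "w \<in> normals (C \<inter> E) x" for w
  proof -
    obtain w1 w2 where "w1 \<in> normals C x" "w2 \<in> normals E x" "w = w1 + w2"
      using normals_Int[OF C(1) E(1) lens_interior xb(3,4) w] by blast
    then have "w = norm w1 *\<^sub>R unormal C x + norm w2 *\<^sub>R unormal E x"
      using unormal_scale[OF C xb(1)] unormal_scale[OF E xb(2)] by metis
    then show ?thesis using norm_ge_zero by blast
  qed
  have cone': "\<exists>a b. 0 \<le> a \<and> 0 \<le> b \<and> w = a *\<^sub>R unormal E x + b *\<^sub>R unormal C x" if w: "w \<in> normals (C \<inter> E) x" for w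
    using cone[OF w] by (metis add.commute)
  \<comment> \<open>Both normals are negative on \<open>c\<close>, so a factor between them would be
    positive, but they have opposite signs on \<open>n\<close>.\<close>
  have ind: "unormal E x \<noteq> r *\<^sub>R unormal C x" "unormal C x \<noteq> r *\<^sub>R unormal E x" for r
  proof -
    have no: False if "w = r *\<^sub>R u" "w \<bullet> c < 0" "u \<bullet> c < 0" "(u \<bullet> n) * (w \<bullet> n) < 0" for u w
    proof -
      have "r * (u \<bullet> c) < 0" using that by simp
      then have "r > 0" using that(3) by (simp add: mult_less_0_iff)
      moreover have "r * (u \<bullet> n)\<^sup>2 < 0" using that by (simp add: power2_eq_square mult_ac)
      ultimately show False by (simp add: mult_less_0_iff)
    qed
    show "unormal E x \<noteq> r *\<^sub>R unormal C x" using no[of "unormal E x" "unormal C x"] cneg ox by (auto simp: mult_pos_neg)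
    show "unormal C x \<noteq> r *\<^sub>R unormal E x" using no[of "unormal C x" "unormal E x"] cneg ox by (auto simp: mult_neg_pos)
  qed
  have xM: "x \<in> C \<inter> E" using xb by blast
  have nz: "unormal C x \<noteq> 0" "unormal E x \<noteq> 0" using ox by auto
  have "f (unormal C x) \<in> normals C (f x) \<or> f (unormal C x) \<in> normals E (f x)"
    by (rule extreme_normal_transfer[OF C(1) E(1) lens_interior f xM nM(1) nz(1) cone cneg ind(1)])
  then show "f (unormal C x) = unormal C (f x) \<or> f (unormal C x) = unormal E (f x)"
    using unormal_unique[OF C fb(1)] unormal_unique[OF E fb(2)] nU by blast
  have "f (unormal E x) \<in> normals C (f x) \<or> f (unormal E x) \<in> normals E (f x)"
    by (rule extreme_normal_transfer[OF C(1) E(1) lens_interior f xM nM(2) nz(2) cone' cneg(2,1) ind(2)])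
  then show "f (unormal E x) = unormal C (f x) \<or> f (unormal E x) = unormal E (f x)"
    using unormal_unique[OF C fb(1)] unormal_unique[OF E fb(2)] nU by blast
qed

text \<open>The three alternatives come from the reflection exchanging the ends, the reflection in
  the chord plane exchanging the bodies, and the half turn exchanging both.\<close>

lemma lens_symmetry:
  assumes f: "orthogonal_transformation f" "f \<noteq> id" "f ` (C \<inter> E) = C \<inter> E"
  shows "unormal C p \<bullet> q = unormal C q \<bullet> p \<and> unormal E p \<bullet> q = unormal E q \<bullet> p \<or>
    unormal C p \<bullet> q = unormal E p \<bullet> q \<and> unormal C q \<bullet> p = unormal E q \<bullet> p \<or>
    unormal C p \<bullet> q = unormal E q \<bullet> p \<and> unormal C q \<bullet> p = unormal E p \<bullet> q"
proof -
  note cp = corner_image[OF f(1,3) disjI1[OF refl]] and cq = corner_image[OF f(1,3) disjI2[OF refl]]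
  have inj: "f p \<noteq> f q" using orthogonal_transformation_inj[OF f(1)] pq(1) by (simp add: inj_eq)
  have lf: "linear f" using f(1) by (rule orthogonal_transformation_linear)
  have ip: "f x \<bullet> f y = x \<bullet> y" for x y using orth_inner[OF f(1)] .
  show ?thesis
  proof (cases "f p = p")
    case fp: True
    then have fq: "f q = q" using cq(1) inj by auto
    \<comment> \<open>With \<open>p\<close> and \<open>q\<close> fixed, a fixed vector outside their
      plane would make \<open>f\<close> the identity; so \<open>f\<close> has to exchange the
      bodies.\<close>
    have nofix: "f u \<noteq> u" if "u \<bullet> n \<noteq> 0" for u
    proof
      assume fu: "f u = u"
      obtain a b where ab: "u = a *\<^sub>R p + b *\<^sub>R q + (u \<bullet> n) *\<^sub>R n"
        using chord_coordinates[OF norms pq n] by blast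
      have "f u = f (a *\<^sub>R p + b *\<^sub>R q + (u \<bullet> n) *\<^sub>R n)" by (rule arg_cong[OF ab])
      also have "\<dots> = a *\<^sub>R p + b *\<^sub>R q + (u \<bullet> n) *\<^sub>R f n" by (simp add: linear_add[OF lf] linear_scale[OF lf] fp fq)
      finally have "a *\<^sub>R p + b *\<^sub>R q + (u \<bullet> n) *\<^sub>R f n = a *\<^sub>R p + b *\<^sub>R q + (u \<bullet> n) *\<^sub>R n"
        using ab fu by (simp only:)
      then have "(u \<bullet> n) *\<^sub>R f n = (u \<bullet> n) *\<^sub>R n" by simp
      then have "f n = n" using that by simp
      moreover have "p \<noteq> - q"
        using pq norms by (auto simp: norm_eq_1)
      then have "cross3 p q \<noteq> 0" using unit_cross_nonzero[OF norms pq(1)] by blast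
      moreover have "n \<noteq> 0" "p \<bullet> n = 0" "q \<bullet> n = 0" using n by (auto simp: inner_commute)
      ultimately show False using f(2) orth_fix_three[OF f(1) _ fp fq] by blast
    qed
    have "f (unormal C p) = unormal E p" "f (unormal C q) = unormal E q"
      using nofix[of "unormal C p"] nofix[of "unormal C q"] Un cp(2) cq(2) fp fq by auto
    then have "unormal C p \<bullet> q = unormal E p \<bullet> q" "unormal C q \<bullet> p = unormal E q \<bullet> p"
      using ip[of "unormal C p" q] ip[of "unormal C q" p] fp fq by auto
    then show ?thesis by blast
  next
    case False
    then have fp: "f p = q" using cp(1) by auto
    then have fq: "f q = p" using cq(1) inj by auto
    have e: "f (unormal C p) \<bullet> p = unormal C p \<bullet> q" "f (unormal E p) \<bullet> p = unormal E p \<bullet> q"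
        "f (unormal C q) \<bullet> q = unormal C q \<bullet> p" "f (unormal E q) \<bullet> q = unormal E q \<bullet> p"
      using ip[of _ q] ip[of _ p] fp fq by metis+
    have "f (unormal C p) = unormal C q \<and> f (unormal E p) = unormal E q \<or> f (unormal C p) = unormal E q \<and> f (unormal E p) = unormal C q"
      using cp(2,3,4) fp by auto
    then show ?thesis using e by metis
  qed
qed

end

section \<open>Chord angles of the two bodies compared\<close>

text \<open>The right-hand side is \<open>2 * (cross3 p u \<bullet> q)\<close> divided by the
  lengths of \<open>q - p\<close> and \<open>p + q\<close>, and the latter is at most 2. A
  tangential bound thus tells how far \<open>u\<close> leans to one side of the chord plane.\<close>

lemma chord_normal:
  fixes p q u :: "real^3"
  assumes "norm p = 1" "norm q = 1" "p \<noteq> q" "p \<noteq> - q" "k * norm (q - p) \<le> cross3 p u \<bullet> q" "k \<ge> 0"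
  shows "k \<le> u \<bullet> cross3 (sgn (q - p)) (sgn (p + q))"
proof -
  define l s where "l = norm (q - p)" and "s = norm (p + q)"
  have l: "l > 0" and s: "s > 0" using assms by (auto simp: l_def s_def eq_neg_iff_add_eq_0)
  have s2: "s \<le> 2" using norm_triangle_ineq[of p q] assms by (simp add: s_def)
  have "cross3 (sgn (q - p)) (sgn (p + q)) = (1 / (l * s)) *\<^sub>R cross3 (q - p) (p + q)"
    by (simp add: sgn_div_norm cross3_bilinear(5,6) l_def s_def divide_inverse)
  also have "cross3 (q - p) (p + q) = 2 *\<^sub>R cross3 q p"
    using cross_skew[of p q] by (simp add: cross3_bilinear scaleR_2)
  finally have "u \<bullet> cross3 (sgn (q - p)) (sgn (p + q)) = 2 * (u \<bullet> cross3 q p) / (l * s)" by simp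
  also have "u \<bullet> cross3 q p = cross3 q p \<bullet> u" by (rule inner_commute)
  also have "cross3 q p \<bullet> u = cross3 p u \<bullet> q" by (rule cross_triple)
  finally have e: "u \<bullet> cross3 (sgn (q - p)) (sgn (p + q)) = 2 * (cross3 p u \<bullet> q) / (l * s)" .
  have "k * (l * s) = k * l * s" by simp
  also have "\<dots> \<le> k * l * 2" using s2 l assms(6) by (intro mult_left_mono) auto
  also have "\<dots> \<le> 2 * (cross3 p u \<bullet> q)" using assms(5) unfolding l_def by linarith
  finally show ?thesis unfolding e using l s by (simp add: pos_le_divide_eq)
qed

lemma sum_diff_orthogonal:
  fixes p q :: "'a::real_inner"
  assumes "norm p = 1" "norm q = 1"
  shows "(p + q) \<bullet> (q - p) = 0" "(norm (p + q))\<^sup>2 = 4 - (norm (q - p))\<^sup>2" "p \<bullet> q = 1 - (norm (q - p))\<^sup>2 / 2"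
  using assms by (simp_all add: power2_norm_eq_inner inner_diff_left inner_diff_right inner_add_left inner_add_right inner_commute norm_eq_1 diff_divide_distrib)

text \<open>For a chord of given length, \<open>unormal C p \<bullet> q\<close> determines the angle between the chord and the boundary
  at \<open>p\<close>, and the sign of \<open>tang C p \<bullet> q\<close> tells on which side of \<open>p\<close> the point \<open>q\<close> lies.\<close>

lemma chord_dichotomy:
  assumes C: "cbody C" "smooth C" and D: "cbody D" "smooth D" and sym: "small_sym \<epsilon> C D" and eps: "\<epsilon> > 0"
  obtains l0 where "l0 > 0"
    "\<And>p q p' q'. p \<in> bd C \<Longrightarrow> q \<in> bd C \<Longrightarrow> p' \<in> bd D \<Longrightarrow> q' \<in> bd D \<Longrightarrow> p \<noteq> q \<Longrightarrow> norm (q - p) \<le> l0 \<Longrightarrow>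
      norm (q' - p') = norm (q - p) \<Longrightarrow> tang C p \<bullet> q > 0 \<Longrightarrow> tang D p' \<bullet> q' > 0 \<Longrightarrow>
      unormal C p \<bullet> q = unormal C q \<bullet> p \<and> unormal D p' \<bullet> q' = unormal D q' \<bullet> p' \<or>
      unormal C p \<bullet> q = unormal D q' \<bullet> p' \<and> unormal C q \<bullet> p = unormal D p' \<bullet> q' \<or>
      unormal C p \<bullet> q = unormal D p' \<bullet> q' \<and> unormal C q \<bullet> p = unormal D q' \<bullet> p'"
proof -
  \<comment> \<open>With 1/16 the normals at \<open>p\<close> and \<open>p'\<close> lean by at least
    7/8 towards \<open>n\<close> and \<open>n'\<close>, and nearby normals still by 1/2.\<close>
  have eta: "0 < (1/16::real)" "(1/16::real) \<le> 1/2" by simp_all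
  obtain rC where rC: "0 < rC" "rC \<le> 1/16"
    "\<And>x y. x \<in> bd C \<Longrightarrow> y \<in> bd C \<Longrightarrow> norm (y - x) < rC \<Longrightarrow> norm (unormal C y - unormal C x) \<le> 1/16"
    "\<And>x y. x \<in> bd C \<Longrightarrow> y \<in> bd C \<Longrightarrow> norm (y - x) < rC \<Longrightarrow> (1 - 2 * (1/16)) * norm (y - x) \<le> \<bar>tang C x \<bullet> y\<bar>"
    by (rule flat_scale[OF C eta]) blast
  obtain rD where rD: "0 < rD" "rD \<le> 1/16"
    "\<And>x y. x \<in> bd D \<Longrightarrow> y \<in> bd D \<Longrightarrow> norm (y - x) < rD \<Longrightarrow> norm (unormal D y - unormal D x) \<le> 1/16"
    "\<And>x y. x \<in> bd D \<Longrightarrow> y \<in> bd D \<Longrightarrow> norm (y - x) < rD \<Longrightarrow> (1 - 2 * (1/16)) * norm (y - x) \<le> \<bar>tang D x \<bullet> y\<bar>"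
    by (rule flat_scale[OF D eta]) blast
  \<comment> \<open>The lens stays within \<open>5 * l\<close> of \<open>p\<close>, hence within
    \<open>6 * l\<close> of \<open>p'\<close> after pulling back, and has diameter at most
    \<open>10 * l\<close>.\<close>
  define l0 where "l0 = Min {rC / 8, rD / 8, \<epsilon> / 10}"
  have l0: "l0 > 0" "l0 \<le> rC / 8" "l0 \<le> rD / 8" "l0 \<le> \<epsilon> / 10" using rC rD eps by (simp_all add: l0_def)
  show ?thesis
  proof (rule that[OF l0(1)])
    fix p q p' q'
    assume pq: "p \<in> bd C" "q \<in> bd C" "p' \<in> bd D" "q' \<in> bd D" "p \<noteq> q" "norm (q - p) \<le> l0"
      "norm (q' - p') = norm (q - p)" "tang C p \<bullet> q > 0" "tang D p' \<bullet> q' > 0"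
    define l where "l = norm (q - p)"
    have l: "l > 0" "l \<le> l0" "norm (q' - p') = l" using pq by (simp_all add: l_def)
    have l1: "l \<le> 1/128" using l l0 rC by linarith
    have nrm: "norm p = 1" "norm q = 1" "norm p' = 1" "norm q' = 1" using pq bd_norm by auto
    have "p' \<noteq> q'" using l by auto
    have "l\<^sup>2 \<le> 1" using l l1 by (simp add: power_le_one)
    then have ip: "p \<bullet> q \<ge> 1/2" "p' \<bullet> q' \<ge> 1/2"
      using sum_diff_orthogonal(3)[OF nrm(1,2)] sum_diff_orthogonal(3)[OF nrm(3,4)] l by (simp_all add: l_def)
    have na: "p \<noteq> - q" "p' \<noteq> - q'" using ip nrm by (auto simp: norm_eq_1)
    define a b n where "a = sgn (p + q)" and "b = sgn (q - p)" and "n = cross3 b a"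
    define a' b' n' where "a' = sgn (p' + q')" and "b' = sgn (q' - p')" and "n' = cross3 b' a'"
    have na1: "norm a = 1" "norm a' = 1" using na by (simp_all add: a_def a'_def norm_sgn eq_neg_iff_add_eq_0)
    have nb1: "norm b = 1" "norm b' = 1" using \<open>p \<noteq> q\<close> \<open>p' \<noteq> q'\<close> by (simp_all add: b_def b'_def norm_sgn)
    have ab: "a \<bullet> b = 0" "a' \<bullet> b' = 0"
      using sum_diff_orthogonal(1)[OF nrm(1,2)] sum_diff_orthogonal(1)[OF nrm(3,4)] by (simp_all add: a_def b_def a'_def b'_def sgn_div_norm)
    then have ba: "b \<bullet> a = 0" "b' \<bullet> a' = 0" by (simp_all add: inner_commute)
    define s where "s = norm (p + q)"
    have "(norm (p' + q'))\<^sup>2 = s\<^sup>2" unfolding s_def sum_diff_orthogonal(2)[OF nrm(1,2)] sum_diff_orthogonal(2)[OF nrm(3,4)] pq(7) ..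
    then have s': "norm (p' + q') = s" by (simp add: s_def)
    have "s > 0" using na by (simp add: s_def eq_neg_iff_add_eq_0)
    have sa: "p + q = s *\<^sub>R a" "p' + q' = s *\<^sub>R a'" "q - p = l *\<^sub>R b" "q' - p' = l *\<^sub>R b'"
      using \<open>s > 0\<close> l s' by (simp_all add: a_def b_def a'_def b'_def s_def l_def sgn_div_norm)
    have half: "x = (1/2) *\<^sub>R (x + y) - (1/2) *\<^sub>R (y - x)" "y = (1/2) *\<^sub>R (x + y) + (1/2) *\<^sub>R (y - x)" for x y :: "real^3"
      by (simp_all add: vec_eq_iff field_simps)
    have pe: "p = (s/2) *\<^sub>R a - (l/2) *\<^sub>R b" "q = (s/2) *\<^sub>R a + (l/2) *\<^sub>R b" using half[where x=p and y=q] sa by simp_all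
    have pe': "p' = (s/2) *\<^sub>R a' - (l/2) *\<^sub>R b'" "q' = (s/2) *\<^sub>R a' + (l/2) *\<^sub>R b'" using half[where x=p' and y=q'] sa by simp_all
    \<comment> \<open>Orientation forbids reflecting \<open>D\<close> across the chord plane, so the
      chord is reversed: \<open>p'\<close> goes to \<open>q\<close>, \<open>q'\<close> to
      \<open>p\<close>, and \<open>n'\<close> to \<open>- n\<close>.\<close>
    define g where "g = frame_map a' b' a (- b)"
    have g: "rot g" "g a' = a" "g b' = - b" using frame_map[of a' b' a "- b"] na1 nb1 ab by (auto simp: g_def)
    have og: "orthogonal_transformation g" and lg: "linear g" using g(1) by (auto simp: rot_def orthogonal_transformation_linear)
    have gp: "g p' = q" "g q' = p" unfolding pe pe' using g by (simp_all add: linear_add[OF lg] linear_diff[OF lg] linear_scale[OF lg])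
    have gn: "g n' = - n" using g by (simp add: n'_def n_def rot_def) (metis cross_minus_left g(2,3) rot_def)
    define E where "E = g ` D"
    have E: "cbody E" "smooth E" unfolding E_def using cbody_image[OF D(1) og] smooth_image(1)[OF D og] by auto
    have UE: "unormal E (g x) = g (unormal D x)" if "x \<in> bd D" for x unfolding E_def by (rule smooth_image(2)[OF D og that])
    have bE: "p \<in> bd E" "q \<in> bd E" using bd_image[OF D(1) og, of p'] bd_image[OF D(1) og, of q'] pq gp by (auto simp: E_def)
    have ipE: "unormal E p \<bullet> q = unormal D q' \<bullet> p'" "unormal E q \<bullet> p = unormal D p' \<bullet> q'"
      using UE[OF pq(3)] UE[OF pq(4)] gp orth_inner[OF og] by metis+
    have lr: "norm (q - p) < rC" "norm (q' - p') < rD" using l l0 by (auto simp: l_def)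
    have Un: "7/8 \<le> unormal C p \<bullet> n" "7/8 \<le> unormal D p' \<bullet> n'"
      unfolding n_def n'_def a_def a'_def b_def b'_def
      using rC(4)[OF pq(1,2) lr(1)] rD(4)[OF pq(3,4) lr(2)] pq(8,9) nrm pq(5) \<open>p' \<noteq> q'\<close> na
      by (intro chord_normal; simp add: tang_def)+
    have nn: "norm n = 1" "norm n' = 1" using cross_orthonormal(1)[OF nb1(1) na1(1) ba(1)] cross_orthonormal(1)[OF nb1(2) na1(2) ba(2)] by (simp_all add: n_def n'_def)
    have n0: "n \<bullet> p = 0" "n \<bullet> q = 0" unfolding pe by (simp_all add: n_def inner_add_right inner_diff_right dot_cross_self)
    have near: "\<bar>w \<bullet> m - u \<bullet> m\<bar> \<le> 1/16" if "norm m = 1" "norm (w - u) \<le> 1/16" for w u m :: "real^3"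
      using Cauchy_Schwarz_ineq2[of "w - u" m] that by (simp add: inner_diff_left)
    show "unormal C p \<bullet> q = unormal C q \<bullet> p \<and> unormal D p' \<bullet> q' = unormal D q' \<bullet> p' \<or>
      unormal C p \<bullet> q = unormal D q' \<bullet> p' \<and> unormal C q \<bullet> p = unormal D p' \<bullet> q' \<or>
      unormal C p \<bullet> q = unormal D p' \<bullet> q' \<and> unormal C q \<bullet> p = unormal D q' \<bullet> p'"
    proof (cases "unormal C p \<bullet> q < 0 \<or> unormal E p \<bullet> q < 0")
      \<comment> \<open>Both bodies are flat along the chord, so all four inner products
        vanish.\<close>
      case False
      then have 0: "unormal C p \<bullet> q = 0" "unormal E p \<bullet> q = 0"
        using unormal(4)[OF C(1) pq(1) bd_mem[OF C(1) pq(2)]] unormal(4)[OF E(1) bE(1) bd_mem[OF E(1) bE(2)]] by auto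
      then have "unormal C q \<bullet> p = 0" "unormal E q \<bullet> p = 0"
        using unormal_transfer_eq[OF C pq(1,2)] unormal_transfer_eq[OF E bE] by auto
      then show ?thesis using 0 ipE by simp
    next
      case True
      interpret glued_caps C E p q n
      proof
        fix z assume z: "z \<in> bd C" "norm (z - p) \<le> 5 * norm (q - p)"
        then have "norm (z - p) < rC" using l l0(2) rC(1) by (simp add: l_def)
        then have "norm (unormal C z - unormal C p) \<le> 1/16" using rC(3) pq(1) z by blast
        then show "unormal C z \<bullet> n \<ge> 1/2" using near[OF nn(1), of "unormal C z" "unormal C p"] Un(1) by linarith
      next
        fix z assume z: "z \<in> bd E" "norm (z - p) \<le> 5 * norm (q - p)"
        obtain z' where z': "z = g z'" using orthogonal_transformation_surj[OF og] by (meson surjD)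
        have zb: "z' \<in> bd D" using z(1) bd_image[OF D(1) og, of z'] by (simp add: z' E_def)
        have "norm (z' - q') = norm (z - p)" using orth_norm[OF og, of "z' - q'"] by (simp add: z' linear_diff[OF lg] gp)
        then have "norm (z' - p') \<le> 6 * l" using norm_triangle_ineq[of "z' - q'" "q' - p'"] z(2) l by (simp add: l_def)
        then have "norm (z' - p') < rD" using l l0(3) rD(1) by linarith
        then have "norm (unormal D z' - unormal D p') \<le> 1/16" using rD(3) pq(3) zb by blast
        then have "unormal D z' \<bullet> n' \<ge> 1/2" using near[OF nn(2), of "unormal D z'" "unormal D p'"] Un(2) by linarith
        moreover have "unormal E z \<bullet> g n' = unormal D z' \<bullet> n'" unfolding z' UE[OF zb] by (rule orth_inner[OF og])
        ultimately show "unormal E z \<bullet> n \<le> - 1/2" by (simp add: gn)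
      qed (use C E pq bE ip nn n0 True in auto)
      have "\<exists>f. orthogonal_transformation f \<and> f \<noteq> id \<and> f ` (C \<inter> g ` D) = C \<inter> g ` D"
      proof (rule sym[unfolded small_sym_def, THEN spec, THEN mp, OF g(1), THEN mp, THEN mp])
        show "interior (C \<inter> g ` D) \<noteq> {}" using lens_interior by (simp add: E_def)
        show "\<forall>x\<in>C \<inter> g ` D \<inter> sphere 0 1. \<forall>y\<in>C \<inter> g ` D \<inter> sphere 0 1. dist x y \<le> \<epsilon>"
        proof (intro ballI)
          fix x y assume "x \<in> C \<inter> g ` D \<inter> sphere 0 1" "y \<in> C \<inter> g ` D \<inter> sphere 0 1"
          then have "norm (x - p) \<le> 5 * l" "norm (y - p) \<le> 5 * l" unfolding l_def by (auto intro!: lens_small simp: E_def)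
          then have "dist x p \<le> \<epsilon> / 2" "dist y p \<le> \<epsilon> / 2" using l l0(4) by (auto simp: dist_norm)
          then show "dist x y \<le> \<epsilon>" using dist_triangle2[of x y p] by linarith
        qed
      qed
      then obtain f where f: "orthogonal_transformation f" "f \<noteq> id" "f ` (C \<inter> E) = C \<inter> E"
        unfolding E_def by blast
      show ?thesis using lens_symmetry[OF f] unfolding ipE by auto
    qed
  qed
qed

section \<open>Existence of short chords and connectedness of the boundary\<close>

text \<open>Compactness makes the depth reached along inner normals uniform; the direction varies
  with the base point, which \<open>inward_seq\<close> allows.\<close>

lemma inward_uniform:
  fixes D :: "(real^3) set"
  assumes D: "cbody D" "smooth D"
  obtains h where "h > 0" "\<And>p t. p \<in> bd D \<Longrightarrow> 0 < t \<Longrightarrow> t \<le> h \<Longrightarrow> p - t *\<^sub>R unormal D p \<in> interior D"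
proof -
  have "\<exists>h>0. \<forall>p t. p \<in> bd D \<longrightarrow> 0 < t \<longrightarrow> t \<le> h \<longrightarrow> p - t *\<^sub>R unormal D p \<in> interior D"
  proof (rule ccontr)
    assume "\<not> ?thesis"
    then have "\<exists>z. fst z \<in> bd D \<and> 0 < snd z \<and> snd z \<le> h \<and> fst z - snd z *\<^sub>R unormal D (fst z) \<notin> interior D" if "h > 0" for h
      using that by force
    then have "\<exists>z. \<forall>n. fst (z n) \<in> bd D \<and> 0 < snd (z n) \<and> snd (z n) \<le> 1 / Suc n \<and> fst (z n) - snd (z n) *\<^sub>R unormal D (fst (z n)) \<notin> interior D"
      by (rule null_seq_choice)
    then obtain z where z: "\<And>n. fst (z n) \<in> bd D \<and> 0 < snd (z n) \<and> snd (z n) \<le> 1 / Suc n \<and> fst (z n) - snd (z n) *\<^sub>R unormal D (fst (z n)) \<notin> interior D" by blast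
    have "\<forall>n. fst (z n) \<in> bd D" using z by blast
    then obtain x r where x: "x \<in> bd D" "strict_mono (r :: nat \<Rightarrow> nat)" "((\<lambda>n. fst (z n)) \<circ> r) \<longlonglongrightarrow> x"
      using compact_bd[of D] unfolding compact_eq_seq_compact_metric seq_compact_def by metis
    have U: "((\<lambda>n. - unormal D (fst (z (r n))))) \<longlonglongrightarrow> - unormal D x"
      by (intro tendsto_minus continuous_on_tendsto_compose[OF unormal_continuous[OF D]]) (use x z in \<open>auto simp: o_def\<close>)
    have "(\<lambda>n. snd (z n)) \<longlonglongrightarrow> 0"
      by (rule Lim_null_comparison[OF _ inverse_Suc_tendsto]) (use z in \<open>auto simp: less_imp_le\<close>)
    then have t: "((\<lambda>n. snd (z n)) \<circ> r) \<longlonglongrightarrow> 0" using x(2) by (rule LIMSEQ_subseq_LIMSEQ)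
    have "\<exists>n. ((\<lambda>n. fst (z n)) \<circ> r) n + ((\<lambda>n. snd (z n)) \<circ> r) n *\<^sub>R (- unormal D (fst (z (r n)))) \<in> interior D"
    proof (rule inward_seq[OF D(1) bd_mem[OF D(1) x(1)] x(3) U _ _ t])
      fix w assume w: "w \<in> normals D x" "w \<noteq> 0"
      have "w = norm w *\<^sub>R unormal D x" by (rule unormal_scale[OF D x(1) w(1)])
      then have "w \<bullet> (- unormal D x) = - norm w * (unormal D x \<bullet> unormal D x)" by (metis inner_minus_right inner_scaleR_left mult_minus_left)
      then show "w \<bullet> (- unormal D x) < 0" using w unormal(2)[OF D(1) x(1)] by (simp add: norm_eq_1)
    qed (use z bd_mem[OF D(1)] in auto)
    then show False using z by auto
  qed
  then show ?thesis using that by metis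
qed

text \<open>Fixes one scale at which the boundary is nearly straight; 7/8 is
  \<open>1 - 2 * (1/16)\<close> from \<open>flat_scale\<close>.\<close>

locale chord_scale =
  fixes D :: "(real^3) set" and r :: real
  assumes D: "cbody D" "smooth D" and r: "0 < r" "r \<le> 1/16"
    and Uclose: "\<And>x y. x \<in> bd D \<Longrightarrow> y \<in> bd D \<Longrightarrow> norm (y - x) < r \<Longrightarrow> norm (unormal D y - unormal D x) \<le> 1/16"
    and Uflat: "\<And>x y. x \<in> bd D \<Longrightarrow> y \<in> bd D \<Longrightarrow> norm (y - x) < r \<Longrightarrow> \<bar>unormal D x \<bullet> (y - x)\<bar> \<le> 1/16 * norm (y - x)"
    and tlarge: "\<And>x y. x \<in> bd D \<Longrightarrow> y \<in> bd D \<Longrightarrow> norm (y - x) < r \<Longrightarrow> 7/8 * norm (y - x) \<le> \<bar>tang D x \<bullet> y\<bar>"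
    and chord_ex: "\<And>p l \<sigma>. p \<in> bd D \<Longrightarrow> 0 < l \<Longrightarrow> l < r \<Longrightarrow> \<bar>\<sigma>\<bar> = 1 \<Longrightarrow> \<exists>q\<in>bd D. norm (q - p) = l \<and> \<sigma> * (tang D p \<bullet> q) > 0"

text \<open>On the circle of points at distance \<open>l\<close> from \<open>p\<close>, the half on
  side \<open>\<sigma>\<close> runs from a point of \<open>D\<close> to a point outside, so it meets
  the boundary.\<close>

lemma chord_scale_exists:
  assumes D: "cbody D" "smooth D"
  obtains r where "chord_scale D r"
proof -
  have eta: "0 < (1/16::real)" "(1/16::real) \<le> 1/2" by simp_all
  obtain r0 where r0: "0 < r0" "r0 \<le> 1/16"
    "\<And>x y. x \<in> bd D \<Longrightarrow> y \<in> bd D \<Longrightarrow> norm (y - x) < r0 \<Longrightarrow> norm (unormal D y - unormal D x) \<le> 1/16"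
    "\<And>x y. x \<in> bd D \<Longrightarrow> y \<in> bd D \<Longrightarrow> norm (y - x) < r0 \<Longrightarrow> \<bar>unormal D x \<bullet> (y - x)\<bar> \<le> 1/16 * norm (y - x)"
    "\<And>x y. x \<in> bd D \<Longrightarrow> y \<in> bd D \<Longrightarrow> norm (y - x) < r0 \<Longrightarrow> (1 - 2 * (1/16)) * norm (y - x) \<le> \<bar>tang D x \<bullet> y\<bar>"
    by (rule flat_scale[OF D eta]) blast
  obtain h where h: "h > 0" "\<And>p t. p \<in> bd D \<Longrightarrow> 0 < t \<Longrightarrow> t \<le> h \<Longrightarrow> p - t *\<^sub>R unormal D p \<in> interior D"
    using inward_uniform[OF D] by metis
  \<comment> \<open>The half circle starts on the ray at depth \<open>m / k\<close>, which is at
    most \<open>2 * l\<close>; so \<open>h / 2\<close> suffices.\<close>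
  define r where "r = min r0 (h / 2)"
  have r: "0 < r" "r \<le> r0" "r \<le> h / 2" using r0 h by (auto simp: r_def)
  have "\<exists>q\<in>bd D. norm (q - p) = l \<and> \<sigma> * (tang D p \<bullet> q) > 0" if p: "p \<in> bd D" and l: "0 < l" "l < r" and \<sigma>: "\<bar>\<sigma>\<bar> = 1" for p l \<sigma>
  proof -
    define u t where "u = unormal D p" and "t = tang D p"
    define k where "k = 1 - l\<^sup>2 / 2"
    define m where "m = sqrt (1 - k\<^sup>2)"
    have l1: "l < 1/16" using l r r0 by linarith
    have "l\<^sup>2 < 1" using l l1 by (simp add: power_less_one_iff abs_square_less_1)
    then have k: "1/2 < k" "k < 1" using l by (auto simp: k_def)
    have kk: "1 - k\<^sup>2 = l\<^sup>2 - (l\<^sup>2 / 2)\<^sup>2" by (simp add: k_def power2_eq_square algebra_simps)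
    have k2: "k\<^sup>2 < 1" using k by (simp add: abs_square_less_1)
    then have m0: "m > 0" by (simp add: m_def)
    have m2: "m\<^sup>2 = 1 - k\<^sup>2" using k2 by (simp add: m_def)
    have "m\<^sup>2 \<le> l\<^sup>2" unfolding m2 kk by simp
    then have ml: "m \<le> l" by (rule power2_le_imp_le) (use l in simp)
    have nn: "p \<bullet> p = 1" "u \<bullet> u = 1" "t \<bullet> t = 1" "p \<bullet> u = 0" "u \<bullet> p = 0" "t \<bullet> p = 0" "p \<bullet> t = 0" "t \<bullet> u = 0" "u \<bullet> t = 0"
      using unormal(2,3)[OF D(1) p] tang(1-3)[OF D(1) p] bd_norm[OF p] by (auto simp: u_def t_def norm_eq_1 inner_commute)
    have ss: "\<sigma> * \<sigma> = 1" using \<sigma> by (metis abs_mult_self_eq mult_1)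
    \<comment> \<open>\<open>k\<close> is the inner product with \<open>p\<close> of the points at
      distance \<open>l\<close>, \<open>m\<close> the radius of their circle; \<theta> runs from the
      inner normal over the side \<sigma> to the outer normal.\<close>
    define c where "c = (\<lambda>\<theta>. k *\<^sub>R p + (- m * cos \<theta>) *\<^sub>R u + (\<sigma> * m * sin \<theta>) *\<^sub>R t)"
    have con: "connected (c ` {0..pi})"
      unfolding c_def by (intro connected_continuous_image continuous_intros) auto
    have "c 0 \<in> D"
    proof -
      have "m / k \<le> h"
      proof -
        have "m / k \<le> m / (1/2)" using k m0 by (intro divide_left_mono) auto
        then show ?thesis using ml l r by simp
      qed
      then have "p - (m / k) *\<^sub>R u \<in> interior D" unfolding u_def using h(2)[OF p] m0 k by simp
      then have "k *\<^sub>R (p - (m / k) *\<^sub>R u) \<in> interior D" using interior_cone_scale[OF D(1)] k by simp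
      then show ?thesis using k interior_subset by (force simp: c_def scaleR_diff_right)
    qed
    then have cD0: "c ` {0..pi} \<inter> D \<noteq> {}" by force
    have "c pi \<notin> D"
    proof
      assume "c pi \<in> D"
      then have "u \<bullet> c pi \<le> 0" using unormal(4)[OF D(1) p] by (simp add: u_def)
      then show False using m0 by (simp add: c_def inner_add_right inner_diff_right nn)
    qed
    moreover have "c pi \<in> c ` {0..pi}" by auto
    ultimately have "c ` {0..pi} - D \<noteq> {}" by blast
    with con cD0 have "c ` {0..pi} \<inter> frontier D \<noteq> {}" by (intro connected_Int_frontier)
    then obtain \<theta> where th: "0 \<le> \<theta>" "\<theta> \<le> pi" "c \<theta> \<in> frontier D" by auto
    have cc: "c \<theta> \<bullet> c \<theta> = 1"
    proof -
      have "c \<theta> \<bullet> c \<theta> = k\<^sup>2 + m\<^sup>2 * (cos \<theta>)\<^sup>2 + (\<sigma> * \<sigma>) * m\<^sup>2 * (sin \<theta>)\<^sup>2"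
        by (simp add: c_def inner_add_left inner_add_right inner_diff_left inner_diff_right nn power2_eq_square algebra_simps)
      also have "\<dots> = k\<^sup>2 + m\<^sup>2 * ((sin \<theta>)\<^sup>2 + (cos \<theta>)\<^sup>2)" unfolding ss by (simp only: distrib_left mult_1 add.commute)
      finally show ?thesis by (simp add: m2)
    qed
    then have nc: "norm (c \<theta>) = 1" by (simp add: norm_eq_1)
    then have qb: "c \<theta> \<in> bd D" using th by (simp add: bd_def)
    have "p \<bullet> c \<theta> = k" by (simp add: c_def inner_add_right inner_diff_right nn)
    then have "(norm (c \<theta> - p))\<^sup>2 = l\<^sup>2" using sum_diff_orthogonal(3)[OF bd_norm[OF p] nc] by (simp add: k_def)
    then have nl: "norm (c \<theta> - p) = l" using l by simp
    have "\<sigma> * (t \<bullet> c \<theta>) = (\<sigma> * \<sigma>) * (m * sin \<theta>)" by (simp add: c_def inner_add_right inner_diff_right nn)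
    also have "\<dots> \<ge> 0" using ss m0 th by (simp add: sin_ge_zero)
    finally have "\<sigma> * (t \<bullet> c \<theta>) \<ge> 0" .
    moreover have "t \<bullet> c \<theta> \<noteq> 0" using r0(5)[OF p qb] nl l r unfolding t_def by fastforce
    ultimately have "\<sigma> * (t \<bullet> c \<theta>) > 0" using \<sigma> by (metis abs_zero less_eq_real_def mult_eq_0_iff zero_neq_one)
    then show ?thesis using qb nl t_def by blast
  qed
  then have "chord_scale D r" using D r r0 by unfold_locales auto
  then show ?thesis by (rule that)
qed

text \<open>Seen from an interior direction \<open>c\<close>, each half great circle from
  \<open>c\<close> to \<open>- c\<close> meets the boundary exactly once, so projection onto the
  circle orthogonal to \<open>c\<close> is a homeomorphism by compactness.\<close>

lemma connected_bd:
  fixes D :: "(real^3) set"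
  assumes D: "cbody D"
  shows "connected (bd D)"
proof -
  obtain c0 where c0: "c0 \<in> interior D" using cbodyD(4)[OF D] by blast
  have "c0 \<noteq> 0" using c0 zero_frontier[OF D] by (auto simp: frontier_def)
  define c where "c = sgn c0"
  have c: "c \<in> interior D" "norm c = 1"
    using interior_cone_scale[OF D c0, of "inverse (norm c0)"] \<open>c0 \<noteq> 0\<close> by (simp_all add: c_def sgn_div_norm norm_sgn)
  have cD: "c \<in> D" using c interior_subset by blast
  have cm: "- c \<notin> D"
  proof
    assume a: "- c \<in> D"
    obtain z where "z \<notin> D" using cbodyD(5)[OF D] by auto
    then obtain w where w: "norm w = 1" "w \<in> polar D" "w \<bullet> z > 0" by (rule polar_separate[OF D])
    then have "w \<bullet> c < 0" using polar_interior_neg[OF _ _ c(1)] by fastforce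
    moreover have "w \<bullet> (- c) \<le> 0" by (rule polarD[OF w(2) a])
    ultimately show False by simp
  qed
  have cc: "c \<bullet> c = 1" using c by (simp add: norm_eq_1)
  obtain e1 :: "real^3" where e1: "norm e1 = 1" "c \<bullet> e1 = 0" by (rule orthogonal_unit_exists)
  define e2 where "e2 = cross3 c e1"
  have e2: "norm e2 = 1" "c \<bullet> e2 = 0" "e1 \<bullet> e2 = 0" "e2 \<bullet> e1 = 0"
    using cross_orthonormal(1)[OF c(2) e1] by (simp_all add: e2_def dot_cross_self inner_commute)
  define G where "G = {e. norm e = 1 \<and> c \<bullet> e = 0}"
  define proj where "proj = (\<lambda>z. sgn (z - (z \<bullet> c) *\<^sub>R c))"
  have conG: "connected G"
  proof -
    have "G = (\<lambda>\<theta>. cos \<theta> *\<^sub>R e1 + sin \<theta> *\<^sub>R e2) ` UNIV"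
    proof (intro equalityI subsetI)
      fix e assume "e \<in> G"
      then have e: "norm e = 1" "e \<bullet> c = 0" by (auto simp: G_def inner_commute)
      have ex: "e = (e \<bullet> e1) *\<^sub>R e1 + (e \<bullet> e2) *\<^sub>R e2" using orthonormal_expand[OF c(2) e1, of e] e by (simp add: e2_def)
      have "e \<bullet> e = (e \<bullet> e1)\<^sup>2 + (e \<bullet> e2)\<^sup>2" using orthonormal_inner[OF c(2) e1, of e e] e by (simp add: e2_def power2_eq_square)
      then have "(e \<bullet> e1)\<^sup>2 + (e \<bullet> e2)\<^sup>2 = 1" using e by (simp add: norm_eq_1)
      then obtain t where "e \<bullet> e1 = cos t" "e \<bullet> e2 = sin t" using sincos_total_2pi by metis
      then show "e \<in> range (\<lambda>\<theta>. cos \<theta> *\<^sub>R e1 + sin \<theta> *\<^sub>R e2)" using ex by auto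
    next
      fix e assume "e \<in> range (\<lambda>\<theta>. cos \<theta> *\<^sub>R e1 + sin \<theta> *\<^sub>R e2)"
      then obtain t where t: "e = cos t *\<^sub>R e1 + sin t *\<^sub>R e2" by blast
      have "e \<bullet> e = (cos t)\<^sup>2 + (sin t)\<^sup>2" using e1 e2 by (simp add: t inner_add_left inner_add_right norm_eq_1 power2_eq_square)
      then show "e \<in> G" using e1 e2 by (simp add: G_def norm_eq_1) (simp add: t inner_add_right)
    qed
    moreover have "connected ((\<lambda>\<theta>::real. cos \<theta> *\<^sub>R e1 + sin \<theta> *\<^sub>R e2) ` UNIV)"
      by (intro connected_continuous_image continuous_intros) auto
    ultimately show ?thesis by simp
  qed
  have offc: "z - (z \<bullet> c) *\<^sub>R c \<noteq> 0" if z: "z \<in> bd D" for z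
  proof
    assume "z - (z \<bullet> c) *\<^sub>R c = 0"
    then have e: "z = (z \<bullet> c) *\<^sub>R c" by simp
    then have "norm z = \<bar>z \<bullet> c\<bar> * norm c" by (metis norm_scaleR)
    then have "\<bar>z \<bullet> c\<bar> = 1" using bd_norm[OF z] c by simp
    then have "z \<bullet> c = 1 \<or> z \<bullet> c = -1" by linarith
    then have "z = c \<or> z = - c"
      using e by (metis scaleR_minus1_left scaleR_one)
    then show False using z c cm bd_mem[OF D z] by (auto simp: bd_def frontier_def)
  qed
  have cont: "continuous_on (bd D) proj"
    unfolding proj_def by (intro continuous_intros) (use offc in auto)
  have polarform: "z = (z \<bullet> c) *\<^sub>R c + norm (z - (z \<bullet> c) *\<^sub>R c) *\<^sub>R proj z" if "z \<in> bd D" for z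
    using offc[OF that] by (simp add: proj_def sgn_div_norm)
  have img: "proj ` bd D = G"
  proof (intro equalityI subsetI)
    fix e assume "e \<in> proj ` bd D"
    then obtain z where z: "z \<in> bd D" "e = proj z" by blast
    have "c \<bullet> (z - (z \<bullet> c) *\<^sub>R c) = 0" using cc by (simp add: inner_diff_right inner_commute)
    then show "e \<in> G" using offc[OF z(1)] by (simp add: z G_def proj_def norm_sgn) (simp add: sgn_div_norm)
  next
    fix e assume "e \<in> G"
    then have e: "norm e = 1" "c \<bullet> e = 0" "e \<bullet> c = 0" "e \<bullet> e = 1" by (auto simp: G_def inner_commute norm_eq_1)
    define h where "h = (\<lambda>\<theta>. cos \<theta> *\<^sub>R c + sin \<theta> *\<^sub>R e)"
    have "connected (h ` {0..pi})" unfolding h_def by (intro connected_continuous_image continuous_intros) auto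
    moreover have "h 0 \<in> D" "h pi \<notin> D" using cD cm by (simp_all add: h_def)
    moreover have "h 0 \<in> h ` {0..pi}" "h pi \<in> h ` {0..pi}" by auto
    ultimately have "connected (h ` {0..pi})" "h ` {0..pi} \<inter> D \<noteq> {}" "h ` {0..pi} - D \<noteq> {}" by blast+
    then have "h ` {0..pi} \<inter> frontier D \<noteq> {}" by (rule connected_Int_frontier)
    then obtain \<theta> where th: "0 \<le> \<theta>" "\<theta> \<le> pi" "h \<theta> \<in> frontier D" by auto
    have "h \<theta> \<bullet> h \<theta> = (cos \<theta>)\<^sup>2 + (sin \<theta>)\<^sup>2" by (simp add: h_def inner_add_left inner_add_right e cc power2_eq_square)
    then have hb: "h \<theta> \<in> bd D" using th by (simp add: bd_def norm_eq_1)
    have he: "h \<theta> - (h \<theta> \<bullet> c) *\<^sub>R c = sin \<theta> *\<^sub>R e" by (simp add: h_def inner_add_left cc e)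
    then have "sin \<theta> \<noteq> 0" using offc[OF hb] by auto
    then have "sin \<theta> > 0" using sin_ge_zero[OF th(1,2)] by simp
    then have "proj (h \<theta>) = e" using e by (simp add: proj_def he sgn_scaleR) (simp add: sgn_div_norm)
    then show "e \<in> proj ` bd D" using hb by blast
  qed
  have inj: "inj_on proj (bd D)"
  proof (rule inj_onI)
    \<comment> \<open>A second boundary point \<open>x\<close> on the same half circle, nearer to
      \<open>c\<close>, would be a positive combination of \<open>c\<close> and \<open>y\<close>, so
      a unit normal at \<open>x\<close> would be negative on \<open>x\<close> itself.\<close>
    have key: "\<not> (x \<bullet> c) * norm (y - (y \<bullet> c) *\<^sub>R c) > (y \<bullet> c) * norm (x - (x \<bullet> c) *\<^sub>R c)"
      if xy: "x \<in> bd D" "y \<in> bd D" "proj x = proj y" for x y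
    proof
      define a a' b b' where "a = x \<bullet> c" and "a' = y \<bullet> c" and "b = norm (x - (x \<bullet> c) *\<^sub>R c)" and "b' = norm (y - (y \<bullet> c) *\<^sub>R c)"
      assume "(x \<bullet> c) * norm (y - (y \<bullet> c) *\<^sub>R c) > (y \<bullet> c) * norm (x - (x \<bullet> c) *\<^sub>R c)"
      then have gt: "a * b' - a' * b > 0" by (simp add: a_def a'_def b_def b'_def)
      have b: "b > 0" "b' > 0" using offc xy by (auto simp: b_def b'_def)
      have x: "x = a *\<^sub>R c + b *\<^sub>R proj y" and y: "y = a' *\<^sub>R c + b' *\<^sub>R proj y"
        using polarform[OF xy(1)] polarform[OF xy(2)] xy(3) by (simp_all add: a_def a'_def b_def b'_def)
      have "b' *\<^sub>R x = (a * b' - a' * b) *\<^sub>R c + b *\<^sub>R y"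
        by (subst x, subst y) (simp add: algebra_simps)
      obtain w where w: "norm w = 1" "w \<in> normals D x" using bd_normal[OF D xy(1)] .
      have "w \<bullet> (b' *\<^sub>R x) = (a * b' - a' * b) * (w \<bullet> c) + b * (w \<bullet> y)"
        unfolding \<open>b' *\<^sub>R x = _\<close> by (simp add: inner_add_right)
      moreover have "w \<bullet> x = 0" "w \<bullet> y \<le> 0" using w bd_mem[OF D xy(2)] by (auto simp: normals_iff polarD)
      moreover have "w \<bullet> c < 0" using w c polar_interior_neg[of w D c] by (force simp: normals_iff)
      then have "(a * b' - a' * b) * (w \<bullet> c) < 0" using gt by (simp add: mult_pos_neg)
      moreover have "b * (w \<bullet> y) \<le> 0" using \<open>w \<bullet> y \<le> 0\<close> b by (simp add: mult_nonneg_nonpos)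
      ultimately show False by simp
    qed
    fix x y assume xy: "x \<in> bd D" "y \<in> bd D" "proj x = proj y"
    define b b' where "b = norm (x - (x \<bullet> c) *\<^sub>R c)" and "b' = norm (y - (y \<bullet> c) *\<^sub>R c)"
    have e: "(x \<bullet> c) * b' = (y \<bullet> c) * b" using key[OF xy] key[OF xy(2,1) xy(3)[symmetric]] by (simp add: b_def b'_def)
    have b: "b > 0" "b' > 0" using offc xy by (auto simp: b_def b'_def)
    have "b' *\<^sub>R x = (b' * (x \<bullet> c)) *\<^sub>R c + (b' * b) *\<^sub>R proj y"
      by (subst polarform[OF xy(1)]) (simp add: xy(3) b_def scaleR_add_right)
    also have "\<dots> = b *\<^sub>R ((y \<bullet> c) *\<^sub>R c + b' *\<^sub>R proj y)" using e by (simp add: scaleR_add_right mult.commute)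
    also have "(y \<bullet> c) *\<^sub>R c + b' *\<^sub>R proj y = y" using polarform[OF xy(2)] by (simp add: b'_def)
    finally have s: "b' *\<^sub>R x = b *\<^sub>R y" .
    then have "norm (b' *\<^sub>R x) = norm (b *\<^sub>R y)" by simp
    then have "b' = b" using bd_norm[OF xy(1)] bd_norm[OF xy(2)] b by simp
    then show "x = y" using s b by simp
  qed
  obtain k where "homeomorphism (bd D) G proj k"
    using homeomorphism_compact[OF compact_bd cont img inj] by blast
  then have "bd D = k ` G" "continuous_on G k" by (auto simp: homeomorphism_def)
  then show ?thesis using conG connected_continuous_image by metis
qed

section \<open>Chords with equal length\<close>

text \<open>A finite net at scale \<delta> is mapped to nets at the scales
  \<open>\<delta> * k ^ n\<close> without growing, so there are never more points than in the first
  net.\<close>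

lemma contraction_cover_finite:
  fixes X :: "'a::metric_space set"
  assumes X: "compact X" and surj: "\<tau> ` X = X" and d: "\<delta> > 0" and k: "0 < k" "k < 1"
    and contr: "\<And>x y. x \<in> X \<Longrightarrow> y \<in> X \<Longrightarrow> dist x y < \<delta> \<Longrightarrow> dist (\<tau> x) (\<tau> y) \<le> k * dist x y"
  shows "finite X"
proof (rule ccontr)
  assume inf: "infinite X"
  obtain F0 where F0: "finite F0" "F0 \<subseteq> X" "X \<subseteq> (\<Union>x\<in>F0. ball x \<delta>)"
    using compactE_image[OF X, of X "\<lambda>x. ball x \<delta>"] d by (metis (no_types, lifting) UN_I centre_in_ball open_ball subsetI)
  have cover: "\<exists>F. finite F \<and> card F \<le> card F0 \<and> F \<subseteq> X \<and> (\<forall>x\<in>X. \<exists>y\<in>F. dist x y < \<delta> * k ^ n)" for n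
  proof (induction n)
    case 0
    have "\<exists>y\<in>F0. dist x y < \<delta> * k ^ 0" if xX: "x \<in> X" for x
    proof -
      obtain y where "y \<in> F0" "x \<in> ball y \<delta>" using F0(3) xX by blast
      then show ?thesis by (intro bexI[of _ y]) (simp_all add: dist_commute)
    qed
    then show ?case using F0(1,2) by (intro exI[of _ F0]) simp
  next
    case (Suc n)
    then obtain F where F: "finite F" "card F \<le> card F0" "F \<subseteq> X" "\<And>x. x \<in> X \<Longrightarrow> \<exists>y\<in>F. dist x y < \<delta> * k ^ n" by blast
    have "\<exists>y\<in>\<tau> ` F. dist x y < \<delta> * k ^ Suc n" if "x \<in> X" for x
    proof -
      obtain x' where x': "x' \<in> X" "x = \<tau> x'" using surj \<open>x \<in> X\<close> by blast
      obtain y where y: "y \<in> F" "dist x' y < \<delta> * k ^ n" using F(4)[OF x'(1)] by blast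
      have "k ^ n \<le> 1" using k by (simp add: power_le_one)
      then have "\<delta> * k ^ n \<le> \<delta>" using mult_left_le[of "k ^ n" \<delta>] d by linarith
      then have "dist (\<tau> x') (\<tau> y) \<le> k * dist x' y" using contr[OF x'(1), of y] y F(3) by auto
      also have "\<dots> < k * (\<delta> * k ^ n)" using y k by simp
      finally show ?thesis using x' y by (auto simp: mult_ac)
    qed
    moreover have "card (\<tau> ` F) \<le> card F0" using card_image_le[OF F(1), of \<tau>] F(2) by linarith
    moreover have "\<tau> ` F \<subseteq> X" using F(3) surj by blast
    ultimately show ?case using F(1) by blast
  qed
  \<comment> \<open>One point more than the net has; at a scale below half their minimal distance,
    different points need different centres.\<close>
  obtain G where G: "finite G" "card G = Suc (card F0)" "G \<subseteq> X"
    using infinite_arbitrarily_large[OF inf] by blast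
  obtain m where m: "m > 0" "\<And>x y. x \<in> G \<Longrightarrow> y \<in> G \<Longrightarrow> x \<noteq> y \<Longrightarrow> dist x y \<ge> m"
  proof -
    define P where "P = (\<lambda>(x, y). dist x y) ` {(x, y) \<in> G \<times> G. x \<noteq> y}"
    have fP: "finite P" unfolding P_def using G(1) by (intro finite_imageI finite_subset[OF _ finite_cartesian_product[OF G(1) G(1)]]) auto
    have pP: "\<forall>p\<in>P. p > 0" by (auto simp: P_def)
    show ?thesis
    proof (rule that[of "Min (insert 1 P)"])
      show "Min (insert 1 P) > 0" using fP pP by (subst Min_gr_iff) auto
      show "dist x y \<ge> Min (insert 1 P)" if "x \<in> G" "y \<in> G" "x \<noteq> y" for x y
        using fP that by (intro Min_le) (auto simp: P_def)
    qed
  qed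
  have "(\<lambda>n. \<delta> * k ^ n) \<longlonglongrightarrow> \<delta> * 0" using k by (intro tendsto_mult LIMSEQ_power_zero tendsto_const) auto
  then have "\<forall>\<^sub>F n in sequentially. \<delta> * k ^ n < m / 2" using m by (intro order_tendstoD) auto
  then obtain n where n: "\<delta> * k ^ n < m / 2" by (meson eventually_happens' sequentially_bot)
  obtain F where F: "finite F" "card F \<le> card F0" "\<And>x. x \<in> X \<Longrightarrow> \<exists>y\<in>F. dist x y < \<delta> * k ^ n" using cover[of n] by blast
  then obtain h where h: "\<And>x. x \<in> X \<Longrightarrow> h x \<in> F \<and> dist x (h x) < \<delta> * k ^ n" by metis
  have "inj_on h G"
  proof (rule inj_onI, rule ccontr)
    fix x y assume xy: "x \<in> G" "y \<in> G" "h x = h y" "x \<noteq> y"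
    have "dist x y \<le> dist x (h x) + dist y (h x)" by (rule dist_triangle2)
    also have "\<dots> < m"
    proof -
      have "x \<in> X" "y \<in> X" using xy G(3) by auto
      then show ?thesis using h[of x] h[of y] xy(3) n by simp
    qed
    finally show False using m(2)[OF xy(1,2,4)] by simp
  qed
  then have "card G \<le> card F" using h G F by (intro card_inj_on_le) auto
  then show False using G F by simp
qed

section \<open>Geometry of chords at a fixed scale\<close>

context chord_scale
begin

lemma tclose:
  assumes "x \<in> bd D" "y \<in> bd D" "norm (y - x) < r"
  shows "norm (tang D y - tang D x) \<le> 1/8"
proof -
  have e: "tang D y - tang D x = cross3 (y - x) (unormal D y) + cross3 x (unormal D y - unormal D x)"
    by (simp add: tang_def cross3_bilinear)
  have nc: "norm (cross3 a b) \<le> norm a * norm b" for a b :: "real^3"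
  proof -
    have "(norm (cross3 a b))\<^sup>2 \<le> (norm a * norm b)\<^sup>2" using norm_cross_dot[of a b] by (smt (verit) zero_le_power2)
    then show ?thesis by (rule power2_le_imp_le) simp
  qed
  have "norm (tang D y - tang D x) \<le> norm (y - x) * norm (unormal D y) + norm x * norm (unormal D y - unormal D x)"
    unfolding e using norm_triangle_ineq nc by (meson add_mono order_trans)
  also have "\<dots> \<le> 1/8" using assms r Uclose[OF assms] unormal(2)[OF D(1) assms(2)] bd_norm[OF assms(1)] by simp
  finally show ?thesis .
qed

text \<open>The tangential components at the two ends nearly cancel: their sum is at most 1/8 of the
  chord, while each is at least 7/8 of it.\<close>

lemma tang_opposite:
  assumes "x \<in> bd D" "y \<in> bd D" "norm (y - x) < r" "\<sigma> * (tang D x \<bullet> y) > 0"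
  shows "\<sigma> * (tang D y \<bullet> x) < 0"
proof -
  define d where "d = norm (y - x)"
  have "x \<noteq> y" using assms(4) tang(2)[OF D(1) assms(1)] by auto
  then have d: "d > 0" by (simp add: d_def)
  have "tang D x \<bullet> y + tang D y \<bullet> x = - ((tang D y - tang D x) \<bullet> (y - x))"
    using tang(2)[OF D(1) assms(1)] tang(2)[OF D(1) assms(2)] by (simp add: inner_diff_left inner_diff_right)
  then have "\<bar>tang D x \<bullet> y + tang D y \<bullet> x\<bar> \<le> norm (tang D y - tang D x) * norm (y - x)"
    using Cauchy_Schwarz_ineq2[of "tang D y - tang D x" "y - x"] by simp
  also have "\<dots> \<le> 1/8 * d" unfolding d_def by (rule mult_right_mono[OF tclose[OF assms(1-3)]]) simp
  finally have s: "\<bar>tang D x \<bullet> y + tang D y \<bullet> x\<bar> \<le> 1/8 * d" .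
  have l: "7/8 * d \<le> \<bar>tang D x \<bullet> y\<bar>" "7/8 * d \<le> \<bar>tang D y \<bullet> x\<bar>"
    using tlarge[OF assms(1-3)] tlarge[OF assms(2,1)] assms(3) by (auto simp: d_def norm_minus_commute)
  show ?thesis
  proof (cases "tang D x \<bullet> y > 0")
    case True
    then have "tang D y \<bullet> x < 0" using s l d by linarith
    moreover have "\<sigma> > 0" using True assms(4) by (simp add: zero_less_mult_iff)
    ultimately show ?thesis by (simp add: mult_pos_neg)
  next
    case False
    then have "tang D y \<bullet> x > 0" using s l d by linarith
    moreover have "\<sigma> < 0" using False assms(4) by (simp add: zero_less_mult_iff)
    ultimately show ?thesis by (simp add: mult_neg_pos)
  qed
qed

text \<open>For two ends at the same distance from \<open>q\<close> the difference \<open>d\<close>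
  is orthogonal to \<open>w1 + w2\<close>, although both are nearly parallel to the tangent at
  \<open>q\<close>: the tangential product is at least 21/16 of \<open>norm d * l\<close>, the other
  two together at most 1/4 of it.\<close>

lemma chord_unique:
  assumes q: "q \<in> bd D" and p: "p \<in> bd D" "norm (p - q) = l" "\<sigma> * (tang D q \<bullet> p) > 0"
    and p2: "p2 \<in> bd D" "norm (p2 - q) = l" "\<sigma> * (tang D q \<bullet> p2) > 0" and l: "2 * l < r"
  shows "p = p2"
proof (rule ccontr)
  assume "p \<noteq> p2"
  define d w1 w2 where "d = p2 - p" and "w1 = p - q" and "w2 = p2 - q"
  define u t where "u = unormal D q" and "t = tang D q"
  have l0: "l \<ge> 0" using p(2) by auto
  have "l \<noteq> 0" using p(2,3) tang(2)[OF D(1) q] by auto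
  then have l0: "l > 0" using l0 by simp
  have d0: "norm d > 0" using \<open>p \<noteq> p2\<close> by (simp add: d_def)
  have nw: "norm w1 = l" "norm w2 = l" using p p2 by (auto simp: w1_def w2_def)
  have dw: "d = w2 - w1" by (simp add: d_def w1_def w2_def)
  have "d \<bullet> (w1 + w2) = w2 \<bullet> w2 - w1 \<bullet> w1" by (simp add: dw inner_diff_left inner_add_right inner_diff_right inner_commute)
  then have z: "d \<bullet> (w1 + w2) = 0" using nw by (simp add: dot_square_norm)
  have lr: "norm (p - q) < r" "norm (p2 - q) < r" using p p2 l l0 by auto
  have "norm d \<le> norm w2 + norm w1" unfolding dw by (rule norm_triangle_ineq4)
  then have dr: "norm (p2 - p) < r" using nw l by (simp add: d_def)
  have small: "\<bar>q \<bullet> w1\<bar> \<le> 1/16 * l" "\<bar>q \<bullet> w2\<bar> \<le> 1/16 * l"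
  proof -
    have "l * l \<le> l * (1/16)" using l r l0 by (intro mult_left_mono) auto
    then have "l\<^sup>2 / 2 \<le> 1/16 * l" using l0 by (simp add: power2_eq_square)
    then show "\<bar>q \<bullet> w1\<bar> \<le> 1/16 * l" "\<bar>q \<bullet> w2\<bar> \<le> 1/16 * l"
      using sphere_diff_inner[OF bd_norm[OF q] bd_norm[OF p(1)]] sphere_diff_inner[OF bd_norm[OF q] bd_norm[OF p2(1)]] p(2) p2(2)
      by (simp_all add: w1_def w2_def)
  qed
  have smallu: "\<bar>u \<bullet> w1\<bar> \<le> 1/16 * l" "\<bar>u \<bullet> w2\<bar> \<le> 1/16 * l"
    using Uflat[OF q p(1) lr(1)] Uflat[OF q p2(1) lr(2)] p p2 by (simp_all add: u_def w1_def w2_def)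
  have tw: "t \<bullet> w1 = t \<bullet> p" "t \<bullet> w2 = t \<bullet> p2" using tang(2)[OF D(1) q] by (simp_all add: w1_def w2_def t_def inner_diff_right)
  have large: "7/8 * l \<le> \<bar>t \<bullet> w1\<bar>" "7/8 * l \<le> \<bar>t \<bullet> w2\<bar>"
    using tlarge[OF q p(1) lr(1)] tlarge[OF q p2(1) lr(2)] p(2) p2(2) unfolding tw by (auto simp: t_def)
  have "t \<bullet> w1 > 0 \<and> t \<bullet> w2 > 0 \<or> t \<bullet> w1 < 0 \<and> t \<bullet> w2 < 0"
  proof -
    have "\<sigma> * (t \<bullet> w1) > 0" "\<sigma> * (t \<bullet> w2) > 0" using p(3) p2(3) unfolding tw by (simp_all add: t_def)
    then show ?thesis by (auto simp: zero_less_mult_iff)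
  qed
  then have tW: "7/4 * l \<le> \<bar>t \<bullet> (w1 + w2)\<bar>" using large unfolding inner_add_right by linarith
  have td: "3/4 * norm d \<le> \<bar>t \<bullet> d\<bar>"
  proof -
    have "7/8 * norm d \<le> \<bar>tang D p \<bullet> p2\<bar>" using tlarge[OF p(1) p2(1) dr] by (simp add: d_def)
    also have "tang D p \<bullet> p2 = tang D p \<bullet> d" using tang(2)[OF D(1) p(1)] by (simp add: d_def inner_diff_right)
    finally have 1: "7/8 * norm d \<le> \<bar>tang D p \<bullet> d\<bar>" .
    have "\<bar>(tang D p - t) \<bullet> d\<bar> \<le> norm (tang D p - t) * norm d" by (rule Cauchy_Schwarz_ineq2)
    also have "\<dots> \<le> 1/8 * norm d" unfolding t_def by (rule mult_right_mono[OF tclose[OF q p(1) lr(1)]]) simp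
    finally show ?thesis using 1 unfolding inner_diff_left by linarith
  qed
  have o: "norm q = 1" "norm u = 1" "q \<bullet> u = 0" using unormal[OF D(1) q] bd_norm[OF q] by (auto simp: u_def inner_commute)
  have "d \<bullet> (w1 + w2) = (d \<bullet> q) * ((w1 + w2) \<bullet> q) + (d \<bullet> u) * ((w1 + w2) \<bullet> u) + (d \<bullet> t) * ((w1 + w2) \<bullet> t)"
    using orthonormal_inner[OF o, of d "w1 + w2"] by (simp add: t_def tang_def u_def)
  then have e: "(t \<bullet> d) * (t \<bullet> (w1 + w2)) = - ((q \<bullet> d) * (q \<bullet> (w1 + w2)) + (u \<bullet> d) * (u \<bullet> (w1 + w2)))"
    using z by (simp add: inner_commute)
  have b: "\<bar>(v \<bullet> d) * (v \<bullet> (w1 + w2))\<bar> \<le> norm d * (1/8 * l)" if "norm v = 1" "\<bar>v \<bullet> w1\<bar> \<le> 1/16 * l" "\<bar>v \<bullet> w2\<bar> \<le> 1/16 * l" for v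
  proof -
    have "\<bar>v \<bullet> d\<bar> \<le> norm d" using Cauchy_Schwarz_ineq2[of v d] that by simp
    moreover have "\<bar>v \<bullet> (w1 + w2)\<bar> \<le> 1/8 * l" unfolding inner_add_right using that by linarith
    ultimately show ?thesis unfolding abs_mult by (intro mult_mono) auto
  qed
  have "(3/4 * norm d) * (7/4 * l) \<le> \<bar>t \<bullet> d\<bar> * \<bar>t \<bullet> (w1 + w2)\<bar>" using td tW l0 by (intro mult_mono) auto
  also have "\<dots> \<le> norm d * (1/8 * l) + norm d * (1/8 * l)"
    using b[OF o(1) small] b[OF o(2) smallu] unfolding abs_mult[symmetric] e by linarith
  finally have "21/16 * (norm d * l) \<le> 1/4 * (norm d * l)" by simp
  moreover have "norm d * l > 0" using d0 l0 by simp
  ultimately show False by linarith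
qed

lemma bd_infinite: "infinite (bd D)"
proof
  assume fin: "finite (bd D)"
  obtain p where p: "p \<in> bd D" using bd_nonempty[OF D(1)] by blast
  have "{0<..<r} \<subseteq> (\<lambda>q. norm (q - p)) ` bd D"
  proof
    fix l assume "l \<in> {0<..<r}"
    then obtain q where "q \<in> bd D" "norm (q - p) = l" using chord_ex[OF p, of l 1] by auto
    then show "l \<in> (\<lambda>q. norm (q - p)) ` bd D" by blast
  qed
  then have "finite {0<..<r}" using fin finite_surj by blast
  then show False using infinite_Ioo[OF r(1)] by blast
qed

lemma continuous_tang: "continuous_on (bd D) (tang D)"
  unfolding tang_def by (intro continuous_on_cross continuous_on_id unormal_continuous D)

lemma chord_tang_sq:
  assumes "x \<in> bd D" "y \<in> bd D"
  shows "(tang D x \<bullet> y)\<^sup>2 = 1 - (x \<bullet> y)\<^sup>2 - (unormal D x \<bullet> y)\<^sup>2"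
  using tang(4)[OF D(1) assms(1), of y] bd_norm[OF assms(2)] by (simp add: norm_eq_1 inner_commute)

text \<open>The points whose forward chord has the value \<open>a\<close> at its start, and those
  where it has \<open>b\<close>, form closed sets that are disjoint by \<open>chord_unique\<close>;
  connectedness leaves one of them empty.\<close>

lemma chord_orientation:
  assumes l: "0 < l" "2 * l < r" and ab: "a \<noteq> b"
    and all: "\<And>p q. p \<in> bd D \<Longrightarrow> q \<in> bd D \<Longrightarrow> norm (q - p) = l \<Longrightarrow>
      unormal D p \<bullet> q = a \<and> unormal D q \<bullet> p = b \<or> unormal D p \<bullet> q = b \<and> unormal D q \<bullet> p = a"
  obtains \<sigma> where "\<bar>\<sigma>\<bar> = 1" "\<And>p q. p \<in> bd D \<Longrightarrow> q \<in> bd D \<Longrightarrow> norm (q - p) = l \<Longrightarrow> \<sigma> * (tang D p \<bullet> q) > 0 \<Longrightarrow>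
    unormal D p \<bullet> q = a \<and> unormal D q \<bullet> p = b"
proof -
  \<comment> \<open>The weak sign condition makes \<open>P v\<close> closed; \<open>tlarge\<close>
    excludes equality.\<close>
  define P where "P = (\<lambda>v. {p \<in> bd D. \<exists>q\<in>bd D. norm (q - p) = l \<and> tang D p \<bullet> q \<ge> 0 \<and> unormal D p \<bullet> q = v})"
  have pos: "tang D p \<bullet> q > 0" if "p \<in> bd D" "q \<in> bd D" "norm (q - p) = l" "tang D p \<bullet> q \<ge> 0" for p q
    using tlarge[OF that(1,2)] that l by auto
  have closedP: "closed (P v)" for v
  proof -
    let ?S = "(bd D \<times> bd D) \<inter> (\<lambda>x. (norm (snd x - fst x), tang D (fst x) \<bullet> snd x, unormal D (fst x) \<bullet> snd x)) -` ({l} \<times> {0..} \<times> {v})"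
    have "continuous_on (bd D \<times> bd D) (\<lambda>x. (norm (snd x - fst x), tang D (fst x) \<bullet> snd x, unormal D (fst x) \<bullet> snd x))"
      by (intro continuous_intros continuous_on_compose2[OF continuous_tang] continuous_on_compose2[OF unormal_continuous[OF D]]) auto
    then have "closed ?S"
      by (intro continuous_closed_preimage closed_Times closed_atLeast) (auto intro: compact_imp_closed compact_bd)
    then have "compact ?S"
      using compact_Int_closed[OF compact_Times[OF compact_bd compact_bd], of ?S D D] by (simp add: Int_absorb1)
    then have "compact (fst ` ?S)" by (intro compact_continuous_image continuous_intros)
    moreover have "fst ` ?S = P v" unfolding P_def by force
    ultimately show ?thesis by (simp add: compact_imp_closed)
  qed
  have cover: "bd D \<subseteq> P a \<union> P b"
  proof
    fix p assume p: "p \<in> bd D"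
    have "l < r" using l by simp
    then obtain q where q: "q \<in> bd D" "norm (q - p) = l" "1 * (tang D p \<bullet> q) > 0" using chord_ex[OF p l(1), of 1] by auto
    then show "p \<in> P a \<union> P b" using all[OF p q(1,2)] p by (auto simp: P_def)
  qed
  have disj: "P a \<inter> P b \<inter> bd D = {}"
  proof (rule ccontr)
    assume "P a \<inter> P b \<inter> bd D \<noteq> {}"
    then obtain p q q2 where h: "p \<in> bd D" "q \<in> bd D" "norm (q - p) = l" "tang D p \<bullet> q \<ge> 0" "unormal D p \<bullet> q = a"
      "q2 \<in> bd D" "norm (q2 - p) = l" "tang D p \<bullet> q2 \<ge> 0" "unormal D p \<bullet> q2 = b" unfolding P_def by blast
    have "q = q2" by (rule chord_unique[OF h(1,2,3) _ h(6,7) _ l(2), of 1]) (use pos h in auto)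
    then show False using h ab by simp
  qed
  have "P a \<inter> bd D = {} \<or> P b \<inter> bd D = {}"
    using connected_closedD[OF connected_bd[OF D(1)] disj cover closedP closedP] .
  then show ?thesis
  proof
    assume e: "P b \<inter> bd D = {}"
    show ?thesis
    proof (rule that[of 1])
      fix p q assume h: "p \<in> bd D" "q \<in> bd D" "norm (q - p) = l" "1 * (tang D p \<bullet> q) > 0"
      have "unormal D p \<bullet> q \<noteq> b" using e h by (force simp: P_def)
      then show "unormal D p \<bullet> q = a \<and> unormal D q \<bullet> p = b" using all[OF h(1-3)] by blast
    qed simp
  next
    assume e: "P a \<inter> bd D = {}"
    show ?thesis
    proof (rule that[of "-1"])
      fix p q assume h: "p \<in> bd D" "q \<in> bd D" "norm (q - p) = l" "-1 * (tang D p \<bullet> q) > 0"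
      have "-1 * (tang D q \<bullet> p) < 0" using tang_opposite[OF h(1,2) _ h(4)] h(3) l by simp
      then have "q \<notin> P a \<Longrightarrow> unormal D q \<bullet> p \<noteq> a" using h by (auto simp: P_def norm_minus_commute less_imp_le)
      then have "unormal D q \<bullet> p \<noteq> a" using e h by blast
      then show "unormal D p \<bullet> q = a \<and> unormal D q \<bullet> p = b" using all[OF h(1-3)] by blast
    qed simp
  qed
qed

text \<open>If all chords of length \<open>l\<close> met the boundary with different angles at their two ends, the map sending
  one end to the other would contract lengths by a definite factor while permuting a curve of finite size.\<close>

lemma no_asymmetric_length:
  assumes l: "0 < l" "2 * l < r" and ab: "b < a" "a \<le> 0"
    and all: "\<And>p q. p \<in> bd D \<Longrightarrow> q \<in> bd D \<Longrightarrow> norm (q - p) = l \<Longrightarrow>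
      unormal D p \<bullet> q = a \<and> unormal D q \<bullet> p = b \<or> unormal D p \<bullet> q = b \<and> unormal D q \<bullet> p = a"
  shows False
proof -
  have "a \<noteq> b" using ab by simp
  obtain \<sigma> where \<sigma>: "\<bar>\<sigma>\<bar> = 1" "\<And>p q. p \<in> bd D \<Longrightarrow> q \<in> bd D \<Longrightarrow> norm (q - p) = l \<Longrightarrow> \<sigma> * (tang D p \<bullet> q) > 0 \<Longrightarrow>
    unormal D p \<bullet> q = a \<and> unormal D q \<bullet> p = b"
    by (rule chord_orientation[OF l \<open>a \<noteq> b\<close> all]) blast+
  have lr: "l < r" using l by simp
  \<comment> \<open>Chords directed so that the end with value \<open>a\<close> comes first; \<tau>
    will map the second end to the first.\<close>
  define R where "R = (\<lambda>p q. p \<in> bd D \<and> q \<in> bd D \<and> norm (q - p) = l \<and> \<sigma> * (tang D p \<bullet> q) > 0)"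
  have R_iff: "R p q \<longleftrightarrow> p \<in> bd D \<and> q \<in> bd D \<and> norm (p - q) = l \<and> - \<sigma> * (tang D q \<bullet> p) > 0" for p q
    unfolding R_def using tang_opposite[of p q \<sigma>] tang_opposite[of q p "- \<sigma>"] lr by (auto simp: norm_minus_commute)
  have ex1: "\<exists>p. R p q" if "q \<in> bd D" for q
    using chord_ex[OF that l(1) lr, of "- \<sigma>"] \<sigma>(1) that unfolding R_iff by auto
  have ex2: "\<exists>q. R p q" if "p \<in> bd D" for p
    using chord_ex[OF that l(1) lr, of \<sigma>] \<sigma>(1) that unfolding R_def by auto
  have uniq: "p = p2" if "R p q" "R p2 q" for p p2 q
    using that chord_unique[of q p l "- \<sigma>" p2] l(2) unfolding R_iff by blast
  define \<tau> where "\<tau> = (\<lambda>q. SOME p. R p q)"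
  have \<tau>: "R (\<tau> q) q" if "q \<in> bd D" for q unfolding \<tau>_def by (rule someI_ex[OF ex1[OF that]])
  have surj: "\<tau> ` bd D = bd D"
  proof (intro equalityI subsetI)
    fix p assume "p \<in> \<tau> ` bd D" then show "p \<in> bd D" using \<tau> by (auto simp: R_def)
  next
    fix p assume "p \<in> bd D"
    then obtain q where q: "R p q" using ex2 by blast
    then have "q \<in> bd D" by (simp add: R_def)
    then have "\<tau> q = p" using uniq[OF \<tau> q] by simp
    then show "p \<in> \<tau> ` bd D" using \<open>q \<in> bd D\<close> by blast
  qed
  \<comment> \<open>\<open>Sa\<close> and \<open>Sb\<close> are the tangential components at the two
    ends. Infinitesimally \<tau> scales lengths by \<open>Sb / Sa\<close>, which is less than 1
    because \<open>b\<close> is the more negative value.\<close>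
  define c where "c = 1 - l\<^sup>2 / 2"
  define Sa where "Sa = sqrt (1 - c\<^sup>2 - a\<^sup>2)"
  define Sb where "Sb = sqrt (1 - c\<^sup>2 - b\<^sup>2)"
  have S: "\<bar>tang D p \<bullet> q\<bar> = Sa" "\<bar>tang D q \<bullet> p\<bar> = Sb" if "R p q" for p q
  proof -
    have h: "p \<in> bd D" "q \<in> bd D" "unormal D p \<bullet> q = a" "unormal D q \<bullet> p = b" "norm (q - p) = l" using that \<sigma>(2) by (auto simp: R_def)
    have "p \<bullet> q = c" using sum_diff_orthogonal(3)[OF bd_norm[OF h(1)] bd_norm[OF h(2)]] h(5) by (simp add: c_def)
    then have "(tang D p \<bullet> q)\<^sup>2 = 1 - c\<^sup>2 - a\<^sup>2" "(tang D q \<bullet> p)\<^sup>2 = 1 - c\<^sup>2 - b\<^sup>2"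
      using chord_tang_sq[OF h(1,2)] chord_tang_sq[OF h(2,1)] h by (simp_all add: inner_commute)
    then show "\<bar>tang D p \<bullet> q\<bar> = Sa" "\<bar>tang D q \<bullet> p\<bar> = Sb" unfolding Sa_def Sb_def by (metis real_sqrt_abs)+
  qed
  obtain q0 where q0: "q0 \<in> bd D" using bd_nonempty[OF D(1)] by blast
  have R0: "R (\<tau> q0) q0" using \<tau>[OF q0] .
  have Sa0: "Sa > 0" using S(1)[OF R0] R0 by (auto simp: R_def)
  have Sb0: "Sb > 0" using S(2)[OF R0] R0 unfolding R_iff by auto
  have "(- a)\<^sup>2 < (- b)\<^sup>2" using ab by (intro power_strict_mono) auto
  then have "a\<^sup>2 < b\<^sup>2" by simp
  then have SS: "Sb < Sa" unfolding Sa_def Sb_def by simp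
  \<comment> \<open>Midway between \<open>Sb / Sa\<close> and 1.\<close>
  define k where "k = (1 + Sb / Sa) / 2"
  have k: "0 < k" "k < 1" "Sb < k * Sa" using SS Sa0 Sb0 by (auto simp: k_def field_simps)
  have "\<exists>\<delta>>0. \<forall>q q2. q \<in> bd D \<longrightarrow> q2 \<in> bd D \<longrightarrow> dist q q2 < \<delta> \<longrightarrow> dist (\<tau> q) (\<tau> q2) \<le> k * dist q q2"
  proof (rule ccontr)
    assume "\<not> ?thesis"
    then have "\<exists>x. fst x \<in> bd D \<and> snd x \<in> bd D \<and> dist (fst x) (snd x) < \<delta> \<and> \<not> dist (\<tau> (fst x)) (\<tau> (snd x)) \<le> k * dist (fst x) (snd x)" if "\<delta> > 0" for \<delta>
      using that by force
    then have "\<exists>x. \<forall>n. fst (x n) \<in> bd D \<and> snd (x n) \<in> bd D \<and> dist (fst (x n)) (snd (x n)) < 1 / Suc n \<and> \<not> dist (\<tau> (fst (x n))) (\<tau> (snd (x n))) \<le> k * dist (fst (x n)) (snd (x n))"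
      by (rule null_seq_choice)
    then obtain x where x: "\<And>n. fst (x n) \<in> bd D \<and> snd (x n) \<in> bd D \<and> dist (fst (x n)) (snd (x n)) < 1 / Suc n \<and> \<not> dist (\<tau> (fst (x n))) (\<tau> (snd (x n))) \<le> k * dist (fst (x n)) (snd (x n))"
      by blast
    define q q2 p p2 where "q = (\<lambda>n. fst (x n))" and "q2 = (\<lambda>n. snd (x n))" and "p = (\<lambda>n. \<tau> (q n))" and "p2 = (\<lambda>n. \<tau> (q2 n))"
    have Rn: "R (p n) (q n)" "R (p2 n) (q2 n)" and bdn: "q n \<in> bd D" "q2 n \<in> bd D" "p n \<in> bd D" "p2 n \<in> bd D" for n
    proof -
      show "R (p n) (q n)" "R (p2 n) (q2 n)" using \<tau> x by (auto simp: p_def p2_def q_def q2_def)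
      then show "q n \<in> bd D" "q2 n \<in> bd D" "p n \<in> bd D" "p2 n \<in> bd D" by (auto simp: R_def)
    qed
    have gt: "norm (p2 n - p n) > k * norm (q2 n - q n)" for n using x[of n] by (simp add: p_def p2_def q_def q2_def dist_norm norm_minus_commute not_le)
    have nep: "p n \<noteq> p2 n" for n using gt[of n] k(1) by (smt (verit) mult_nonneg_nonneg norm_ge_zero norm_zero right_minus_eq)
    have neq: "q n \<noteq> q2 n" for n using uniq[OF Rn(1)[of n], of "p2 n"] Rn(2)[of n] nep[of n] by metis
    \<comment> \<open>Directions in which the two ends move; in the limit they are tangent to the
      boundary at \<open>P\<close> and \<open>Q\<close>.\<close>
    define e e' where "e = (\<lambda>n. sgn (p2 n - p n))" and "e' = (\<lambda>n. sgn (q2 n - q n))"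
    have ne: "norm (e n) = 1" "norm (e' n) = 1" for n using nep[of n] neq[of n] by (simp_all add: e_def e'_def norm_sgn)
    have nb: "norm (p n) = 1" "norm (p2 n) = 1" "norm (q n) = 1" "norm (q2 n) = 1" for n using bd_norm bdn by blast+
    obtain P P2 Q s1 where L1: "strict_mono (s1 :: nat \<Rightarrow> nat)" "(p \<circ> s1) \<longlonglongrightarrow> P" "(p2 \<circ> s1) \<longlonglongrightarrow> P2" "(q \<circ> s1) \<longlonglongrightarrow> Q"
      using unit_subseq3[of p p2 q] nb by metis
    obtain E E' E'' s2 where L2: "norm E = 1" "norm E' = 1" "norm E'' = 1" "strict_mono (s2 :: nat \<Rightarrow> nat)" "((e \<circ> s1) \<circ> s2) \<longlonglongrightarrow> E" "((e' \<circ> s1) \<circ> s2) \<longlonglongrightarrow> E'"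
      "((e \<circ> s1) \<circ> s2) \<longlonglongrightarrow> E''"
      by (rule unit_subseq3[of "e \<circ> s1" "e' \<circ> s1" "e \<circ> s1"]) (use ne in auto)
    define s where "s = s1 \<circ> s2"
    have sm: "strict_mono s" using L1 L2 by (simp add: s_def strict_mono_o)
    have lim: "(\<lambda>n. p (s n)) \<longlonglongrightarrow> P" "(\<lambda>n. p2 (s n)) \<longlonglongrightarrow> P2" "(\<lambda>n. q (s n)) \<longlonglongrightarrow> Q" "(\<lambda>n. e (s n)) \<longlonglongrightarrow> E" "(\<lambda>n. e' (s n)) \<longlonglongrightarrow> E'"
      using LIMSEQ_subseq_LIMSEQ[OF L1(2) L2(4)] LIMSEQ_subseq_LIMSEQ[OF L1(3) L2(4)] LIMSEQ_subseq_LIMSEQ[OF L1(4) L2(4)] L2(5,6)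
      by (simp_all add: s_def o_def)
    have "(\<lambda>n. q2 n - q n) \<longlonglongrightarrow> 0"
      by (rule Lim_null_comparison[OF _ inverse_Suc_tendsto])
         (use x in \<open>auto simp: q_def q2_def dist_norm norm_minus_commute less_imp_le\<close>)
    from LIMSEQ_subseq_LIMSEQ[OF this sm] have "(\<lambda>n. q2 (s n) - q (s n)) \<longlonglongrightarrow> 0" by (simp add: o_def)
    from tendsto_add[OF this lim(3)] have lim2: "(\<lambda>n. q2 (s n)) \<longlonglongrightarrow> Q" by simp
    have cl: "closed (bd D)" by (simp add: compact_bd compact_imp_closed)
    have B: "P \<in> bd D" "P2 \<in> bd D" "Q \<in> bd D"
      by (rule closed_sequentially[OF cl _ lim(1)], use bdn in blast, rule closed_sequentially[OF cl _ lim(2)], use bdn in blast,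
          rule closed_sequentially[OF cl _ lim(3)], use bdn in blast)
    have ct: "(\<lambda>n. tang D (y n)) \<longlonglongrightarrow> tang D Y" "(\<lambda>n. unormal D (y n)) \<longlonglongrightarrow> unormal D Y" if "y \<longlonglongrightarrow> Y" "\<And>n. y n \<in> bd D" "Y \<in> bd D" for y Y
      using continuous_on_tendsto_compose[OF continuous_tang that(1,3)] continuous_on_tendsto_compose[OF unormal_continuous[OF D] that(1,3)] that(2) by auto
    have lower: "\<sigma> * (tang D Y \<bullet> Q) > 0 \<and> norm (Q - Y) = l" if y: "y \<longlonglongrightarrow> Y" "\<And>n. R (y n) (z n)" "z \<longlonglongrightarrow> Q" "Y \<in> bd D" for y z Y
    proof -
      have yb: "y n \<in> bd D" for n using y(2)[of n] by (simp add: R_def)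
      have "(\<lambda>n. norm (z n - y n)) \<longlonglongrightarrow> norm (Q - Y)" by (intro tendsto_intros y)
      moreover have "(\<lambda>n. norm (z n - y n)) = (\<lambda>n. l)" using y(2) by (auto simp: R_def)
      ultimately have n: "norm (Q - Y) = l" by (simp add: LIMSEQ_const_iff)
      have "(\<lambda>n. \<sigma> * (tang D (y n) \<bullet> z n)) \<longlonglongrightarrow> \<sigma> * (tang D Y \<bullet> Q)" by (intro tendsto_intros ct(1)[OF y(1) yb y(4)] y(3))
      then have "0 \<le> \<sigma> * (tang D Y \<bullet> Q)" by (rule LIMSEQ_le_const) (use y(2) in \<open>auto simp: R_def less_imp_le\<close>)
      moreover have "tang D Y \<bullet> Q \<noteq> 0" using tlarge[OF y(4) B(3)] n lr l by auto
      ultimately show ?thesis using n \<sigma>(1) by (auto simp: less_le)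
    qed
    have RL: "R P Q" "R P2 Q"
      using lower[OF lim(1) Rn(1) lim(3) B(1)] lower[OF lim(2) Rn(2) lim2 B(2)] B by (auto simp: R_def)
    then have PP: "P2 = P" using uniq by blast
    \<comment> \<open>A secant between boundary points converging to \<open>Y\<close> is nonpositive
      on the normal at one end, nonnegative on the other, and orthogonal to the midpoint, so its
      limit is plus or minus the tangent.\<close>
    have dir: "\<bar>F \<bullet> tang D Y\<bar> = 1 \<and> F \<bullet> Y = 0"
      if y: "(\<lambda>n. y (s n)) \<longlonglongrightarrow> Y" "(\<lambda>n. y2 (s n)) \<longlonglongrightarrow> Y" "\<And>n. y n \<in> bd D" "\<And>n. y2 n \<in> bd D" "Y \<in> bd D" "norm F = 1"
        "(\<lambda>n. sgn (y2 (s n) - y (s n))) \<longlonglongrightarrow> F" for y y2 Y F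
    proof -
      have a1: "unormal D Y \<bullet> F \<le> 0"
      proof (rule LIMSEQ_le_const2)
        show "(\<lambda>n. unormal D (y (s n)) \<bullet> sgn (y2 (s n) - y (s n))) \<longlonglongrightarrow> unormal D Y \<bullet> F"
          by (intro tendsto_intros ct(2)[OF y(1) _ y(5)] y(3,7))
        have "unormal D (y n) \<bullet> sgn (y2 n - y n) \<le> 0" for n
          using unormal(3,4)[OF D(1) y(3)] bd_mem[OF D(1) y(4)] by (simp add: sgn_div_norm inner_diff_right mult_nonneg_nonpos)
        then show "\<exists>N. \<forall>n\<ge>N. unormal D (y (s n)) \<bullet> sgn (y2 (s n) - y (s n)) \<le> 0" by blast
      qed
      have a2: "unormal D Y \<bullet> F \<ge> 0"
      proof (rule LIMSEQ_le_const)
        show "(\<lambda>n. unormal D (y2 (s n)) \<bullet> sgn (y2 (s n) - y (s n))) \<longlonglongrightarrow> unormal D Y \<bullet> F"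
          by (intro tendsto_intros ct(2)[OF y(2) _ y(5)] y(4,7))
        have "unormal D (y2 n) \<bullet> sgn (y2 n - y n) \<ge> 0" for n
          using unormal(3,4)[OF D(1) y(4)] bd_mem[OF D(1) y(3)] by (simp add: sgn_div_norm inner_diff_right mult_nonneg_nonpos)
        then show "\<exists>N. \<forall>n\<ge>N. 0 \<le> unormal D (y2 (s n)) \<bullet> sgn (y2 (s n) - y (s n))" by blast
      qed
      have "(y2 n - y n) \<bullet> (y n + y2 n) = 0" for n
        using sum_diff_orthogonal(1)[OF bd_norm[OF y(3)] bd_norm[OF y(4)]] by (simp add: inner_commute)
      then have "sgn (y2 n - y n) \<bullet> (y n + y2 n) = 0" for n by (simp add: sgn_div_norm)
      moreover have "(\<lambda>n. sgn (y2 (s n) - y (s n)) \<bullet> (y (s n) + y2 (s n))) \<longlonglongrightarrow> F \<bullet> (Y + Y)" by (intro tendsto_intros y)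
      ultimately have "F \<bullet> (Y + Y) = 0" by (simp add: LIMSEQ_const_iff)
      then have FY: "F \<bullet> Y = 0" unfolding inner_add_right by linarith
      have "F \<bullet> unormal D Y = 0" using a1 a2 by (simp add: inner_commute)
      then have "(F \<bullet> tang D Y)\<^sup>2 = 1" using tang(4)[OF D(1) y(5), of F] FY y(6) by (simp add: norm_eq_1)
      then have "\<bar>F \<bullet> tang D Y\<bar> = 1" by (metis real_sqrt_abs real_sqrt_one)
      then show ?thesis using FY by blast
    qed
    have dE: "\<bar>E \<bullet> tang D P\<bar> = 1" "E \<bullet> P = 0"
      using dir[OF lim(1) lim(2)[unfolded PP] bdn(3,4) B(1) L2(1)] lim(4) by (auto simp: e_def)
    have dE': "\<bar>E' \<bullet> tang D Q\<bar> = 1" "E' \<bullet> Q = 0"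
      using dir[OF lim(3) lim2 bdn(1,2) B(3) L2(2)] lim(5) by (auto simp: e'_def)
    have par: "\<bar>F \<bullet> v\<bar> = \<bar>tang D Y \<bullet> v\<bar>" if "Y \<in> bd D" "norm F = 1" "\<bar>F \<bullet> tang D Y\<bar> = 1" for F Y v
    proof -
      have "tang D Y \<bullet> tang D Y = 1" "F \<bullet> F = 1" using tang(1)[OF D(1) that(1)] that(2) by (simp_all add: norm_eq_1)
      have "F \<bullet> tang D Y = 1 \<or> F \<bullet> tang D Y = -1" using that(3) by linarith
      then have "(F - tang D Y) \<bullet> (F - tang D Y) = 0 \<or> (F + tang D Y) \<bullet> (F + tang D Y) = 0"
        using \<open>tang D Y \<bullet> tang D Y = 1\<close> \<open>F \<bullet> F = 1\<close> by (auto simp: inner_diff_left inner_diff_right inner_add_left inner_add_right inner_commute)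
      then have "F = tang D Y \<or> F = - tang D Y" by (simp add: eq_neg_iff_add_eq_0)
      then show ?thesis by auto
    qed
    \<comment> \<open>Equal lengths of the two chords mean that the change from one to the other is
      orthogonal to their sum; this relates the two displacements.\<close>
    define W where "W = (\<lambda>n. (q n - p n) + (q2 n - p2 n))"
    have WL: "(\<lambda>n. W (s n)) \<longlonglongrightarrow> (Q - P) + (Q - P)"
      unfolding W_def by (intro tendsto_intros lim lim2 lim(2)[unfolded PP])
    have We: "\<bar>W n \<bullet> e n\<bar> * k \<le> \<bar>W n \<bullet> e' n\<bar>" for n
    proof -
      have "norm (q n - p n) = norm (q2 n - p2 n)" using Rn[of n] by (simp add: R_def)
      then have "(q n - p n) \<bullet> (q n - p n) = (q2 n - p2 n) \<bullet> (q2 n - p2 n)" by (simp add: dot_square_norm)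
      then have "W n \<bullet> (p2 n - p n) = W n \<bullet> (q2 n - q n)"
      proof -
        have "(v + w) \<bullet> (w - v) = w \<bullet> w - v \<bullet> v" for v w :: "real^3"
          by (simp add: inner_diff_right inner_diff_left inner_add_left inner_add_right inner_commute)
        from this[of "q n - p n" "q2 n - p2 n"]
        have "W n \<bullet> ((q2 n - p2 n) - (q n - p n)) = 0" using \<open>(q n - p n) \<bullet> (q n - p n) = _\<close> unfolding W_def by simp
        moreover have "(q2 n - p2 n) - (q n - p n) = (q2 n - q n) - (p2 n - p n)" by simp
        ultimately have "W n \<bullet> ((q2 n - q n) - (p2 n - p n)) = 0" by (simp only:)
        then show ?thesis unfolding inner_diff_right[of _ "q2 n - q n"] by linarith
      qed
      moreover have "p2 n - p n = norm (p2 n - p n) *\<^sub>R e n" "q2 n - q n = norm (q2 n - q n) *\<^sub>R e' n"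
        using nep[of n] neq[of n] by (simp_all add: e_def e'_def sgn_div_norm)
      ultimately have "norm (p2 n - p n) * (W n \<bullet> e n) = norm (q2 n - q n) * (W n \<bullet> e' n)" by (metis inner_scaleR_right)
      then have eq: "norm (p2 n - p n) * \<bar>W n \<bullet> e n\<bar> = norm (q2 n - q n) * \<bar>W n \<bullet> e' n\<bar>" by (metis abs_mult abs_norm_cancel)
      have "norm (q2 n - q n) * (\<bar>W n \<bullet> e n\<bar> * k) = (k * norm (q2 n - q n)) * \<bar>W n \<bullet> e n\<bar>" by (simp add: mult_ac)
      also have "\<dots> \<le> norm (p2 n - p n) * \<bar>W n \<bullet> e n\<bar>" by (rule mult_right_mono[OF less_imp_le[OF gt]]) simp
      finally have "norm (q2 n - q n) * (\<bar>W n \<bullet> e n\<bar> * k) \<le> norm (q2 n - q n) * \<bar>W n \<bullet> e' n\<bar>" unfolding eq .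
      then show ?thesis using neq[of n] by simp
    qed
    have "(\<lambda>n. \<bar>W (s n) \<bullet> e (s n)\<bar> * k) \<longlonglongrightarrow> \<bar>((Q - P) + (Q - P)) \<bullet> E\<bar> * k" by (intro tendsto_intros WL lim)
    moreover have "(\<lambda>n. \<bar>W (s n) \<bullet> e' (s n)\<bar>) \<longlonglongrightarrow> \<bar>((Q - P) + (Q - P)) \<bullet> E'\<bar>" by (intro tendsto_intros WL lim)
    ultimately have le: "\<bar>((Q - P) + (Q - P)) \<bullet> E\<bar> * k \<le> \<bar>((Q - P) + (Q - P)) \<bullet> E'\<bar>" by (rule LIMSEQ_le) (use We in auto)
    have dd: "((Q - P) + (Q - P)) \<bullet> F = 2 * (F \<bullet> Q) - 2 * (F \<bullet> P)" for F
      unfolding inner_add_left inner_diff_left inner_commute[of F] by simp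
    have "((Q - P) + (Q - P)) \<bullet> E = 2 * (E \<bullet> Q)" unfolding dd dE(2) by simp
    moreover have "((Q - P) + (Q - P)) \<bullet> E' = - 2 * (E' \<bullet> P)" unfolding dd dE'(2) by simp
    moreover have "\<bar>E \<bullet> Q\<bar> = Sa" using par[OF B(1) L2(1) dE(1)] S(1)[OF RL(1)] by simp
    moreover have "\<bar>E' \<bullet> P\<bar> = Sb" using par[OF B(3) L2(2) dE'(1)] S(2)[OF RL(1)] by simp
    ultimately have "2 * Sa * k \<le> 2 * Sb" using le by (simp add: abs_mult)
    then show False using k(3) by (simp add: mult.commute)
  qed
  then obtain \<delta> where "\<delta> > 0" "\<And>q q2. q \<in> bd D \<Longrightarrow> q2 \<in> bd D \<Longrightarrow> dist q q2 < \<delta> \<Longrightarrow> dist (\<tau> q) (\<tau> q2) \<le> k * dist q q2" by blast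
  then have "finite (bd D)" using contraction_cover_finite[OF compact_bd surj _ k(1,2)] by blast
  then show False using bd_infinite by simp
qed

end

section \<open>Boundaries with equal chord angles\<close>

text \<open>A line meets a sphere in at most two points.\<close>

lemma sphere_points_independent:
  fixes p q z :: "'a::real_inner"
  assumes "norm p = 1" "norm q = 1" "norm z = 1" "p \<noteq> q" "z \<noteq> q" "p \<noteq> z" and e: "a *\<^sub>R (p - q) + b *\<^sub>R (z - q) = 0"
  shows "a = 0"
proof (rule ccontr)
  assume a: "a \<noteq> 0"
  define m where "m = - b / a"
  define d where "d = z - q"
  have "a *\<^sub>R (p - q) = - b *\<^sub>R d" using e by (simp add: d_def eq_neg_iff_add_eq_0)
  then have "(1 / a) *\<^sub>R a *\<^sub>R (p - q) = (1 / a) *\<^sub>R (- b *\<^sub>R d)" by simp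
  then have pm: "p = q + m *\<^sub>R d" using a by (simp add: m_def algebra_simps)
  have z: "z = q + d" by (simp add: d_def)
  have d0: "d \<bullet> d \<noteq> 0" using assms by (simp add: d_def)
  have "z \<bullet> z = 1" "p \<bullet> p = 1" "q \<bullet> q = 1" using assms by (simp_all add: norm_eq_1)
  then have 1: "2 * (q \<bullet> d) + d \<bullet> d = 0" "2 * m * (q \<bullet> d) + m * m * (d \<bullet> d) = 0"
    unfolding pm z by (simp_all add: inner_add_left inner_add_right inner_commute algebra_simps)
  have "m * (2 * (q \<bullet> d) + d \<bullet> d) - (2 * m * (q \<bullet> d) + m * m * (d \<bullet> d)) = m * (1 - m) * (d \<bullet> d)" by (simp add: algebra_simps)
  then have "m * (1 - m) * (d \<bullet> d) = 0" unfolding 1 by simp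
  then have "m = 0 \<or> m = 1" using d0 by auto
  then show False using pm z assms by auto
qed

context chord_scale
begin

text \<open>In the frame of chord, midpoint and chord normal, the two unit normals have equal
  components along the midpoint and opposite ones along the chord. Having length 1 and being close,
  they agree in the third, so only the chord direction remains in the difference.\<close>

lemma equal_angles_parallel:
  assumes p: "p \<in> bd D" and q: "q \<in> bd D" "q \<noteq> p" "norm (q - p) < r" and e: "unormal D p \<bullet> q = unormal D q \<bullet> p"
  shows "\<exists>k. unormal D p - unormal D q = k *\<^sub>R (p - q)"
proof -
  \<comment> \<open>\<open>chord_normal\<close> needs \<open>q\<close> on the positive side; the
    other case exchanges the ends.\<close>
  have main: "\<exists>k. unormal D p - unormal D q = k *\<^sub>R (p - q)"
    if p: "p \<in> bd D" and q: "q \<in> bd D" "q \<noteq> p" "norm (q - p) < r" and e: "unormal D p \<bullet> q = unormal D q \<bullet> p" and t: "tang D p \<bullet> q > 0"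
    for p q
  proof -
    define l s where "l = norm (q - p)" and "s = norm (p + q)"
    have np: "norm p = 1" "norm q = 1" using bd_norm p q by auto
    have l0: "l > 0" using q by (simp add: l_def)
    have na: "p \<noteq> - q"
    proof
      assume "p = - q"
      then have "norm (q - p) = 2" using np by (simp flip: scaleR_2)
      then show False using q r by simp
    qed
    define a b n where "a = sgn (p + q)" and "b = sgn (q - p)" and "n = cross3 b a"
    have o: "norm b = 1" "norm a = 1" "b \<bullet> a = 0"
      using q na sum_diff_orthogonal(1)[OF np] by (simp_all add: a_def b_def norm_sgn eq_neg_iff_add_eq_0) (simp add: sgn_div_norm inner_commute)
    have u: "unormal D p \<bullet> p = 0" "unormal D q \<bullet> q = 0" "norm (unormal D p) = 1" "norm (unormal D q) = 1"
      using unormal[OF D(1)] p q by auto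
    have c: "unormal D p \<bullet> a = unormal D q \<bullet> a" "unormal D p \<bullet> b = - (unormal D q \<bullet> b)"
      using e u by (simp_all add: a_def b_def sgn_div_norm inner_add_right inner_diff_right)
    have sq: "1 = (v \<bullet> b)\<^sup>2 + (v \<bullet> a)\<^sup>2 + (v \<bullet> n)\<^sup>2" if "norm v = 1" for v
      using orthonormal_inner[OF o, of v v] that by (simp add: n_def norm_eq_1 power2_eq_square)
    have "(unormal D p \<bullet> n)\<^sup>2 = (unormal D q \<bullet> n)\<^sup>2" using sq[OF u(3)] sq[OF u(4)] c by simp
    then have pm: "unormal D p \<bullet> n = unormal D q \<bullet> n \<or> unormal D p \<bullet> n = - (unormal D q \<bullet> n)" by (simp add: power2_eq_iff)
    have "7/8 * norm (q - p) \<le> cross3 p (unormal D p) \<bullet> q" using tlarge[OF p q(1,3)] t by (simp add: tang_def)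
    then have big: "7/8 \<le> unormal D p \<bullet> n" unfolding n_def a_def b_def by (intro chord_normal[OF np q(2)[symmetric] na]) auto
    have "norm n = 1" using cross_orthonormal(1)[OF o] by (simp add: n_def)
    then have "\<bar>(unormal D q - unormal D p) \<bullet> n\<bar> \<le> 1/16"
      using Cauchy_Schwarz_ineq2[of "unormal D q - unormal D p" n] Uclose[OF p q(1,3)] by simp
    then have "unormal D q \<bullet> n > 0" using big unfolding inner_diff_left by linarith
    then have cn: "unormal D p \<bullet> n = unormal D q \<bullet> n" using pm big by linarith
    define d where "d = unormal D p - unormal D q"
    have "d = (d \<bullet> b) *\<^sub>R b + (d \<bullet> a) *\<^sub>R a + (d \<bullet> n) *\<^sub>R n" unfolding n_def by (rule orthonormal_expand[OF o])
    moreover have "d \<bullet> a = 0" "d \<bullet> n = 0" using c cn by (simp_all add: d_def inner_diff_left)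
    ultimately have "d = (d \<bullet> b) *\<^sub>R b" by simp
    also have "\<dots> = (- (d \<bullet> b) / l) *\<^sub>R (p - q)" by (simp add: b_def sgn_div_norm l_def algebra_simps divide_inverse)
    finally show ?thesis unfolding d_def by blast
  qed
  have "tang D p \<bullet> q \<noteq> 0" using tlarge[OF p q(1,3)] q(2) by auto
  then consider "tang D p \<bullet> q > 0" | "tang D p \<bullet> q < 0" by linarith
  then show ?thesis
  proof cases
    case 1 then show ?thesis using main[OF p q e] by blast
  next
    case 2
    then have "-1 * (tang D q \<bullet> p) < 0" by (intro tang_opposite[OF p q(1,3)]) simp
    then obtain k where "unormal D q - unormal D p = k *\<^sub>R (q - p)"
      using main[OF q(1) p q(2)[symmetric] _ e[symmetric]] q(3) by (auto simp: norm_minus_commute)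
    then have "unormal D p - unormal D q = k *\<^sub>R (p - q)" by (metis minus_diff_eq scaleR_minus_right)
    then show ?thesis by blast
  qed
qed

lemma nearby_point: "x \<in> bd D \<Longrightarrow> e > 0 \<Longrightarrow> \<exists>y\<in>bd D. y \<noteq> x \<and> norm (y - x) < e"
proof -
  assume x: "x \<in> bd D" and e: "e > 0"
  define l where "l = min e r / 2"
  have "0 < l" "l < r" "l < e" using e r by (auto simp: l_def)
  then obtain q where "q \<in> bd D" "norm (q - x) = l" using chord_ex[OF x, of l 1] by auto
  then show ?thesis using \<open>0 < l\<close> \<open>l < e\<close> by (intro bexI[of _ q]) auto
qed

text \<open>Differences of normals along the three sides of a triangle are multiples of the sides;
  as two sides are independent, the three factors agree. The radius \<open>s / 2\<close> keeps the
  third side below \<open>s\<close>.\<close>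

lemma local_affine:
  assumes s: "0 < s" "s \<le> r" and sym: "\<And>p q. p \<in> bd D \<Longrightarrow> q \<in> bd D \<Longrightarrow> norm (q - p) < s \<Longrightarrow> unormal D p \<bullet> q = unormal D q \<bullet> p"
    and x: "x \<in> bd D"
  shows "\<exists>k a. \<forall>y\<in>bd D. norm (y - x) < s / 2 \<longrightarrow> unormal D y = k *\<^sub>R y + a"
proof -
  have par: "\<exists>k. unormal D p - unormal D q = k *\<^sub>R (p - q)" if "p \<in> bd D" "q \<in> bd D" "q \<noteq> p" "norm (q - p) < s" for p q
    using equal_angles_parallel[OF that(1-3)] sym[OF that(1,2,4)] that(4) s by auto
  obtain z where z: "z \<in> bd D" "z \<noteq> x" "norm (z - x) < s / 2" using nearby_point[OF x, of "s / 2"] s by auto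
  obtain k where k: "unormal D z - unormal D x = k *\<^sub>R (z - x)" using par[OF z(1) x] z s by (auto simp: norm_minus_commute)
  have "unormal D y = k *\<^sub>R y + (unormal D x - k *\<^sub>R x)" if y: "y \<in> bd D" "norm (y - x) < s / 2" for y
  proof (cases "y = x \<or> y = z")
    case True
    then show ?thesis using k by (auto simp: algebra_simps)
  next
    case False
    obtain k1 where k1: "unormal D y - unormal D x = k1 *\<^sub>R (y - x)" using par[OF y(1) x] y False s by (auto simp: norm_minus_commute)
    have "norm (z - y) < s" using norm_triangle_ineq4[of "z - x" "y - x"] y z by simp
    then obtain k2 where k2: "unormal D y - unormal D z = k2 *\<^sub>R (y - z)" using par[OF y(1) z(1)] False by auto
    have "k1 *\<^sub>R (y - x) - k2 *\<^sub>R (y - z) - k *\<^sub>R (z - x) = 0" unfolding k[symmetric] k1[symmetric] k2[symmetric] by simp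
    then have "(k2 - k) *\<^sub>R (z - x) + (k1 - k2) *\<^sub>R (y - x) = 0" by (simp add: algebra_simps)
    then have "k2 - k = 0"
      using False z(2) bd_norm[OF x] bd_norm[OF y(1)] bd_norm[OF z(1)] by (intro sphere_points_independent[of z x y "k2 - k" "k1 - k2"]) auto
    moreover have "(k1 - k2) *\<^sub>R (y - x) = 0" using \<open>(k2 - k) *\<^sub>R (z - x) + (k1 - k2) *\<^sub>R (y - x) = 0\<close> calculation by simp
    ultimately have "k1 = k" using False by simp
    then show ?thesis using k1 by (simp add: algebra_simps)
  qed
  then show ?thesis by blast
qed

text \<open>Near each point the coefficients are unique, since two distinct boundary points fix
  \<open>k\<close> and then \<open>a\<close>; so they are locally constant on a connected
  set.\<close>

lemma global_affine:
  assumes s: "0 < s" "s \<le> r" and sym: "\<And>p q. p \<in> bd D \<Longrightarrow> q \<in> bd D \<Longrightarrow> norm (q - p) < s \<Longrightarrow> unormal D p \<bullet> q = unormal D q \<bullet> p"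
  shows "\<exists>k a. \<forall>y\<in>bd D. unormal D y = k *\<^sub>R y + a"
proof -
  define N where "N = (\<lambda>x (ka :: real \<times> (real^3)). \<exists>e>0. \<forall>y\<in>bd D. norm (y - x) < e \<longrightarrow> unormal D y = fst ka *\<^sub>R y + snd ka)"
  have ex: "\<exists>ka. N x ka" if xb: "x \<in> bd D" for x
  proof -
    obtain k a where "\<forall>y\<in>bd D. norm (y - x) < s / 2 \<longrightarrow> unormal D y = k *\<^sub>R y + a" using local_affine[OF s sym xb] by blast
    then have "N x (k, a)" using s unfolding N_def by (intro exI[of _ "s / 2"]) auto
    then show ?thesis by blast
  qed
  have un: "ka = ka'" if x: "x \<in> bd D" and N: "N x ka" "N x ka'" for x ka ka'
  proof -
    obtain e where e: "e > 0" "\<And>y. y \<in> bd D \<Longrightarrow> norm (y - x) < e \<Longrightarrow> unormal D y = fst ka *\<^sub>R y + snd ka" using N(1) unfolding N_def by blast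
    obtain e' where e': "e' > 0" "\<And>y. y \<in> bd D \<Longrightarrow> norm (y - x) < e' \<Longrightarrow> unormal D y = fst ka' *\<^sub>R y + snd ka'" using N(2) unfolding N_def by blast
    obtain y where y: "y \<in> bd D" "y \<noteq> x" "norm (y - x) < min e e'" using nearby_point[OF x, of "min e e'"] e e' by auto
    have 1: "fst ka *\<^sub>R x + snd ka = fst ka' *\<^sub>R x + snd ka'" using e(2)[OF x] e'(2)[OF x] e(1) e'(1) by simp
    have 2: "fst ka *\<^sub>R y + snd ka = fst ka' *\<^sub>R y + snd ka'" using e(2)[OF y(1)] e'(2)[OF y(1)] y(3) by simp
    have "(fst ka - fst ka') *\<^sub>R (y - x) = (fst ka *\<^sub>R y + snd ka) - (fst ka *\<^sub>R x + snd ka) - ((fst ka' *\<^sub>R y + snd ka') - (fst ka' *\<^sub>R x + snd ka'))"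
      by (simp add: algebra_simps)
    also have "\<dots> = 0" unfolding 1 2 by simp
    finally have "fst ka = fst ka'" using y(2) by simp
    moreover have "snd ka = snd ka'" using 1 calculation by simp
    ultimately show ?thesis by (simp add: prod_eq_iff)
  qed
  define F where "F = (\<lambda>x. SOME ka. N x ka)"
  have F: "N x (F x)" if "x \<in> bd D" for x unfolding F_def by (rule someI_ex[OF ex[OF that]])
  have loc: "eventually (\<lambda>y. F x = F y) (at x within bd D)" if x: "x \<in> bd D" for x
  proof -
    obtain e where e: "e > 0" "\<And>y. y \<in> bd D \<Longrightarrow> norm (y - x) < e \<Longrightarrow> unormal D y = fst (F x) *\<^sub>R y + snd (F x)" using F[OF x] unfolding N_def by blast
    have "F x = F y" if y: "y \<in> bd D" "dist y x < e" for y
    proof -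
      have "N y (F x)" unfolding N_def
      proof (intro exI[of _ "e - dist y x"] conjI ballI impI)
        show "e - dist y x > 0" using y by simp
        fix w assume w: "w \<in> bd D" "norm (w - y) < e - dist y x"
        then have "norm (w - x) < e" using norm_triangle_ineq[of "w - y" "y - x"] by (simp add: dist_norm)
        then show "unormal D w = fst (F x) *\<^sub>R w + snd (F x)" using e(2) w by blast
      qed
      then show ?thesis using un[OF y(1)] F[OF y(1)] by blast
    qed
    then show ?thesis using e(1) unfolding eventually_at by blast
  qed
  obtain x0 where x0: "x0 \<in> bd D" using bd_nonempty[OF D(1)] by blast
  have "F x0 = F y" if "y \<in> bd D" for y
    using connected_local_const[OF connected_bd[OF D(1)] x0 that] loc by blast
  then have "unormal D y = fst (F x0) *\<^sub>R y + snd (F x0)" if "y \<in> bd D" for y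
    using F[OF that] that unfolding N_def by force
  then show ?thesis by blast
qed

end

section \<open>Recognising circular cones\<close>

text \<open>The function is convex only for \<open>k \<ge> 0\<close>, and both signs occur.
  Star-shapedness about \<open>- a\<close> covers both, since moving towards \<open>- a\<close>
  contributes a negative term of size
  \<open>t * (norm a * (norm a - \<bar>k\<bar>))\<close>.\<close>

lemma cone_level_connected:
  fixes a :: "'a::real_inner"
  assumes "\<bar>k\<bar> < norm a"
  shows "connected {z. a \<bullet> z + k * norm z < 0}"
    "a \<bullet> z + k * norm z \<le> 0 \<Longrightarrow> 0 < t \<Longrightarrow> t \<le> 1 \<Longrightarrow> a \<bullet> ((1 - t) *\<^sub>R z - t *\<^sub>R a) + k * norm ((1 - t) *\<^sub>R z - t *\<^sub>R a) < 0"
proof -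
  have step: "a \<bullet> ((1 - t) *\<^sub>R z - t *\<^sub>R a) + k * norm ((1 - t) *\<^sub>R z - t *\<^sub>R a) \<le> (1 - t) * (a \<bullet> z + k * norm z) - t * (norm a * (norm a - \<bar>k\<bar>))"
    if "0 \<le> t" "t \<le> 1" for z t
  proof -
    define w where "w = (1 - t) *\<^sub>R z - t *\<^sub>R a"
    have "norm w \<le> (1 - t) * norm z + t * norm a" unfolding w_def using norm_triangle_ineq4[of "(1 - t) *\<^sub>R z" "t *\<^sub>R a"] that by simp
    moreover have "norm w \<ge> (1 - t) * norm z - t * norm a" unfolding w_def using norm_triangle_ineq2[of "(1 - t) *\<^sub>R z" "t *\<^sub>R a"] that by simp
    ultimately have "\<bar>norm w - (1 - t) * norm z\<bar> \<le> t * norm a" by linarith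
    then have "\<bar>k\<bar> * \<bar>norm w - (1 - t) * norm z\<bar> \<le> \<bar>k\<bar> * (t * norm a)" by (intro mult_left_mono) auto
    then have "k * (norm w - (1 - t) * norm z) \<le> \<bar>k\<bar> * (t * norm a)" by (metis abs_ge_self abs_mult order_trans)
    moreover have "a \<bullet> w = (1 - t) * (a \<bullet> z) - t * (norm a * norm a)" by (simp add: w_def inner_diff_right dot_square_norm power2_eq_square)
    ultimately show ?thesis unfolding w_def[symmetric] by (simp add: algebra_simps)
  qed
  have pos: "norm a * (norm a - \<bar>k\<bar>) > 0" using assms by (intro mult_pos_pos) auto
  show 2: "a \<bullet> ((1 - t) *\<^sub>R z - t *\<^sub>R a) + k * norm ((1 - t) *\<^sub>R z - t *\<^sub>R a) < 0"
    if "a \<bullet> z + k * norm z \<le> 0" "0 < t" "t \<le> 1" for z t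
  proof -
    have "(1 - t) * (a \<bullet> z + k * norm z) \<le> 0" using that by (simp add: mult_nonneg_nonpos)
    moreover have "t * (norm a * (norm a - \<bar>k\<bar>)) > 0" using pos that by simp
    ultimately show ?thesis using step[of t z] that by linarith
  qed
  have "starlike {z. a \<bullet> z + k * norm z < 0}"
    unfolding starlike_def
  proof (intro bexI[of _ "- a"] ballI subsetI)
    show "- a \<in> {z. a \<bullet> z + k * norm z < 0}" using 2[of 0 1] by simp
    fix z w assume z: "z \<in> {z. a \<bullet> z + k * norm z < 0}" and "w \<in> closed_segment (- a) z"
    then obtain u where u: "0 \<le> u" "u \<le> 1" "w = (1 - u) *\<^sub>R (- a) + u *\<^sub>R z" unfolding closed_segment_def by blast
    have "w = (1 - (1 - u)) *\<^sub>R z - (1 - u) *\<^sub>R a" unfolding u(3) by simp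
    moreover have "u = 1 \<or> 0 < 1 - u" using u by linarith
    ultimately show "w \<in> {z. a \<bullet> z + k * norm z < 0}"
      using 2[of z "1 - u"] z u by (cases "u = 1") auto
  qed
  then show "connected {z. a \<bullet> z + k * norm z < 0}" by (rule starlike_imp_connected)
qed

text \<open>For a unit vector \<open>c\<close> and \<open>m\<close> between -1 and 1 this is the
  cone over the spherical disc with centre \<open>c\<close> and radius
  \<open>arccos m\<close>.\<close>

definition cap_cone :: "'a::real_inner \<Rightarrow> real \<Rightarrow> 'a set" where
  "cap_cone c m = {z. m * norm z \<le> c \<bullet> z}"

text \<open>On the boundary \<open>a \<bullet> y = - k\<close>, so the frontier lies in the zero set
  of \<open>g\<close>. The sides \<open>g < 0\<close> and \<open>g > 0\<close> are connected,
  because \<open>(norm a)\<^sup>2 = 1 + k\<^sup>2\<close> gives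
  \<open>\<bar>k\<bar> < norm a\<close>, and they miss the frontier; crossing the boundary at one
  point \<open>p\<close> tells which of them is inside.\<close>

lemma affine_normals_imp_cap:
  fixes D :: "(real^3) set"
  assumes D: "cbody D" and S: "smooth D" and aff: "\<And>y. y \<in> bd D \<Longrightarrow> unormal D y = k *\<^sub>R y + a"
  obtains c m where "norm c = 1" "0 \<le> m" "m < 1" "D = cap_cone c m"
proof -
  have ay: "a \<bullet> y = - k" "a \<bullet> unormal D y = 1" "(norm a)\<^sup>2 = 1 + k\<^sup>2" if y: "y \<in> bd D" for y
  proof -
    have a: "a = unormal D y - k *\<^sub>R y" using aff[OF y] by simp
    have n: "unormal D y \<bullet> y = 0" "y \<bullet> y = 1" "unormal D y \<bullet> unormal D y = 1" "y \<bullet> unormal D y = 0"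
      using unormal[OF D y] bd_norm[OF y] by (simp_all add: norm_eq_1 inner_commute)
    show "a \<bullet> y = - k" "a \<bullet> unormal D y = 1" by (simp_all add: a inner_diff_left n)
    show "(norm a)\<^sup>2 = 1 + k\<^sup>2" unfolding power2_norm_eq_inner power2_eq_square[of k] by (simp add: a inner_diff_left inner_diff_right n)
  qed
  obtain p where p: "p \<in> bd D" using bd_nonempty[OF D] by blast
  have ka: "\<bar>k\<bar> < norm a"
    by (rule power2_less_imp_less) (use ay(3)[OF p] in simp_all)
  define g where "g = (\<lambda>z. a \<bullet> z + k * norm z)"
  have fr: "g z = 0" if z: "z \<in> frontier D" for z
  proof (cases "z = 0")
    case False
    have zD: "z \<in> D" "z \<notin> interior D" using z cbodyD(2)[OF D] by (auto simp: frontier_def)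
    have "sgn z \<in> D" using cbodyD(3)[OF D zD(1), of "inverse (norm z)"] by (simp add: sgn_div_norm)
    moreover have "sgn z \<notin> interior D"
    proof
      assume "sgn z \<in> interior D"
      then have "norm z *\<^sub>R sgn z \<in> interior D" by (rule interior_cone_scale[OF D]) (use False in simp)
      then show False using zD False by (simp add: sgn_div_norm)
    qed
    ultimately have "sgn z \<in> bd D" using cbodyD(2)[OF D] False by (simp add: bd_def frontier_def norm_sgn)
    then have "a \<bullet> sgn z = - k" by (rule ay)
    then show ?thesis using False by (simp add: g_def sgn_div_norm field_simps)
  qed (simp add: g_def)
  have con1: "connected {z. g z < 0}" using cone_level_connected(1)[OF ka] by (simp add: g_def)
  have "connected {z. (- a) \<bullet> z + (- k) * norm z < 0}" by (rule cone_level_connected(1)) (use ka in simp)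
  moreover have "{z. (- a) \<bullet> z + (- k) * norm z < 0} = {z. g z > 0}" by (auto simp: g_def)
  ultimately have con2: "connected {z. g z > 0}" by simp
  define u where "u = unormal D p"
  have up: "u \<bullet> p = 0" "norm u = 1" "u \<bullet> u = 1" "p \<bullet> u = 0" "p \<bullet> p = 1"
    using unormal[OF D p] bd_norm[OF p] by (auto simp: u_def norm_eq_1 inner_commute)
  \<comment> \<open>Along the normal at \<open>p\<close> the function \<open>g\<close> equals
    \<open>s\<close> up to a term of second order.\<close>
  have gs: "\<bar>g (p + s *\<^sub>R u) - s\<bar> < \<bar>s\<bar>" if s: "s \<noteq> 0" "\<bar>s\<bar> * \<bar>k\<bar> < 1" for s
  proof -
    have n1: "(norm (p + s *\<^sub>R u))\<^sup>2 = 1 + s\<^sup>2" unfolding power2_norm_eq_inner by (simp add: inner_add_left inner_add_right up power2_eq_square)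
    have lo: "1 \<le> norm (p + s *\<^sub>R u)" using n1 by (smt (verit) zero_le_power2 power2_le_imp_le norm_ge_zero one_power2)
    have "(norm (p + s *\<^sub>R u) - 1) * 2 \<le> (norm (p + s *\<^sub>R u) - 1) * (norm (p + s *\<^sub>R u) + 1)" using lo by (intro mult_left_mono) auto
    also have "\<dots> = s\<^sup>2" using n1 by (simp add: power2_eq_square algebra_simps)
    finally have hi: "norm (p + s *\<^sub>R u) - 1 \<le> s\<^sup>2 / 2" by simp
    have "g (p + s *\<^sub>R u) - s = k * (norm (p + s *\<^sub>R u) - 1)"
      using ay(1,2)[OF p] by (simp add: g_def inner_add_right u_def algebra_simps)
    then have "\<bar>g (p + s *\<^sub>R u) - s\<bar> = \<bar>k\<bar> * (norm (p + s *\<^sub>R u) - 1)" using lo by (simp add: abs_mult)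
    also have "\<dots> \<le> \<bar>k\<bar> * (s\<^sup>2 / 2)" using hi by (intro mult_left_mono) auto
    also have "\<dots> = (\<bar>s\<bar> * \<bar>k\<bar>) * \<bar>s\<bar> / 2" by (simp add: power2_eq_square)
    also have "\<dots> < \<bar>s\<bar>" using s mult_strict_right_mono[of "\<bar>s\<bar> * \<bar>k\<bar>" 1 "\<bar>s\<bar>"] by simp
    finally show ?thesis .
  qed
  obtain s0 where s0: "s0 > 0" "\<And>s. 0 < s \<Longrightarrow> s \<le> s0 \<Longrightarrow> p + s *\<^sub>R (- u) \<in> interior D"
  proof -
    have "w \<bullet> (- u) < 0" if "w \<in> normals D p" "w \<noteq> 0" for w
    proof -
      have "w = norm w *\<^sub>R u" unfolding u_def by (rule unormal_scale[OF D S p that(1)])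
      then have "w \<bullet> (- u) = - norm w * (u \<bullet> u)" by (metis inner_minus_right inner_scaleR_left mult_minus_left)
      then show ?thesis using that up by simp
    qed
    then show ?thesis using inward_interior[OF D bd_mem[OF D p], of "- u"] that by blast
  qed
  \<comment> \<open>The bound \<open>1 / (\<bar>k\<bar> + 1)\<close> makes
    \<open>s * \<bar>k\<bar>\<close> less than 1, as \<open>gs\<close> requires.\<close>
  define s where "s = min s0 (1 / (\<bar>k\<bar> + 1))"
  have s: "s > 0" "s \<le> s0" using s0(1) by (auto simp: s_def)
  have "s * \<bar>k\<bar> < 1"
  proof -
    have "s * (\<bar>k\<bar> + 1) \<le> 1 / (\<bar>k\<bar> + 1) * (\<bar>k\<bar> + 1)" by (intro mult_right_mono) (auto simp: s_def)
    also have "\<dots> = 1" by simp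
    finally show ?thesis using s(1) by (simp add: algebra_simps)
  qed
  then have gp: "g (p + (- s) *\<^sub>R u) < 0" "g (p + s *\<^sub>R u) > 0" using gs[of "- s"] gs[of s] s(1) by (simp_all add: abs_less_iff)
  have inD: "p + (- s) *\<^sub>R u \<in> D" using s0(2)[OF s] interior_subset by auto
  have outD: "p + s *\<^sub>R u \<notin> D"
  proof
    assume "p + s *\<^sub>R u \<in> D"
    then have "u \<bullet> (p + s *\<^sub>R u) \<le> 0" using unormal(4)[OF D p] by (simp add: u_def)
    then show False using s(1) up by (simp add: inner_add_right)
  qed
  have sub1: "{z. g z < 0} \<subseteq> D"
  proof (rule ccontr)
    assume "\<not> {z. g z < 0} \<subseteq> D"
    moreover have "{z. g z < 0} \<inter> D \<noteq> {}" using inD gp(1) by blast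
    ultimately have "{z. g z < 0} \<inter> frontier D \<noteq> {}" by (intro connected_Int_frontier con1) auto
    then show False using fr by force
  qed
  have sub2: "D \<subseteq> {z. g z \<le> 0}"
  proof (rule ccontr)
    assume "\<not> D \<subseteq> {z. g z \<le> 0}"
    then have "{z. g z > 0} \<inter> D \<noteq> {}" by force
    moreover have "{z. g z > 0} - D \<noteq> {}" using outD gp(2) by blast
    ultimately have "{z. g z > 0} \<inter> frontier D \<noteq> {}" by (intro connected_Int_frontier con2)
    then show False using fr by force
  qed
  \<comment> \<open>Points on the level 0 are limits of points moved towards \<open>- a\<close>,
    where \<open>g\<close> is negative.\<close>
  have sub3: "z \<in> D" if z: "g z \<le> 0" for z
  proof (rule closed_sequentially[OF cbodyD(2)[OF D]])
    fix n
    have "g ((1 - 1 / Suc n) *\<^sub>R z - (1 / Suc n) *\<^sub>R a) < 0"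
      unfolding g_def by (rule cone_level_connected(2)[OF ka]) (use z in \<open>auto simp: g_def\<close>)
    then show "(1 - 1 / Suc n) *\<^sub>R z - (1 / Suc n) *\<^sub>R a \<in> D" using sub1 by blast
  next
    have "(\<lambda>n. (1 - 1 / Suc n) *\<^sub>R z - (1 / Suc n) *\<^sub>R a) \<longlonglongrightarrow> (1 - 0) *\<^sub>R z - 0 *\<^sub>R a"
      by (intro tendsto_intros inverse_Suc_tendsto)
    then show "(\<lambda>n. (1 - 1 / Suc n) *\<^sub>R z - (1 / Suc n) *\<^sub>R a) \<longlonglongrightarrow> z" by simp
  qed
  \<comment> \<open>A negative \<open>k\<close> would put \<open>- p\<close> into the interior, but
    a normal at \<open>p\<close> vanishes on \<open>- p\<close>. This is what bounds the radius by
    \<open>pi / 2\<close>.\<close>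
  have k0: "k \<ge> 0"
  proof (rule ccontr)
    assume "\<not> k \<ge> 0"
    then have "g (- p) < 0" using ay(1)[OF p] bd_norm[OF p] by (simp add: g_def)
    moreover have "open {z. g z < 0}" unfolding g_def by (intro open_Collect_less continuous_intros)
    ultimately have "- p \<in> interior D" using interior_maximal[OF sub1] by blast
    then have "u \<bullet> (- p) < 0" using unormal[OF D p] up by (intro polar_interior_neg[of u D]) (auto simp: u_def normals_iff)
    then show False using up by simp
  qed
  have a0: "norm a > 0" using ka by linarith
  show ?thesis
  proof
    show "norm (- sgn a) = 1" using a0 by (simp add: norm_sgn)
    show "0 \<le> k / norm a" "k / norm a < 1" using k0 ka a0 by simp_all
    have "g z \<le> 0 \<longleftrightarrow> k / norm a * norm z \<le> (- sgn a) \<bullet> z" for z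
      using a0 by (simp add: g_def sgn_div_norm field_simps) linarith
    then show "D = cap_cone (- sgn a) (k / norm a)" using sub2 sub3 by (auto simp: cap_cone_def)
  qed
qed

section \<open>From symmetric intersections to circular cones\<close>

text \<open>A single chord of \<open>C\<close> with different end angles would force, through
  \<open>chord_dichotomy\<close>, the same pair of angles on every chord of that length in
  \<open>D\<close>, against \<open>no_asymmetric_length\<close> for \<open>D\<close>.\<close>

lemma equal_angles_of_small_sym:
  assumes C: "cbody C" "smooth C" and D: "cbody D" "smooth D" and sym: "small_sym \<epsilon> C D" and eps: "\<epsilon> > 0"
  obtains s where "s > 0" "\<And>p q. p \<in> bd C \<Longrightarrow> q \<in> bd C \<Longrightarrow> norm (q - p) < s \<Longrightarrow> unormal C p \<bullet> q = unormal C q \<bullet> p"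
proof -
  obtain l0 where l0: "l0 > 0"
    "\<And>p q p' q'. p \<in> bd C \<Longrightarrow> q \<in> bd C \<Longrightarrow> p' \<in> bd D \<Longrightarrow> q' \<in> bd D \<Longrightarrow> p \<noteq> q \<Longrightarrow> norm (q - p) \<le> l0 \<Longrightarrow>
      norm (q' - p') = norm (q - p) \<Longrightarrow> tang C p \<bullet> q > 0 \<Longrightarrow> tang D p' \<bullet> q' > 0 \<Longrightarrow>
      unormal C p \<bullet> q = unormal C q \<bullet> p \<and> unormal D p' \<bullet> q' = unormal D q' \<bullet> p' \<or>
      unormal C p \<bullet> q = unormal D q' \<bullet> p' \<and> unormal C q \<bullet> p = unormal D p' \<bullet> q' \<or>
      unormal C p \<bullet> q = unormal D p' \<bullet> q' \<and> unormal C q \<bullet> p = unormal D q' \<bullet> p'"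
    by (rule chord_dichotomy[OF C D sym eps]) blast
  obtain rC where "chord_scale C rC" using chord_scale_exists[OF C] .
  then interpret c: chord_scale C rC .
  obtain rD where "chord_scale D rD" using chord_scale_exists[OF D] .
  then interpret d: chord_scale D rD .
  \<comment> \<open>\<open>rD / 2\<close> provides \<open>2 * l < rD\<close> for
    \<open>no_asymmetric_length\<close>.\<close>
  define s where "s = Min {l0, rC, rD / 2}"
  have s: "s > 0" "s \<le> l0" "s \<le> rC" "s \<le> rD / 2" using l0 c.r d.r by (simp_all add: s_def)
  have fwd: "unormal C p \<bullet> q = unormal C q \<bullet> p" if p: "p \<in> bd C" and q: "q \<in> bd C" "norm (q - p) < s" and t: "tang C p \<bullet> q > 0" for p q
  proof (rule ccontr)
    assume ne: "unormal C p \<bullet> q \<noteq> unormal C q \<bullet> p"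
    define l where "l = norm (q - p)"
    have "p \<noteq> q" using ne by auto
    then have l: "l > 0" "l < s" using q by (simp_all add: l_def)
    define a b where "a = unormal C p \<bullet> q" and "b = unormal C q \<bullet> p"
    have ab: "a \<noteq> b" "a \<le> 0" "b \<le> 0" using ne unormal(4)[OF C(1) p bd_mem[OF C(1) q(1)]] unormal(4)[OF C(1) q(1) bd_mem[OF C(1) p]] by (auto simp: a_def b_def)
    have fw: "unormal D p' \<bullet> q' = a \<and> unormal D q' \<bullet> p' = b \<or> unormal D p' \<bullet> q' = b \<and> unormal D q' \<bullet> p' = a"
      if "p' \<in> bd D" "q' \<in> bd D" "norm (q' - p') = l" "tang D p' \<bullet> q' > 0" for p' q'
      using l0(2)[OF p q(1) that(1,2) \<open>p \<noteq> q\<close> _ _ t that(4)] that(3) l s ab(1) by (auto simp: a_def b_def l_def)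
    have all: "unormal D p' \<bullet> q' = a \<and> unormal D q' \<bullet> p' = b \<or> unormal D p' \<bullet> q' = b \<and> unormal D q' \<bullet> p' = a"
      if h: "p' \<in> bd D" "q' \<in> bd D" "norm (q' - p') = l" for p' q'
    proof -
      have lr: "norm (q' - p') < rD" using h(3) l s d.r by linarith
      have "tang D p' \<bullet> q' \<noteq> 0" using d.tlarge[OF h(1,2) lr] h(3) l by auto
      then consider "tang D p' \<bullet> q' > 0" | "tang D p' \<bullet> q' < 0" by linarith
      then show ?thesis
      proof cases
        case 1 then show ?thesis using fw h by blast
      next
        case 2
        then have "-1 * (tang D q' \<bullet> p') < 0" by (intro d.tang_opposite[OF h(1,2) lr]) simp
        then have "tang D q' \<bullet> p' > 0" by simp
        then show ?thesis using fw[OF h(2,1)] h(3) by (auto simp: norm_minus_commute)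
      qed
    qed
    have "2 * l < rD" using l s by linarith
    then show False
      using d.no_asymmetric_length[of l b a] d.no_asymmetric_length[of l a b] l ab all by (metis linorder_neqE_linordered_idom)
  qed
  show ?thesis
  proof (rule that[OF s(1)])
    fix p q assume h: "p \<in> bd C" "q \<in> bd C" "norm (q - p) < s"
    show "unormal C p \<bullet> q = unormal C q \<bullet> p"
    proof (cases "p = q")
      case False
      have lr: "norm (q - p) < rC" using h s by linarith
      have "tang C p \<bullet> q \<noteq> 0" using c.tlarge[OF h(1,2) lr] False by auto
      then consider "tang C p \<bullet> q > 0" | "tang C p \<bullet> q < 0" by linarith
      then show ?thesis
      proof cases
        case 1 then show ?thesis using fwd h by blast
      next
        case 2
        then have "-1 * (tang C q \<bullet> p) < 0" by (intro c.tang_opposite[OF h(1,2) lr]) simp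
        then show ?thesis using fwd[OF h(2,1)] h(3) by (simp add: norm_minus_commute)
      qed
    qed simp
  qed
qed

lemma small_sym_imp_cap:
  assumes C: "cbody C" and D: "cbody D" and sym: "small_sym \<epsilon> C D" and eps: "\<epsilon> > 0"
  obtains c m where "norm c = 1" "0 \<le> m" "m < 1" "C = cap_cone c m"
proof -
  have SC: "smooth C" by (rule smooth_of_small_sym[OF C D sym eps])
  have SD: "smooth D" by (rule smooth_of_small_sym[OF D C small_sym_commute[OF sym] eps])
  obtain s where s: "s > 0" "\<And>p q. p \<in> bd C \<Longrightarrow> q \<in> bd C \<Longrightarrow> norm (q - p) < s \<Longrightarrow> unormal C p \<bullet> q = unormal C q \<bullet> p"
    using equal_angles_of_small_sym[OF C SC D SD sym eps] by blast
  obtain r where "chord_scale C r" using chord_scale_exists[OF C SC] .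
  then interpret c: chord_scale C r .
  have "0 < min s r" "min s r \<le> r" using s c.r by auto
  then obtain k a where "\<And>y. y \<in> bd C \<Longrightarrow> unormal C y = k *\<^sub>R y + a"
    using c.global_affine[of "min s r"] s(2) by (metis min_less_iff_conj)
  then show ?thesis using affine_normals_imp_cap[OF C SC] that by blast
qed

section \<open>From the sphere to cones\<close>

lemma S2_inner_bounds:
  assumes "x \<in> S2" "y \<in> S2"
  shows "-1 \<le> x \<bullet> y" "x \<bullet> y \<le> 1"
  using Cauchy_Schwarz_ineq2[of x y] assms by auto

lemma sdist_le_iff:
  assumes "x \<in> S2" "y \<in> S2" "0 \<le> r" "r \<le> pi"
  shows "sdist x y \<le> r \<longleftrightarrow> cos r \<le> x \<bullet> y"
proof
  assume "sdist x y \<le> r"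
  then have "cos r \<le> cos (sdist x y)"
    using assms S2_inner_bounds[OF assms(1,2)] by (intro cos_monotone_0_pi_le) (auto simp: sdist_def arccos_lbound)
  then show "cos r \<le> x \<bullet> y" using S2_inner_bounds[OF assms(1,2)] by (simp add: sdist_def cos_arccos)
next
  assume "cos r \<le> x \<bullet> y"
  then have "arccos (x \<bullet> y) \<le> arccos (cos r)"
    using S2_inner_bounds[OF assms(1,2)] by (intro arccos_le_arccos) auto
  then show "sdist x y \<le> r" using assms by (simp add: sdist_def arccos_cos)
qed

lemma sdisc_eq:
  assumes "c \<in> S2" "0 \<le> r" "r \<le> pi"
  shows "sdisc c r = {x \<in> S2. cos r \<le> c \<bullet> x}"
  using assms by (auto simp: sdisc_def sdist_le_iff simp del: mem_sphere_0)

lemma sdist_eq_iff: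
  assumes "x \<in> S2" "y \<in> S2" "x' \<in> S2" "y' \<in> S2"
  shows "sdist x y = sdist x' y' \<longleftrightarrow> x \<bullet> y = x' \<bullet> y'"
  using S2_inner_bounds[OF assms(1,2)] S2_inner_bounds[OF assms(3,4)] by (auto simp: sdist_def intro: arccos_eq_iff[THEN iffD1] )

text \<open>Equal angular distances are equal inner products, hence equal chords, and an isometry of
  the sphere extends to an orthogonal map.\<close>

lemma congruence_orth:
  assumes "congruence f"
  obtains g where "orthogonal_transformation g" "\<And>x. x \<in> S2 \<Longrightarrow> g x = f x"
proof -
  have fS: "f x \<in> S2" if "x \<in> S2" for x using assms that by (auto simp: congruence_def simp del: mem_sphere_0)
  have ip: "f x \<bullet> f y = x \<bullet> y" if "x \<in> S2" "y \<in> S2" for x y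
    using assms that sdist_eq_iff[OF fS[OF that(1)] fS[OF that(2)] that] by (auto simp: congruence_def simp del: mem_sphere_0)
  have "\<exists>g. orthogonal_transformation g \<and> (\<forall>x. norm x = 1 \<longrightarrow> g x = f x)"
  proof (rule isometry_sphere_extend)
    fix x :: "real^3" assume "norm x = 1"
    then show "norm (f x) = 1" using fS[of x] by simp
  next
    fix x y :: "real^3" assume "norm x = 1" "norm y = 1"
    then have "(f x - f y) \<bullet> (f x - f y) = (x - y) \<bullet> (x - y)"
      using ip[of x y] ip[of x x] ip[of y y] by (simp add: inner_diff_left inner_diff_right inner_commute)
    then show "dist (f x) (f y) = dist x y" by (simp add: dist_norm norm_eq_sqrt_inner)
  qed
  then show ?thesis using that by auto
qed

lemma orth_congruence:
  assumes "orthogonal_transformation f"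
  shows "congruence f"
  unfolding congruence_def
proof (intro conjI ballI)
  show "f ` S2 = S2"
  proof (intro equalityI subsetI)
    fix z :: "real^3" assume z: "z \<in> S2"
    obtain x where "z = f x" using orthogonal_transformation_surj[OF assms] by (meson surjD)
    then show "z \<in> f ` S2" using z orth_norm[OF assms] by auto
  qed (use orth_norm[OF assms] in auto)
  show "sdist (f x) (f y) = sdist x y" for x y by (simp add: sdist_def orth_inner[OF assms])
qed

text \<open>An orthogonal map multiplies cross products by its determinant, so commuting with one
  nonzero cross product gives determinant 1.\<close>

lemma rot_orientation_preserving:
  assumes "rot g"
  shows "orientation_preserving g"
proof -
  have o: "orthogonal_transformation g" using assms by (rule rot_orth)
  have m: "matrix g *v z = g z" for z using o by (simp add: matrix_works orthogonal_transformation_linear)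
  let ?x = "axis 1 1 :: real^3" and ?y = "axis 2 1 :: real^3"
  have "g (cross3 ?x ?y) = det (matrix g) *\<^sub>R g (cross3 ?x ?y)"
    using cross_orthogonal_transformation[OF o, of ?x ?y] assms by (simp add: rot_def)
  moreover have "cross3 ?x ?y \<noteq> 0" unfolding cross_basis by (simp add: axis_eq_0_iff)
  then have "g (cross3 ?x ?y) \<noteq> 0" using orth_norm[OF o] by (metis norm_eq_zero)
  ultimately have "det (matrix g) = 1" by (metis scaleR_cancel_right scaleR_one)
  then have "rotation_matrix (matrix g)" using o by (simp add: rotation_matrix_def orthogonal_transformation_matrix)
  then show ?thesis using m unfolding orientation_preserving_def by metis
qed

lemma rot_id: "rot id"
  by (simp add: rot_def orthogonal_transformation_def linear_id)

lemma neg_ne_self: "x \<noteq> 0 \<Longrightarrow> - x \<noteq> x" for x :: "'a::real_vector"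
proof
  assume "x \<noteq> 0" "- x = x"
  then have "2 *\<^sub>R x = 0" by (metis add.right_inverse scaleR_2)
  then show False using \<open>x \<noteq> 0\<close> by simp
qed

lemma rot_transitive:
  assumes "norm d = 1" "norm d' = 1"
  obtains g where "rot g" "g d = d'"
proof -
  obtain e where e: "norm e = 1" "d \<bullet> e = 0" by (rule orthogonal_unit_exists)
  obtain e' where e': "norm e' = 1" "d' \<bullet> e' = 0" by (rule orthogonal_unit_exists)
  show ?thesis using that frame_map[OF assms(1) e assms(2) e'] by blast
qed

lemma sdisc_image:
  assumes "orthogonal_transformation g"
  shows "g ` sdisc d s = sdisc (g d) s"
proof (intro equalityI subsetI)
  fix z assume "z \<in> sdisc (g d) s"
  moreover obtain x where "z = g x" using orthogonal_transformation_surj[OF assms] by (meson surjD)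
  ultimately show "z \<in> g ` sdisc d s" by (auto simp: sdisc_def sdist_def orth_inner[OF assms] orth_norm[OF assms])
qed (auto simp: sdisc_def sdist_def orth_inner[OF assms] orth_norm[OF assms])

text \<open>Two unit vectors at angle \<open>e1\<close> have chord length
  \<open>sqrt (2 - 2 * cos e1)\<close>; \<open>min \<epsilon> pi\<close> stays where the cosine
  decreases.\<close>

lemma sdiam_le:
  assumes "\<epsilon> > 0"
  obtains e where "e > 0" "\<And>A. A \<subseteq> S2 \<Longrightarrow> (\<And>x y. x \<in> A \<Longrightarrow> y \<in> A \<Longrightarrow> dist x y \<le> e) \<Longrightarrow> sdiam A \<le> \<epsilon>"
proof -
  define e1 where "e1 = min \<epsilon> pi"
  have e1: "0 < e1" "e1 \<le> pi" "e1 \<le> \<epsilon>" using assms by (auto simp: e1_def)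
  have c1: "cos e1 < 1" using cos_monotone_0_pi[of 0 e1] e1 by simp
  define e where "e = sqrt (2 - 2 * cos e1)"
  have e: "e > 0" "e\<^sup>2 = 2 - 2 * cos e1" using c1 by (simp_all add: e_def)
  show ?thesis
  proof (rule that[OF e(1)])
    fix A :: "(real^3) set" assume A: "A \<subseteq> S2" and d: "\<And>x y. x \<in> A \<Longrightarrow> y \<in> A \<Longrightarrow> dist x y \<le> e"
    have "sdist x y \<le> \<epsilon>" if "x \<in> A" "y \<in> A" for x y
    proof -
      have xy: "x \<in> S2" "y \<in> S2" using that A by auto
      have "(norm (y - x))\<^sup>2 \<le> e\<^sup>2" using d[OF that] by (intro power_mono) (auto simp: dist_norm norm_minus_commute)
      then have "cos e1 \<le> x \<bullet> y" using sum_diff_orthogonal(3)[of x y] xy e(2) by simp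
      then show ?thesis using sdist_le_iff[OF xy, of e1] e1 by simp
    qed
    then show "sdiam A \<le> \<epsilon>"
      unfolding sdiam_def using assms by (auto intro!: cSUP_least)
  qed
qed

lemma sint_nonempty:
  assumes "open U" "x \<in> U" "x \<in> S2" "U \<inter> S2 \<subseteq> A"
  shows "sint A \<noteq> {}"
proof -
  have "openin (top_of_set S2) (S2 \<inter> U)" using assms(1) by (rule openin_open_Int)
  then have "x \<in> sint A" unfolding interior_of_def using assms by (auto intro!: exI[of _ "S2 \<inter> U"])
  then show ?thesis by blast
qed

section \<open>Cones over convex sets on the sphere\<close>

definition cone_of :: "(real^3) set \<Rightarrow> (real^3) set" where
  "cone_of K = {r *\<^sub>R x | r x. 0 \<le> r \<and> x \<in> K}"

text \<open>\<open>sconvex\<close> becomes closure under addition: the sum of two vectors points to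
  the short arc between their directions. For opposite directions, where no arc is prescribed, the
  sum is a nonnegative multiple of one of the two.\<close>

lemma cone_of_cbody:
  assumes K: "K \<subset> S2" "closedin (top_of_set S2) K" "sconvex K" "sint K \<noteq> {}"
  shows "cbody (cone_of K)" "cone_of K \<inter> S2 = K"
proof -
  have nK: "norm x = 1" if "x \<in> K" for x using K(1) that by auto
  show KS: "cone_of K \<inter> S2 = K"
  proof (intro equalityI subsetI)
    fix z assume "z \<in> cone_of K \<inter> S2"
    then obtain r x where "z = r *\<^sub>R x" "0 \<le> r" "x \<in> K" "norm z = 1" by (auto simp: cone_of_def)
    then show "z \<in> K" using nK[of x] by simp
  next
    fix z assume "z \<in> K"
    then show "z \<in> cone_of K \<inter> S2" using nK[of z] by (auto simp: cone_of_def intro!: exI[of _ "1::real"])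
  qed
  obtain U where U: "open U" "S2 \<inter> U \<subseteq> K" "S2 \<inter> U \<noteq> {}"
  proof -
    obtain x T where T: "openin (top_of_set S2) T" "x \<in> T" "T \<subseteq> K" using K(4) unfolding interior_of_def by blast
    then obtain U where "open U" "T = S2 \<inter> U" by (metis openin_open)
    then show ?thesis using that T by blast
  qed
  have "K \<noteq> {}" using U by blast
  have "closed K" using K(2) closed_sphere closedin_closed_trans by blast
  have memI: "z \<in> cone_of K" if "z = 0 \<or> sgn z \<in> K" for z
    using that
  proof
    assume "z = 0" then show ?thesis using \<open>K \<noteq> {}\<close> by (auto simp: cone_of_def intro!: exI[of _ "0::real"])
  next
    assume "sgn z \<in> K"
    moreover have "z = norm z *\<^sub>R sgn z" by (cases "z = 0") (auto simp: sgn_div_norm)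
    ultimately show ?thesis unfolding cone_of_def by (metis (mono_tags, lifting) mem_Collect_eq norm_ge_zero)
  qed
  have memD: "sgn z \<in> K" if "z \<in> cone_of K" "z \<noteq> 0" for z
    using that nK by (auto simp: cone_of_def sgn_scaleR) (simp add: sgn_div_norm)
  have sc: "r *\<^sub>R z \<in> cone_of K" if "z \<in> cone_of K" "0 \<le> r" for r z
  proof -
    obtain s x where "z = s *\<^sub>R x" "0 \<le> s" "x \<in> K" using \<open>z \<in> cone_of K\<close> by (auto simp: cone_of_def)
    then have "r *\<^sub>R z = (r * s) *\<^sub>R x" "0 \<le> r * s" "x \<in> K" using that by auto
    then show ?thesis unfolding cone_of_def by blast
  qed
  have add: "x + y \<in> cone_of K" if xy: "x \<in> cone_of K" "y \<in> cone_of K" for x y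
  proof (cases "x = 0 \<or> y = 0")
    case True then show ?thesis using xy by auto
  next
    case False
    define p q r s where "p = sgn x" and "q = sgn y" and "r = norm x" and "s = norm y"
    have pq: "p \<in> K" "q \<in> K" "x = r *\<^sub>R p" "y = s *\<^sub>R q" "r > 0" "s > 0"
      using memD xy False by (auto simp: p_def q_def r_def s_def sgn_div_norm)
    show ?thesis
    proof (cases "q = - p")
      case True
      then have "x + y = (r - s) *\<^sub>R p" "x + y = (s - r) *\<^sub>R q" using pq by (simp_all add: algebra_simps)
      moreover have "0 \<le> r - s \<or> 0 \<le> s - r" by linarith
      ultimately show ?thesis using pq(1,2) unfolding cone_of_def by blast
    next
      case False
      define z where "z = (r / (r + s)) *\<^sub>R p + (s / (r + s)) *\<^sub>R q"
      have "z = (1 - s / (r + s)) *\<^sub>R p + (s / (r + s)) *\<^sub>R q" using pq by (simp add: z_def field_simps)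
      then have "z \<in> closed_segment p q" using pq unfolding closed_segment_def by (auto intro!: exI[of _ "s / (r + s)"])
      then have "sgn z \<in> short_arc p q" by (simp add: short_arc_def)
      then have "sgn z \<in> K" using K(3) pq False unfolding sconvex_def by blast
      then have "(r + s) *\<^sub>R z \<in> cone_of K" using pq by (intro sc memI) auto
      moreover have "(r + s) *\<^sub>R z = x + y" using pq by (simp add: z_def scaleR_add_right)
      ultimately show ?thesis by simp
    qed
  qed
  have "convex (cone_of K)" by (rule convexI) (simp add: sc add)
  moreover have "closed (cone_of K)"
    unfolding closed_sequential_limits
  proof (intro allI impI)
    fix x l assume h: "(\<forall>n. x n \<in> cone_of K) \<and> x \<longlonglongrightarrow> l"
    show "l \<in> cone_of K"
    proof (cases "l = 0")
      case False
      have lim: "(\<lambda>n. sgn (x n)) \<longlonglongrightarrow> sgn l" using h False by (intro tendsto_sgn) auto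
      have "\<forall>\<^sub>F n in sequentially. x n \<noteq> 0" using h False by (intro tendsto_imp_eventually_ne) auto
      then have "\<forall>\<^sub>F n in sequentially. sgn (x n) \<in> K" by eventually_elim (use h memD in auto)
      then have "sgn l \<in> K" using Lim_in_closed_set[OF \<open>closed K\<close> _ _ lim] by auto
      then show ?thesis by (intro memI) simp
    qed (simp add: memI)
  qed
  moreover have "interior (cone_of K) \<noteq> {}"
  proof -
    obtain x where x: "x \<in> S2" "x \<in> U" using U by blast
    have "open ((- {0}) \<inter> sgn -` U)"
      by (intro continuous_open_preimage continuous_intros U(1)) auto
    moreover have "(- {0}) \<inter> sgn -` U \<subseteq> cone_of K"
    proof
      fix y assume "y \<in> (- {0}) \<inter> sgn -` U"
      then have "sgn y \<in> S2 \<inter> U" by (auto simp: norm_sgn)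
      then show "y \<in> cone_of K" using U(2) memI by blast
    qed
    moreover have "x \<in> (- {0}) \<inter> sgn -` U" using x by (auto simp: sgn_div_norm)
    ultimately show ?thesis using interior_maximal by blast
  qed
  moreover have "cone_of K \<noteq> UNIV" using KS K(1) by blast
  ultimately show "cbody (cone_of K)" using sc by (auto simp: cbody_def)
qed

section \<open>The hypothesis on small intersections\<close>

text \<open>The property \<open>P\<close> is a parameter because the three conditions in the theorem
  differ only in it.\<close>

definition small_hyp :: "((real^3) set \<Rightarrow> bool) \<Rightarrow> (real^3) set \<Rightarrow> (real^3) set \<Rightarrow> real \<Rightarrow> bool" where
  "small_hyp P K L \<epsilon> \<longleftrightarrow> (\<forall>\<phi> \<psi>. congruence \<phi> \<and> orientation_preserving \<phi> \<and> congruence \<psi> \<and> orientation_preserving \<psi> \<and>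
     sint (\<phi> ` K \<inter> \<psi> ` L) \<noteq> {} \<and> sdiam (\<phi> ` K \<inter> \<psi> ` L) \<le> \<epsilon> \<longrightarrow> P (\<phi> ` K \<inter> \<psi> ` L))"

lemma small_hyp_commute: "small_hyp P K L \<epsilon> \<Longrightarrow> small_hyp P L K \<epsilon>"
  unfolding small_hyp_def by (metis Int_commute)

lemma small_hyp_mono: "small_hyp P K L \<epsilon> \<Longrightarrow> (\<And>A. P A \<Longrightarrow> Q A) \<Longrightarrow> small_hyp Q K L \<epsilon>"
  unfolding small_hyp_def by blast

lemma small_hyp_rot:
  assumes "small_hyp P K L \<epsilon>" "rot g" "sint (K \<inter> g ` L) \<noteq> {}" "sdiam (K \<inter> g ` L) \<le> \<epsilon>"
  shows "P (K \<inter> g ` L)"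
proof -
  have "congruence id" "orientation_preserving id" "congruence g" "orientation_preserving g"
    using assms(2) rot_id orth_congruence rot_orth rot_orientation_preserving by blast+
  then show ?thesis using assms(1,3,4) unfolding small_hyp_def by (metis image_id id_apply)
qed

text \<open>A congruence extends to an orthogonal map, and homogeneity carries invariance from the
  sphere to the cones.\<close>

lemma small_hyp_imp_small_sym:
  assumes K: "K \<subset> S2" "closedin (top_of_set S2) K" "sconvex K" "sint K \<noteq> {}"
    and L: "L \<subset> S2" "closedin (top_of_set S2) L" "sconvex L" "sint L \<noteq> {}"
    and eps: "\<epsilon> > 0" and hyp: "small_hyp has_nontrivial_symmetry K L \<epsilon>"
  obtains e where "e > 0" "small_sym e (cone_of K) (cone_of L)"
proof -
  obtain e where e: "e > 0" "\<And>A. A \<subseteq> S2 \<Longrightarrow> (\<And>x y. x \<in> A \<Longrightarrow> y \<in> A \<Longrightarrow> dist x y \<le> e) \<Longrightarrow> sdiam A \<le> \<epsilon>"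
    using sdiam_le[OF eps] by metis
  define C D where "C = cone_of K" and "D = cone_of L"
  have C: "cbody C" "C \<inter> S2 = K" and D: "cbody D" "D \<inter> S2 = L"
    using cone_of_cbody[OF K] cone_of_cbody[OF L] by (auto simp: C_def D_def)
  have "small_sym e C D"
    unfolding small_sym_def
  proof (intro allI impI)
    fix g assume g: "rot g" and ne: "interior (C \<inter> g ` D) \<noteq> {}"
      and sm: "\<forall>x\<in>C \<inter> g ` D \<inter> sphere 0 1. \<forall>y\<in>C \<inter> g ` D \<inter> sphere 0 1. dist x y \<le> e"
    have og: "orthogonal_transformation g" using g by (rule rot_orth)
    have E: "cbody (g ` D)" by (rule cbody_image[OF D(1) og])
    define M where "M = C \<inter> g ` D"
    have "g ` L = g ` D \<inter> S2"
    proof -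
      have "g ` (D \<inter> S2) = g ` D \<inter> S2" using orth_norm[OF og] by auto
      then show ?thesis using D(2) by simp
    qed
    then have M0: "K \<inter> g ` L = M \<inter> S2" using C(2) by (auto simp: M_def)
    have Msc: "r *\<^sub>R z \<in> M" if "z \<in> M" "0 \<le> r" for z r
      using that cbodyD(3)[OF C(1)] cbodyD(3)[OF E] by (simp add: M_def)
    have Msgn: "sgn z \<in> M \<inter> S2" if "z \<in> M" "z \<noteq> 0" for z
      using Msc[OF that(1), of "inverse (norm z)"] that by (simp add: sgn_div_norm norm_sgn)
    obtain z where z: "z \<in> interior C" "z \<in> interior (g ` D)" using ne by auto
    have "z \<noteq> 0" using z(1) zero_frontier[OF C(1)] by (auto simp: frontier_def)
    then have "sgn z \<in> interior C" "sgn z \<in> interior (g ` D)"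
      using interior_cone_scale[OF C(1) z(1), of "inverse (norm z)"] interior_cone_scale[OF E z(2), of "inverse (norm z)"]
      by (simp_all add: sgn_div_norm)
    then have si: "sint (K \<inter> g ` L) \<noteq> {}"
      unfolding M0 M_def using \<open>z \<noteq> 0\<close> interior_subset
      by (intro sint_nonempty[of "interior C \<inter> interior (g ` D)" "sgn z"]) (auto simp: norm_sgn)
    have "sdiam (K \<inter> g ` L) \<le> \<epsilon>"
      unfolding M0 by (rule e(2)) (use sm in \<open>auto simp: M_def\<close>)
    then have "has_nontrivial_symmetry (M \<inter> S2)" using small_hyp_rot[OF hyp g si] M0 by simp
    then obtain f where f: "congruence f" "\<exists>x\<in>S2. f x \<noteq> x" "f ` (M \<inter> S2) = M \<inter> S2" unfolding has_nontrivial_symmetry_def by blast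
    obtain h where h: "orthogonal_transformation h" "\<And>x. x \<in> S2 \<Longrightarrow> h x = f x" using congruence_orth[OF f(1)] by metis
    have lh: "linear h" using h(1) by (rule orthogonal_transformation_linear)
    have "h \<noteq> id" using f(2) h(2) by (metis id_apply)
    moreover have "h ` M = M"
    proof (intro equalityI subsetI)
      fix w assume "w \<in> h ` M"
      then obtain z where z: "z \<in> M" "w = h z" by blast
      show "w \<in> M"
      proof (cases "z = 0")
        case True then show ?thesis using z linear_0[OF lh] by simp
      next
        case False
        have "f (sgn z) \<in> M" using f(3) Msgn[OF z(1) False] by blast
        then have "norm z *\<^sub>R f (sgn z) \<in> M" by (intro Msc) auto
        moreover have "h (sgn z) = f (sgn z)" using h(2) Msgn[OF z(1) False] by blast
        moreover have "w = norm z *\<^sub>R h (sgn z)"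
          unfolding z(2) linear_scale[OF lh, symmetric] using False by (simp add: sgn_div_norm)
        ultimately show ?thesis by simp
      qed
    next
      fix w assume w: "w \<in> M"
      show "w \<in> h ` M"
      proof (cases "w = 0")
        case True then show ?thesis using w linear_0[OF lh] by (metis image_eqI)
      next
        case False
        then have "sgn w \<in> f ` (M \<inter> S2)" unfolding f(3) by (intro Msgn w)
        then obtain x where x: "x \<in> M \<inter> S2" "f x = sgn w" by (elim imageE) simp
        have "h (norm w *\<^sub>R x) = norm w *\<^sub>R sgn w" using x h(2)[of x] by (simp add: linear_scale[OF lh])
        also have "\<dots> = w" using False by (simp add: sgn_div_norm)
        finally have "w = h (norm w *\<^sub>R x)" ..
        moreover have "norm w *\<^sub>R x \<in> M" using x by (intro Msc) auto
        ultimately show ?thesis by (rule image_eqI)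
      qed
    qed
    ultimately show "\<exists>f. orthogonal_transformation f \<and> f \<noteq> id \<and> f ` (C \<inter> g ` D) = C \<inter> g ` D"
      using h(1) unfolding M_def by blast
  qed
  then show ?thesis using that e(1) by (simp add: C_def D_def)
qed

lemma small_hyp_imp_disc:
  assumes K: "K \<subset> S2" "closedin (top_of_set S2) K" "sconvex K" "sint K \<noteq> {}"
    and L: "L \<subset> S2" "closedin (top_of_set S2) L" "sconvex L" "sint L \<noteq> {}"
    and eps: "\<epsilon> > 0" and hyp: "small_hyp has_nontrivial_symmetry K L \<epsilon>"
  shows "circle_radius_le_half_pi K"
proof -
  obtain e where e: "e > 0" "small_sym e (cone_of K) (cone_of L)"
    by (rule small_hyp_imp_small_sym[OF K L eps hyp])
  obtain c m where cm: "norm c = 1" "0 \<le> m" "m < 1" "cone_of K = cap_cone c m"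
    by (rule small_sym_imp_cap[OF cone_of_cbody(1)[OF K] cone_of_cbody(1)[OF L] e(2,1)])
  \<comment> \<open>\<open>0 \<le> m\<close> gives a radius of at most \<open>pi / 2\<close>, and
    \<open>m < 1\<close> a positive one.\<close>
  define r where "r = arccos m"
  have r: "cos r = m" "0 \<le> r" "r \<le> pi / 2" using cm arccos_le_pi2[of m] arccos_lbound[of m] by (simp_all add: r_def)
  have "r \<noteq> 0" using r cm by auto
  then have "0 < r" using r by simp
  have "K = cap_cone c m \<inter> S2" using cone_of_cbody(2)[OF K] cm by simp
  also have "\<dots> = sdisc c r" using sdisc_eq[of c r] cm r pi_gt_zero by (auto simp: cap_cone_def)
  finally show ?thesis unfolding circle_radius_le_half_pi_def using cm r \<open>0 < r\<close> by auto
qed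

section \<open>Symmetries of discs and of their intersections\<close>

lemma reflection_orth:
  assumes "norm u = 1"
  shows "orthogonal_transformation (great_circle_reflection u)"
  unfolding orthogonal_transformation_def
proof (intro conjI allI)
  show "linear (great_circle_reflection u)"
    by (rule linearI) (simp_all add: great_circle_reflection_def inner_add_right algebra_simps)
  have "u \<bullet> u = 1" using assms by (simp add: norm_eq_1)
  then show "great_circle_reflection u v \<bullet> great_circle_reflection u w = v \<bullet> w" for v w
    by (simp add: great_circle_reflection_def inner_diff_left inner_diff_right inner_commute algebra_simps)
qed

text \<open>The pole \<open>u\<close> of the axis is moved to its antipode.\<close>

lemma axis_imp_nontrivial:
  assumes "axis_of_symmetry C A"
  shows "has_nontrivial_symmetry A"
proof -
  obtain u where u: "u \<in> S2" "great_circle_reflection u ` A = A" using assms unfolding axis_of_symmetry_def by blast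
  have "great_circle_reflection u u = - u" using u(1) by (simp add: great_circle_reflection_def norm_eq_1 scaleR_2)
  moreover have "- u \<noteq> u" using u(1) by (intro neg_ne_self) auto
  ultimately show ?thesis
    using u orth_congruence[OF reflection_orth[of u]] unfolding has_nontrivial_symmetry_def by (metis mem_sphere_0)
qed

lemma rotation_pi: "rotation_about p pi x = (2 * (p \<bullet> x)) *\<^sub>R p - x"
  by (simp add: rotation_about_def)

lemma rotation_pi_orth:
  assumes "norm p = 1"
  shows "orthogonal_transformation (rotation_about p pi)"
  unfolding orthogonal_transformation_def
proof (intro conjI allI)
  show "linear (rotation_about p pi)"
    by (rule linearI) (simp_all add: rotation_pi inner_add_right algebra_simps)
  have "p \<bullet> p = 1" using assms by (simp add: norm_eq_1)
  then show "rotation_about p pi v \<bullet> rotation_about p pi w = v \<bullet> w" for v w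
    by (simp add: rotation_pi inner_diff_left inner_diff_right inner_commute algebra_simps)
qed

text \<open>A point at distance \<open>pi / 2\<close> from the centre is moved to its
  antipode.\<close>

lemma central_imp_nontrivial:
  assumes "centrally_symmetric A"
  shows "has_nontrivial_symmetry A"
proof -
  obtain p where p: "p \<in> S2" "rotation_about p pi ` A = A" using assms unfolding centrally_symmetric_def by blast
  obtain e where e: "norm e = 1" "p \<bullet> e = 0" by (rule orthogonal_unit_exists)
  have "rotation_about p pi e = - e" using e by (simp add: rotation_pi)
  moreover have "- e \<noteq> e" using e by (intro neg_ne_self) auto
  ultimately show ?thesis
    using p e orth_congruence[OF rotation_pi_orth[of p]] unfolding has_nontrivial_symmetry_def by (metis mem_sphere_0)
qed

text \<open>A great circle through both centres is an axis; its pole \<open>u\<close> is any unit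
  vector orthogonal to \<open>c\<close> when the centres coincide or are antipodal.\<close>

lemma discs_have_axis:
  assumes c: "c \<in> S2" and d: "d \<in> S2"
  shows "\<exists>X. axis_of_symmetry X (sdisc c r \<inter> sdisc d s)"
proof -
  obtain u where u: "norm u = 1" "u \<bullet> c = 0" "u \<bullet> d = 0"
  proof (cases "cross3 c d = 0")
    case False
    then show ?thesis using that[of "sgn (cross3 c d)"] by (simp add: norm_sgn sgn_div_norm dot_cross_self)
  next
    case True
    obtain e where e: "norm e = 1" "c \<bullet> e = 0" by (rule orthogonal_unit_exists)
    have "c = d \<or> c = - d" using unit_cross_nonzero[of c d] True c d by auto
    then show ?thesis using that[of e] e by (auto simp: inner_commute)
  qed
  let ?f = "great_circle_reflection u"
  have o: "orthogonal_transformation ?f" using u by (intro reflection_orth)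
  have "?f c = c" "?f d = d" using u by (simp_all add: great_circle_reflection_def)
  then have "?f ` sdisc c r = sdisc c r" "?f ` sdisc d s = sdisc d s" using sdisc_image[OF o] by metis+
  then have "?f ` (sdisc c r \<inter> sdisc d s) = sdisc c r \<inter> sdisc d s"
    using orthogonal_transformation_inj[OF o] by (simp add: image_Int)
  moreover have "u \<in> S2" using u by simp
  ultimately show ?thesis unfolding axis_of_symmetry_def by blast
qed

lemma orientation_preserving_disc:
  assumes "orientation_preserving \<phi>" "c \<in> S2"
  obtains c' where "c' \<in> S2" "\<phi> ` sdisc c r = sdisc c' r"
proof -
  obtain Q :: "real^3^3" where Q: "rotation_matrix Q" "\<And>x. x \<in> S2 \<Longrightarrow> \<phi> x = Q *v x"
    using assms(1) unfolding orientation_preserving_def by blast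
  have o: "orthogonal_transformation ((*v) Q)" 
    using Q(1) by (simp add: rotation_matrix_def orthogonal_transformation_matrix)
  have "\<phi> ` sdisc c r = (*v) Q ` sdisc c r" by (rule image_cong) (use Q(2) in \<open>auto simp: sdisc_def\<close>)
  also have "\<dots> = sdisc (Q *v c) r" by (rule sdisc_image[OF o])
  finally show ?thesis using that[of "Q *v c"] orth_norm[OF o, of c] assms(2) by auto
qed

lemma discs_small_hyp:
  assumes "circle_radius_le_half_pi K" "circle_radius_le_half_pi L"
  shows "small_hyp (\<lambda>A. \<exists>X. axis_of_symmetry X A) K L \<epsilon>"
  unfolding small_hyp_def
proof (intro allI impI)
  fix \<phi> \<psi> assume h: "congruence \<phi> \<and> orientation_preserving \<phi> \<and> congruence \<psi> \<and> orientation_preserving \<psi> \<and>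
     sint (\<phi> ` K \<inter> \<psi> ` L) \<noteq> {} \<and> sdiam (\<phi> ` K \<inter> \<psi> ` L) \<le> \<epsilon>"
  obtain c r d s where cd: "c \<in> S2" "K = sdisc c r" "d \<in> S2" "L = sdisc d s" using assms unfolding circle_radius_le_half_pi_def by blast
  obtain c' where "c' \<in> S2" "\<phi> ` K = sdisc c' r" using orientation_preserving_disc[OF _ cd(1), of \<phi> r] h cd by metis
  moreover obtain d' where "d' \<in> S2" "\<psi> ` L = sdisc d' s" using orientation_preserving_disc[OF _ cd(3), of \<psi> s] h cd by metis
  ultimately show "\<exists>X. axis_of_symmetry X (\<phi> ` K \<inter> \<psi> ` L)" using discs_have_axis by simp
qed

section \<open>Two discs of different radii\<close>

text \<open>If the axes were independent, the points would lie on a line, which contains at most two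
  points of the sphere.\<close>

lemma circle_determines_axis:
  fixes c b :: "real^3"
  assumes cb: "norm c = 1" "norm b = 1" and A: "infinite A"
    and on: "\<And>x. x \<in> A \<Longrightarrow> norm x = 1 \<and> c \<bullet> x = \<alpha> \<and> b \<bullet> x = \<beta>"
  shows "b = c \<or> b = - c"
proof (rule ccontr)
  assume "\<not> ?thesis"
  then have n0: "cross3 c b \<noteq> 0" using cb by (intro unit_cross_nonzero) auto
  let ?n = "cross3 c b"
  have par: "\<exists>k. x - y = k *\<^sub>R ?n" if "x \<in> A" "y \<in> A" for x y
  proof -
    have d: "(x - y) \<bullet> c = 0" "(x - y) \<bullet> b = 0" using on[OF that(1)] on[OF that(2)] by (auto simp: inner_diff_left inner_diff_right inner_commute)
    show ?thesis using parallel_cross3[OF n0 d] .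
  qed
  obtain x where x: "x \<in> A" using A by (metis finite.emptyI ex_in_conv)
  have "infinite (A - {x})" using A by simp
  then obtain y where y: "y \<in> A" "y \<noteq> x" by (metis Diff_iff finite.emptyI ex_in_conv singletonI)
  have "infinite (A - {x, y})" using A by simp
  then obtain z where z: "z \<in> A" "z \<noteq> x" "z \<noteq> y" by (metis Diff_iff finite.emptyI ex_in_conv insertI1 insertI2)
  obtain k1 k2 where k: "x - y = k1 *\<^sub>R ?n" "z - y = k2 *\<^sub>R ?n" using par x y z by meson
  have "k2 *\<^sub>R (x - y) + (- k1) *\<^sub>R (z - y) = 0" unfolding k by simp
  then have "k2 = 0" using on x y z by (intro sphere_points_independent[of x y z k2 "- k1"]) auto
  then show False using k z by simp
qed

text \<open>The lens is made small by putting the centres almost \<open>r + s\<close> apart. The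
  half turn takes the arc of the smaller circle into the boundary of the lens. If infinitely many
  points land on the smaller circle, the half turn is about \<open>c\<close>, which moves the arc
  out of the other disc; infinitely many cannot land on the larger circle, as the radii
  differ.\<close>

lemma central_radii_not_less:
  assumes c: "c \<in> S2" and d: "d \<in> S2" and rs: "0 < r" "r < s" "s \<le> pi / 2" and eps: "\<epsilon> > 0"
    and hyp: "small_hyp centrally_symmetric (sdisc c r) (sdisc d s) \<epsilon>"
  shows False
proof -
  obtain e0 where e0: "e0 > 0" "\<And>A. A \<subseteq> S2 \<Longrightarrow> (\<And>x y. x \<in> A \<Longrightarrow> y \<in> A \<Longrightarrow> dist x y \<le> e0) \<Longrightarrow> sdiam A \<le> \<epsilon>"
    using sdiam_le[OF eps] by metis
  obtain e where e: "norm e = 1" "c \<bullet> e = 0" by (rule orthogonal_unit_exists)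
  define f where "f = cross3 c e"
  have nc: "norm c = 1" using c by simp
  have f: "norm f = 1" "c \<bullet> f = 0" "e \<bullet> f = 0"
    using cross_orthonormal(1)[OF nc e] by (simp_all add: f_def dot_cross_self)
  have o: "c \<bullet> c = 1" "e \<bullet> e = 1" "f \<bullet> f = 1" "c \<bullet> e = 0" "e \<bullet> c = 0" "c \<bullet> f = 0" "f \<bullet> c = 0" "e \<bullet> f = 0" "f \<bullet> e = 0"
    using nc e f by (simp_all add: norm_eq_1 inner_commute)
  define S where "S = sin (r + s)"
  have S: "S > 0" unfolding S_def using rs by (intro sin_gt_zero) auto
  \<comment> \<open>Overlap of the discs: \<open>near\<close> needs
    \<open>16 * \<delta> \<le> S * e0\<^sup>2\<close>, and \<open>\<delta> < r\<close> keeps the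
    distance of the centres above \<open>s\<close>.\<close>
  define \<delta> where "\<delta> = min (r / 2) (S * e0\<^sup>2 / 16)"
  have de: "0 < \<delta>" "\<delta> < r" "16 * \<delta> \<le> S * e0\<^sup>2" using rs S e0 by (auto simp: \<delta>_def)
  define \<omega> where "\<omega> = r + s - \<delta>"
  have om: "s < \<omega>" "\<omega> < pi" "\<omega> - r = s - \<delta>" using de rs by (auto simp: \<omega>_def)
  define d' where "d' = cos \<omega> *\<^sub>R c + sin \<omega> *\<^sub>R e"
  have nd': "norm d' = 1" by (simp add: d'_def norm_eq_1 inner_add_left inner_add_right o power2_eq_square[symmetric])
  obtain g where g: "rot g" "g d = d'" using rot_transitive[OF _ nd', of d] d by auto
  define M where "M = {x \<in> S2. cos r \<le> c \<bullet> x \<and> cos s \<le> d' \<bullet> x}"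
  have M: "sdisc c r \<inter> g ` sdisc d s = M"
    using sdisc_eq[of c r] sdisc_eq[of d' s] c nd' rs sdisc_image[OF rot_orth[OF g(1)], of d s] g(2) by (auto simp: M_def)
  have cos_d: "c \<bullet> d' = cos \<omega>" "d' \<bullet> c = cos \<omega>" by (simp_all add: d'_def inner_add_right inner_add_left o)
  \<comment> \<open>Polar coordinates about \<open>c\<close>; \<open>\<tau> = 0\<close> is the
    direction towards \<open>d'\<close>.\<close>
  define p where "p = (\<lambda>\<theta> \<tau>. cos \<theta> *\<^sub>R c + sin \<theta> *\<^sub>R (cos \<tau> *\<^sub>R e + sin \<tau> *\<^sub>R f))"
  have pn: "norm (p \<theta> \<tau>) = 1" for \<theta> \<tau>
  proof -
    have "p \<theta> \<tau> \<bullet> p \<theta> \<tau> = cos \<theta> * cos \<theta> + (sin \<theta> * sin \<theta> * (cos \<tau> * cos \<tau>) + sin \<theta> * sin \<theta> * (sin \<tau> * sin \<tau>))"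
      by (simp add: p_def inner_add_left inner_add_right o algebra_simps)
    also have "\<dots> = (cos \<theta>)\<^sup>2 + (sin \<theta>)\<^sup>2 * ((cos \<tau>)\<^sup>2 + (sin \<tau>)\<^sup>2)"
      by (simp only: power2_eq_square distrib_left)
    also have "\<dots> = 1" by simp
    finally show ?thesis by (simp only: norm_eq_1)
  qed
  have pc: "c \<bullet> p \<theta> \<tau> = cos \<theta>" for \<theta> \<tau> by (simp add: p_def inner_add_right o)
  have pd: "d' \<bullet> p \<theta> \<tau> = cos \<omega> * cos \<theta> + sin \<omega> * sin \<theta> * cos \<tau>" for \<theta> \<tau>
    by (simp add: p_def d'_def inner_add_left inner_add_right o)
  have pd0: "d' \<bullet> p \<theta> 0 = cos (\<omega> - \<theta>)" for \<theta> by (simp add: pd cos_diff)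
  have near: "norm (x - p r 0) \<le> e0 / 2" if x: "x \<in> M" for x
  proof -
    define d0 where "d0 = cos (r + s) *\<^sub>R c + sin (r + s) *\<^sub>R e"
    have nx: "norm x = 1" "cos r \<le> c \<bullet> x" "cos s \<le> d' \<bullet> x" using x by (auto simp: M_def)
    have "norm (d0 - d') \<le> 2 * \<delta>"
    proof -
      have "norm d0 = 1" by (simp add: d0_def norm_eq_1 inner_add_left inner_add_right o power2_eq_square[symmetric])
      then have "d' \<bullet> d0 = 1 - (norm (d0 - d'))\<^sup>2 / 2" by (rule sum_diff_orthogonal(3)[OF nd'])
      moreover have "d' \<bullet> d0 = cos (2 * (\<delta> / 2))"
        using cos_diff[of "r + s" \<omega>] by (simp add: d'_def d0_def inner_add_left inner_add_right o \<omega>_def mult.commute)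
      ultimately have "(norm (d0 - d'))\<^sup>2 = 4 * (sin (\<delta> / 2))\<^sup>2" unfolding cos_double_sin by simp
      moreover have "\<bar>sin (\<delta> / 2)\<bar>\<^sup>2 \<le> \<bar>\<delta> / 2\<bar>\<^sup>2" by (rule power_mono[OF abs_sin_x_le_abs_x]) simp
      ultimately have "(norm (d0 - d'))\<^sup>2 \<le> \<delta>\<^sup>2" by (simp add: power_divide)
      also have "\<dots> \<le> (2 * \<delta>)\<^sup>2" by (simp add: power_mult_distrib)
      finally show ?thesis by (rule power2_le_imp_le) (use de in simp)
    qed
    then have "\<bar>(d0 - d') \<bullet> x\<bar> \<le> 2 * \<delta>" using Cauchy_Schwarz_ineq2[of "d0 - d'" x] nx(1) by simp
    then have d0x: "d0 \<bullet> x \<ge> cos s - 2 * \<delta>" using nx(3) by (simp add: inner_diff_left)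
    \<comment> \<open>If the centres were \<open>c\<close> and \<open>d0\<close>, the discs would
      touch at \<open>p r 0\<close>; this point is proportional to the combination of the centres
      with weights \<open>sin s\<close> and \<open>sin r\<close>.\<close>
    have "sin s *\<^sub>R c + sin r *\<^sub>R d0 = (sin s + sin r * cos (r + s)) *\<^sub>R c + (sin r * sin (r + s)) *\<^sub>R e"
      by (simp add: d0_def algebra_simps)
    also have "sin s + sin r * cos (r + s) = sin (r + s) * cos r"
    proof -
      have "sin s = sin ((r + s) - r)" by simp
      also have "\<dots> = sin (r + s) * cos r - cos (r + s) * sin r" by (rule sin_diff)
      finally show ?thesis by simp
    qed
    also have "(sin (r + s) * cos r) *\<^sub>R c + (sin r * sin (r + s)) *\<^sub>R e = S *\<^sub>R p r 0"
      by (simp add: p_def S_def scaleR_add_right mult.commute)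
    finally have "S * (p r 0 \<bullet> x) = sin s * (c \<bullet> x) + sin r * (d0 \<bullet> x)"
      by (metis inner_add_left inner_scaleR_left)
    moreover have "sin s * cos r \<le> sin s * (c \<bullet> x)" using nx(2) rs by (intro mult_left_mono sin_ge_zero) auto
    moreover have "sin r * (cos s - 2 * \<delta>) \<le> sin r * (d0 \<bullet> x)" using d0x rs by (intro mult_left_mono sin_ge_zero) auto
    moreover have "sin s * cos r + sin r * cos s = S" by (simp add: S_def sin_add)
    moreover have "sin r * (2 * \<delta>) \<le> 1 * (2 * \<delta>)" using de by (intro mult_right_mono) auto
    ultimately have Sx: "S * (p r 0 \<bullet> x) \<ge> S - 2 * \<delta>" by (simp add: algebra_simps)
    have nsq: "(norm (x - p r 0))\<^sup>2 = 2 - 2 * (p r 0 \<bullet> x)"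
      using sum_diff_orthogonal(3)[OF pn nx(1), of r 0] by simp
    have "S * (norm (x - p r 0))\<^sup>2 = 2 * S - 2 * (S * (p r 0 \<bullet> x))" unfolding nsq by (simp add: algebra_simps)
    also have "\<dots> \<le> 4 * \<delta>" using Sx by simp
    also have "\<dots> \<le> S * (e0 / 2)\<^sup>2" using de(3) by (simp add: power_divide)
    finally have "(norm (x - p r 0))\<^sup>2 \<le> (e0 / 2)\<^sup>2" using S by simp
    then show ?thesis by (rule power2_le_imp_le) (use e0(1) in simp)
  qed
  have "sdiam M \<le> \<epsilon>"
  proof (rule e0(2))
    fix x y assume "x \<in> M" "y \<in> M"
    then have "dist x (p r 0) \<le> e0 / 2" "dist y (p r 0) \<le> e0 / 2" using near by (auto simp: dist_norm)
    then show "dist x y \<le> e0" using dist_triangle2[of x y "p r 0"] by linarith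
  qed (auto simp: M_def)
  moreover have "sint M \<noteq> {}"
  proof (rule sint_nonempty)
    show "open {x. cos r < c \<bullet> x \<and> cos s < d' \<bullet> x}"
      by (intro open_Collect_conj open_Collect_less continuous_intros)
    \<comment> \<open>The middle of the overlap, at distance \<open>\<delta> / 2\<close> inside both
      circles.\<close>
    have "cos r < cos (r - \<delta> / 2)" "cos s < cos (s - \<delta> / 2)" using rs de by (intro cos_monotone_0_pi; simp)+
    moreover have "d' \<bullet> p (r - \<delta> / 2) 0 = cos (s - \<delta> / 2)"
      unfolding pd0 by (rule arg_cong[of _ _ cos]) (simp add: \<omega>_def)
    ultimately show "p (r - \<delta> / 2) 0 \<in> {x. cos r < c \<bullet> x \<and> cos s < d' \<bullet> x}" by (simp add: pc)
  qed (use pn in \<open>auto simp: M_def\<close>)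
  ultimately have "centrally_symmetric M" using small_hyp_rot[OF hyp g(1)] M by simp
  then obtain q where q: "norm q = 1" "rotation_about q pi ` M = M" unfolding centrally_symmetric_def by auto
  define \<rho> where "\<rho> = rotation_about q pi"
  have oq: "orthogonal_transformation \<rho>" unfolding \<rho>_def by (rule rotation_pi_orth[OF q(1)])
  have qq: "q \<bullet> q = 1" using q by (simp add: norm_eq_1)
  have inv: "\<rho> (\<rho> x) = x" for x
    by (simp add: \<rho>_def rotation_pi inner_diff_right qq)
  have sa: "a \<bullet> \<rho> x = \<rho> a \<bullet> x" for a x using orth_inner[OF oq, of a "\<rho> x"] inv by simp
  have \<rho>M: "\<rho> x \<in> M" if "x \<in> M" for x using q(2) that unfolding \<rho>_def by blast
  have cr: "cos r > 0" using rs by (intro cos_gt_zero) auto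
  have cs: "cos s \<ge> 0" using rs by (intro cos_ge_zero) auto
  have csr: "cos s < cos r" using rs by (intro cos_monotone_0_pi) auto
  have "continuous (at 0) (\<lambda>\<tau>. d' \<bullet> p r \<tau>)" unfolding p_def by (intro continuous_intros)
  moreover have "cos s < d' \<bullet> p r 0" unfolding pd0 om(3) using rs de by (intro cos_monotone_0_pi) auto
  ultimately have "\<forall>\<^sub>F \<tau> in at 0. cos s < d' \<bullet> p r \<tau>"
    unfolding continuous_at by (intro order_tendstoD(1)) auto
  then obtain t0 where t0: "t0 > 0" "\<And>\<tau>. \<tau> \<noteq> 0 \<Longrightarrow> \<bar>\<tau>\<bar> < t0 \<Longrightarrow> cos s < d' \<bullet> p r \<tau>"
    unfolding eventually_at by (auto simp: dist_real_def)
  \<comment> \<open>Small positive \<tau> parametrise an arc of the circle about \<open>c\<close>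
    strictly inside the other disc.\<close>
  define T where "T = {0<..<min t0 pi}"
  define A where "A = p r ` T"
  have sr: "sin r > 0" using rs by (intro sin_gt_zero) auto
  have "inj_on (p r) T"
  proof (rule inj_onI)
    fix a b assume ab: "a \<in> T" "b \<in> T" "p r a = p r b"
    have "e \<bullet> p r a = sin r * cos a" for a by (simp add: p_def inner_add_right o)
    then have "cos a = cos b" using ab(3) sr by (metis mult_left_cancel less_irrefl)
    moreover have "0 \<le> a" "a \<le> pi" "0 \<le> b" "b \<le> pi" using ab(1,2) by (simp_all add: T_def)
    ultimately show "a = b" by (simp add: cos_inj_pi)
  qed
  moreover have "infinite T" unfolding T_def using t0(1) pi_gt_zero by (intro infinite_Ioo) simp
  ultimately have infA: "infinite A" unfolding A_def using finite_image_iff by blast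
  have A: "norm x = 1" "c \<bullet> x = cos r" "cos s < d' \<bullet> x" if "x \<in> A" for x
    using that pn pc t0(2) by (auto simp: A_def T_def)
  have AM: "x \<in> M" if "x \<in> A" for x using A[OF that] by (simp add: M_def)
  \<comment> \<open>If \<open>\<rho> x\<close> were strictly inside both discs, points slightly
    beyond the circle would also be mapped into \<open>M\<close>; as \<rho> is an involution, they
    would belong to \<open>M\<close>.\<close>
  have edge: "\<rho> c \<bullet> x = cos r \<or> \<rho> d' \<bullet> x = cos s" if xA: "x \<in> A" for x
  proof (rule ccontr)
    assume no: "\<not> ?thesis"
    have "\<rho> x \<in> M" using \<rho>M AM xA by blast
    then have lt: "cos r < \<rho> c \<bullet> x" "cos s < \<rho> d' \<bullet> x" using no by (auto simp: M_def sa)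
    obtain \<tau> where x: "x = p r \<tau>" using xA by (auto simp: A_def)
    have "continuous (at r) (\<lambda>\<theta>. \<rho> c \<bullet> p \<theta> \<tau>)" "continuous (at r) (\<lambda>\<theta>. \<rho> d' \<bullet> p \<theta> \<tau>)"
      unfolding p_def by (intro continuous_intros)+
    then have "\<forall>\<^sub>F \<theta> in at r. cos r < \<rho> c \<bullet> p \<theta> \<tau>" "\<forall>\<^sub>F \<theta> in at r. cos s < \<rho> d' \<bullet> p \<theta> \<tau>"
      using lt unfolding continuous_at x by (auto intro: order_tendstoD(1))
    then have "\<forall>\<^sub>F \<theta> in at r. cos r < \<rho> c \<bullet> p \<theta> \<tau> \<and> cos s < \<rho> d' \<bullet> p \<theta> \<tau>" by (rule eventually_conj)
    then obtain h where h: "h > 0" "\<And>\<theta>. \<theta> \<noteq> r \<Longrightarrow> \<bar>\<theta> - r\<bar> < h \<Longrightarrow> cos r < \<rho> c \<bullet> p \<theta> \<tau> \<and> cos s < \<rho> d' \<bullet> p \<theta> \<tau>"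
      unfolding eventually_at by (auto simp: dist_real_def)
    \<comment> \<open>\<open>pi / 4\<close> keeps \<theta> below \<open>pi\<close>, where the cosine
      still decreases.\<close>
    define \<theta> where "\<theta> = r + min (h / 2) (pi / 4)"
    have th: "r < \<theta>" "\<theta> < pi" "\<bar>\<theta> - r\<bar> < h" using h(1) rs by (auto simp: \<theta>_def)
    have "cos r < \<rho> c \<bullet> p \<theta> \<tau> \<and> cos s < \<rho> d' \<bullet> p \<theta> \<tau>" using h(2)[of \<theta>] th by simp
    then have "\<rho> (p \<theta> \<tau>) \<in> M" using orth_norm[OF oq] pn by (simp add: M_def sa)
    then have "p \<theta> \<tau> \<in> M" using \<rho>M inv by metis
    then have "cos r \<le> cos \<theta>" by (simp add: M_def pc)
    moreover have "cos \<theta> < cos r" using th rs by (intro cos_monotone_0_pi) auto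
    ultimately show False by simp
  qed
  have n\<rho>: "norm (\<rho> c) = 1" "norm (\<rho> d') = 1" using orth_norm[OF oq] nc nd' by auto
  have "A \<subseteq> {x \<in> A. \<rho> c \<bullet> x = cos r} \<union> {x \<in> A. \<rho> d' \<bullet> x = cos s}" using edge by auto
  then have "infinite {x \<in> A. \<rho> c \<bullet> x = cos r} \<or> infinite {x \<in> A. \<rho> d' \<bullet> x = cos s}"
    using infA finite_subset finite_UnI by blast
  then show False
  proof
    assume inf: "infinite {x \<in> A. \<rho> c \<bullet> x = cos r}"
    then obtain x where x: "x \<in> A" "\<rho> c \<bullet> x = cos r" using infinite_imp_nonempty by blast
    have "\<rho> c = c \<or> \<rho> c = - c"
      by (rule circle_determines_axis[OF nc n\<rho>(1) inf, of "cos r" "cos r"]) (use A in auto)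
    moreover have "\<rho> c \<noteq> - c" using x A(2)[OF x(1)] cr by auto
    ultimately have "\<rho> c = c" by blast
    \<comment> \<open>A fixed \<open>c\<close> is plus or minus the centre \<open>q\<close>, so
      \<open>x\<close> and \<open>\<rho> x\<close> add up to \<open>2 * cos r\<close> times
      \<open>c\<close>; this is too far from \<open>d'\<close> for both to be in the other
      disc.\<close>
    then have "2 *\<^sub>R ((q \<bullet> c) *\<^sub>R q) = 2 *\<^sub>R c" by (simp add: \<rho>_def rotation_pi scaleR_2 algebra_simps)
    then have cq: "c = (q \<bullet> c) *\<^sub>R q" by (metis scaleR_left_imp_eq zero_neq_numeral)
    define k where "k = q \<bullet> c"
    have ck: "c = k *\<^sub>R q" using cq by (simp add: k_def)
    have "k * k = 1" using o(1) unfolding ck by (simp add: qq)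
    have "\<rho> x + x = 2 *\<^sub>R ((q \<bullet> x) *\<^sub>R q)" by (simp add: \<rho>_def rotation_pi)
    also have "(q \<bullet> x) *\<^sub>R q = ((k * k) * (q \<bullet> x)) *\<^sub>R q" using \<open>k * k = 1\<close> by simp
    also have "\<dots> = (c \<bullet> x) *\<^sub>R c" unfolding ck by (simp add: mult_ac)
    finally have "d' \<bullet> (\<rho> x + x) = 2 * (cos r * cos \<omega>)" by (simp add: A(2)[OF x(1)] cos_d)
    moreover have "cos s \<le> d' \<bullet> \<rho> x" "cos s < d' \<bullet> x" using \<rho>M[OF AM[OF x(1)]] A(3)[OF x(1)] by (auto simp: M_def)
    ultimately have lt: "cos s < cos r * cos \<omega>" by (simp add: inner_add_right)
    have "cos \<omega> < cos s" using om rs by (intro cos_monotone_0_pi) auto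
    show False
    proof (cases "cos \<omega> \<ge> 0")
      case True
      then have "cos r * cos \<omega> \<le> 1 * cos \<omega>" by (intro mult_right_mono) auto
      then show False using lt \<open>cos \<omega> < cos s\<close> by simp
    next
      case False
      then have "cos r * cos \<omega> < 0" using cr by (simp add: mult_pos_neg)
      then show False using lt cs by simp
    qed
  next
    assume inf: "infinite {x \<in> A. \<rho> d' \<bullet> x = cos s}"
    then obtain x where x: "x \<in> A" "\<rho> d' \<bullet> x = cos s" using infinite_imp_nonempty by blast
    have "\<rho> d' = c \<or> \<rho> d' = - c"
      by (rule circle_determines_axis[OF nc n\<rho>(2) inf, of "cos r" "cos s"]) (use A in auto)
    \<comment> \<open>Here \<open>cos s\<close> would be plus or minus \<open>cos r\<close>, while
      \<open>0 \<le> cos s < cos r\<close>.\<close>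
    then show False using x A(2)[OF x(1)] csr cs cr by auto
  qed
qed

text \<open>The two discs may be exchanged, so neither radius is the smaller one; with equal radii a
  rotation matching the centres is the congruence.\<close>

lemma central_imp_congruent:
  assumes K: "circle_radius_le_half_pi K" and L: "circle_radius_le_half_pi L" and eps: "\<epsilon> > 0"
    and hyp: "small_hyp centrally_symmetric K L \<epsilon>"
  shows "congruent_sets K L"
proof -
  obtain c r where c: "c \<in> S2" "0 < r" "r \<le> pi / 2" "K = sdisc c r" using K unfolding circle_radius_le_half_pi_def by blast
  obtain d s where d: "d \<in> S2" "0 < s" "s \<le> pi / 2" "L = sdisc d s" using L unfolding circle_radius_le_half_pi_def by blast
  have "\<not> r < s" using central_radii_not_less[OF c(1) d(1) c(2) _ d(3) eps] hyp c(4) d(4) by blast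
  moreover have "\<not> s < r" using central_radii_not_less[OF d(1) c(1) d(2) _ c(3) eps] small_hyp_commute[OF hyp] c(4) d(4) by blast
  ultimately have "r = s" by simp
  obtain g where g: "rot g" "g c = d" using rot_transitive[of c d] c d by auto
  have "g ` K = L" using sdisc_image[OF rot_orth[OF g(1)], of c r] g \<open>r = s\<close> c d by simp
  then show ?thesis unfolding congruent_sets_def using orth_congruence[OF rot_orth[OF g(1)]] by blast
qed

theorem theorem3:
  fixes K L :: "(real ^ 3) set"
  assumes "K \<subset> S2" and "closedin (top_of_set S2) K" and "sconvex K" and "sint K \<noteq> {}"
    and "L \<subset> S2" and "closedin (top_of_set S2) L" and "sconvex L" and "sint L \<noteq> {}"
  shows
    "((\<exists>\<epsilon>>0. \<forall>\<phi> \<psi>.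
            congruence \<phi> \<and> orientation_preserving \<phi> \<and>
            congruence \<psi> \<and> orientation_preserving \<psi> \<and>
            sint (\<phi> ` K \<inter> \<psi> ` L) \<noteq> {} \<and> sdiam (\<phi> ` K \<inter> \<psi> ` L) \<le> \<epsilon> \<longrightarrow>
            has_nontrivial_symmetry (\<phi> ` K \<inter> \<psi> ` L))
      \<longleftrightarrow>
      (\<exists>\<epsilon>>0. \<forall>\<phi> \<psi>.
            congruence \<phi> \<and> orientation_preserving \<phi> \<and>
            congruence \<psi> \<and> orientation_preserving \<psi> \<and>
            sint (\<phi> ` K \<inter> \<psi> ` L) \<noteq> {} \<and> sdiam (\<phi> ` K \<inter> \<psi> ` L) \<le> \<epsilon> \<longrightarrow>
            (\<exists>C. axis_of_symmetry C (\<phi> ` K \<inter> \<psi> ` L))))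
     \<and>
     ((\<exists>\<epsilon>>0. \<forall>\<phi> \<psi>.
            congruence \<phi> \<and> orientation_preserving \<phi> \<and>
            congruence \<psi> \<and> orientation_preserving \<psi> \<and>
            sint (\<phi> ` K \<inter> \<psi> ` L) \<noteq> {} \<and> sdiam (\<phi> ` K \<inter> \<psi> ` L) \<le> \<epsilon> \<longrightarrow>
            (\<exists>C. axis_of_symmetry C (\<phi> ` K \<inter> \<psi> ` L)))
      \<longleftrightarrow>
      circle_radius_le_half_pi K \<and> circle_radius_le_half_pi L)
     \<and>
     ((\<exists>\<epsilon>>0. \<forall>\<phi> \<psi>.
            congruence \<phi> \<and> orientation_preserving \<phi> \<and>
            congruence \<psi> \<and> orientation_preserving \<psi> \<and>
            sint (\<phi> ` K \<inter> \<psi> ` L) \<noteq> {} \<and> sdiam (\<phi> ` K \<inter> \<psi> ` L) \<le> \<epsilon> \<longrightarrow>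
            centrally_symmetric (\<phi> ` K \<inter> \<psi> ` L))
      \<longrightarrow>
      circle_radius_le_half_pi K \<and> circle_radius_le_half_pi L \<and> congruent_sets K L)"
proof -
  let ?axis = "\<lambda>A. \<exists>C. axis_of_symmetry C A"
  have discs: "circle_radius_le_half_pi K \<and> circle_radius_le_half_pi L"
    if "\<epsilon> > 0" "small_hyp has_nontrivial_symmetry K L \<epsilon>" for \<epsilon>
    using small_hyp_imp_disc[OF assms that(1,2)]
      small_hyp_imp_disc[OF assms(5-8) assms(1-4) that(1) small_hyp_commute[OF that(2)]] by blast
  have axis: "small_hyp has_nontrivial_symmetry K L \<epsilon>" if "small_hyp ?axis K L \<epsilon>" for \<epsilon>
    by (rule small_hyp_mono[OF that]) (use axis_imp_nontrivial in blast)
  have central: "small_hyp has_nontrivial_symmetry K L \<epsilon>" if "small_hyp centrally_symmetric K L \<epsilon>" for \<epsilon>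
    by (rule small_hyp_mono[OF that]) (rule central_imp_nontrivial)
  \<comment> \<open>Two discs meet in a set with an axis at every size, so any positive bound
    serves; 1 is an arbitrary choice.\<close>
  have conv: "small_hyp ?axis K L 1" if "circle_radius_le_half_pi K \<and> circle_radius_le_half_pi L"
    using discs_small_hyp that by blast
  have "((\<exists>\<epsilon>>0. small_hyp has_nontrivial_symmetry K L \<epsilon>) \<longleftrightarrow> (\<exists>\<epsilon>>0. small_hyp ?axis K L \<epsilon>)) \<and>
    ((\<exists>\<epsilon>>0. small_hyp ?axis K L \<epsilon>) \<longleftrightarrow> circle_radius_le_half_pi K \<and> circle_radius_le_half_pi L) \<and>
    ((\<exists>\<epsilon>>0. small_hyp centrally_symmetric K L \<epsilon>) \<longrightarrow>
      circle_radius_le_half_pi K \<and> circle_radius_le_half_pi L \<and> congruent_sets K L)"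
    using discs axis central conv central_imp_congruent zero_less_one by meson
  then show ?thesis unfolding small_hyp_def .
qed

end
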